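(* Let $A=\{a_j\}_{j=0}^\infty$ be a sequence of real numbers. The following conditions on $A$ are equivalent. (i) For each $k\in\mathbb{N}$, $\mathcal{L}^k(A)$ is a P\'olya frequency sequence which is interpolated by a polynomial. (ii) $A$, $\mathcal{L}(A)$ and $\mathcal{L}^2(A)$ are interpolated by polynomials, and $A$ as well as $\mathcal{L}(A)$ are P\'olya frequency sequences. (iii) $A\in\mathcal{A}_0\cup\mathcal{A}_{-1}\cup\mathcal{A}_{-2}$. Moreover, if $A\in\mathcal{A}_i$ where $i\in\{-2,-1,0\}$, then $\mathcal{L}(A)\in\mathcal{A}_i$.
   Context: For a sequence $A=\{a_0,a_1,a_2,\ldots\}$ of real numbers, $\mathcal{L}(A)=\{a_0^2,\ a_1^2-a_0a_2,\ a_2^2-a_1a_3,\ a_3^2-a_2a_4,\ldots\}$, i.e. the $j$-th term of $\mathcal{L}(A)$ is $a_j^2-a_{j-1}a_{j+1}$ with $a_{-1}:=0$; $\mathcal{L}^k$ denotes the $k$-fold iterate. A sequence $\{a_k\}_{k\ge0}$ is a P\'olya frequency (PF) sequence if the infinite Toeplitz matrix $(a_{j-i})_{i,j\ge0}$ (with $a_m=0$ for $m<0$) is totally nonnegative, i.e. all its minors are nonnegative. A sequence $\{a_k\}_{k\ge0}$ is interpolated by a polynomial if there is $p\in\mathbb{R}[x]$ with $a_k=p(k)$ for all $k\ge0$. Define $\mathcal{A}_0=\{\{p(k)\}_{k\ge0}\text{ PF}: p\in\mathbb{R}[x],\ p(0)=p(1)=0\}$, $\mathcal{A}_{-1}=\{\{p(k)\}_{k\ge0}\text{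 PF}: p\in\mathbb{R}[x],\ p(-1)=p(0)=0\}$, $\mathcal{A}_{-2}=\{\{p(k)\}_{k\ge0}\text{ PF}: p\in\mathbb{R}[x],\ p(-2)=p(-1)=0\}$. *)

theory Defs
  imports
    "HOL-Computational_Algebra.Polynomial"
    "Jordan_Normal_Form.Determinant"
begin

(* The convention a_(-1) = 0 appears here as the case j = 0. *)
definition L_op :: "(nat \<Rightarrow> real) \<Rightarrow> nat \<Rightarrow> real" where
  "L_op a j = (a j)\<^sup>2 - (if j = 0 then 0 else a (j - 1)) * a (j + 1)"

definition toeplitz :: "(nat \<Rightarrow> real) \<Rightarrow> nat \<Rightarrow> nat \<Rightarrow> real" where
  "toeplitz a i j = (if i \<le> j then a (j - i) else 0)"

(* An n x n minor is given by increasing row indices r 0 < ... < r (n-1) and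
   column indices c 0 < ... < c (n-1); the values of r and c from n on are irrelevant. *)
definition totally_nonnegative :: "(nat \<Rightarrow> nat \<Rightarrow> real) \<Rightarrow> bool" where
  "totally_nonnegative M \<longleftrightarrow>
     (\<forall>n r c. strict_mono_on {..<n} r \<longrightarrow> strict_mono_on {..<n} c \<longrightarrow>
        0 \<le> det (mat n n (\<lambda>(i, j). M (r i) (c j))))"

definition polya_frequency :: "(nat \<Rightarrow> real) \<Rightarrow> bool" where
  "polya_frequency a \<longleftrightarrow> totally_nonnegative (toeplitz a)"

definition interpolates :: "real poly \<Rightarrow> (nat \<Rightarrow> real) \<Rightarrow> bool" where
  "interpolates p a \<longleftrightarrow> (\<forall>k. a k = poly p (of_nat k))"

definition poly_interpolated :: "(nat \<Rightarrow> real) \<Rightarrow> bool" where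
  "poly_interpolated a \<longleftrightarrow> (\<exists>p. interpolates p a)"

(* The three classes of interest are those with i = 0, -1, -2. *)
definition PF_class :: "int \<Rightarrow> (nat \<Rightarrow> real) set" where
  "PF_class i =
     {a. polya_frequency a \<and>
         (\<exists>p. interpolates p a \<and> poly p (of_int i) = 0 \<and> poly p (of_int (i + 1)) = 0)}"

end

theory Submission
  imports Defs
    "HOL-Computational_Algebra.Polynomial_FPS"
    "HOL-Computational_Algebra.Fundamental_Theorem_Algebra"
begin

text \<open>Since \<open>\<L> A\<close> is interpolated by \<open>q(x) = p(x)\<^sup>2 - p(x - 1) p(x + 1)\<close>, its
  convention at \<open>j = 0\<close> forces \<open>p(-1) p(1) = 0\<close>; two steps force \<open>p\<close> into one of the
  three classes. The substance is that each class is preserved. After a translation \<open>p(0) = p(1) = 0\<close>, so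
  \<open>p(x) = \<Sum>i\<le>e. c i * (x choose i + 2)\<close>. With \<open>f\<close> the generating function, being a PF
  sequence means that \<open>\<Sum>i\<le>e. c i * z\<^sup>i\<close> has all its zeros \<open>-\<rho>\<close> in \<open>[-1,
  0]\<close>: dividing out the poles of \<open>1 / f(-x)\<close> one at a time, each is seen to be the limit of the quotients
  of consecutive coefficients. A binomial identity gives the generating function of \<open>q\<close> as \<open>x\<^sup>2 G(x)
  / (1 - x)\<^sup>2\<^sup>e\<^sup>+\<^sup>3\<close>, where \<open>G(y\<^sup>2) = \<Sum>m. b m * b m - b m * b (m + 2)\<close>
  for the coefficients \<open>b\<close> of \<open>\<Prod>\<rho>. (x + \<rho> (1 - x) + y t)\<close>, \<open>x =
  y\<^sup>2\<close>. This is a value of the moment functional of the semicircle law at a polynomial all of whose zeros have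
  negative real part when \<open>Re y > 0\<close>, and such a value is nonzero. Hence \<open>G\<close> has only nonpositive
  zeros.\<close>

section \<open>Operations preserving total nonnegativity\<close>

text \<open>Total nonnegativity is not classified in general; only rational generating functions
  occur. Factors \<open>s + x\<close> with \<open>s >= 0\<close> and the factor
  \<open>1 / (1 - x)\<close> preserve it, which gives a sufficient criterion. Conversely a pole
  leaves a visible trace, the limit ratio of consecutive coefficients, while a zero leaves none;
  hence zeros of \<open>f\<close> are studied as poles of \<open>1 / f(-x)\<close>. The exponent
  \<open>2 * e + 3\<close> reflects a cancellation: \<open>p(x)^2\<close> has degree
  \<open>2 * e + 4\<close>, but \<open>p(x)^2 - p(x - 1) p(x + 1)\<close> has degree at most
  \<open>2 * e + 2\<close>. The interval \<open>[-1, 0]\<close> matters because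
  \<open>x + \<rho> (1 - x)\<close> divided by \<open>y\<close> is
  \<open>(1 - \<rho>) y + \<rho> / y\<close>, for \<open>0 <= \<rho> <= 1\<close> a convex
  combination of two points of the right half-plane. The semicircle law enters through
  \<open>t + 1/t\<close>: its even moments, the Catalan numbers, are the constant terms of
  \<open>(1 - t^2) (t + 1/t)^(2 j)\<close>. Its moment generating function is a Bessel function with
  purely imaginary zeros, hence a limit of products of factors \<open>1 + c D^2\<close> with
  \<open>c >= 0\<close>, and these keep zeros in a left half-plane.\<close>

lemma det_replace_col:
  assumes "k < n"
  shows "det (mat n n (\<lambda>(i, j). if j = k then v i else U i j)) =
    (\<Sum>i<n. v i * cofactor (mat n n (\<lambda>(i, j). U i j)) i k)"
proof -
  let ?A = "mat n n (\<lambda>(i, j). if j = k then v i else U i j)"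
  have "det ?A = (\<Sum>i<n. ?A $$ (i, k) * cofactor ?A i k)"
    by (rule laplace_expansion_column) (use assms in auto)
  also have "\<dots> = (\<Sum>i<n. v i * cofactor (mat n n (\<lambda>(i, j). U i j)) i k)"
  proof (rule sum.cong, goal_cases)
    case (2 i)
    have "mat_delete ?A i k = mat_delete (mat n n (\<lambda>(i, j). U i j)) i k"
      using 2 assms by (auto simp: mat_delete_def intro!: eq_matI)
    then show ?case using 2 assms by (simp add: cofactor_def)
  qed auto
  finally show ?thesis .
qed

lemma det_replace_row:
  assumes "k < n"
  shows "det (mat n n (\<lambda>(i, j). if i = k then v j else U i j)) =
    (\<Sum>j<n. v j * cofactor (mat n n (\<lambda>(i, j). U i j)) k j)"
proof -
  let ?A = "mat n n (\<lambda>(i, j). if i = k then v j else U i j)"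
  have "det ?A = (\<Sum>j<n. ?A $$ (k, j) * cofactor ?A k j)"
    by (rule laplace_expansion_row) (use assms in auto)
  also have "\<dots> = (\<Sum>j<n. v j * cofactor (mat n n (\<lambda>(i, j). U i j)) k j)"
  proof (rule sum.cong, goal_cases)
    case (2 j)
    have "mat_delete ?A k j = mat_delete (mat n n (\<lambda>(i, j). U i j)) k j"
      using 2 assms by (auto simp: mat_delete_def intro!: eq_matI)
    then show ?case using 2 assms by (simp add: cofactor_def)
  qed auto
  finally show ?thesis .
qed

lemma det_col_sum:
  assumes "k < n"
  shows "det (mat n n (\<lambda>(i, j). if j = k then \<Sum>l\<in>L. w l * V l i else U i j)) =
    (\<Sum>l\<in>L. w l * det (mat n n (\<lambda>(i, j). if j = k then V l i else U i j)))"
proof -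
  have "det (mat n n (\<lambda>(i, j). if j = k then \<Sum>l\<in>L. w l * V l i else U i j)) =
    (\<Sum>i<n. (\<Sum>l\<in>L. w l * V l i) * cofactor (mat n n (\<lambda>(i, j). U i j)) i k)"
    by (rule det_replace_col[OF assms])
  also have "\<dots> = (\<Sum>l\<in>L. \<Sum>i<n. w l * (V l i * cofactor (mat n n (\<lambda>(i, j). U i j)) i k))"
    by (subst sum.swap) (simp add: sum_distrib_right mult.assoc)
  also have "\<dots> = (\<Sum>l\<in>L. w l * det (mat n n (\<lambda>(i, j). if j = k then V l i else U i j)))"
    by (simp add: det_replace_col[OF assms] sum_distrib_left)
  finally show ?thesis .
qed

lemma det_equal_cols:
  assumes "k < n" "l < n" "k \<noteq> l" "\<And>i. i < n \<Longrightarrow> f i k = f i l"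
  shows "det (mat n n (\<lambda>(i, j). f i j)) = (0 :: 'a :: comm_ring_1)"
  by (rule det_identical_columns[of _ n k l]) (use assms in \<open>auto intro!: eq_vecI\<close>)

lemma det_col_add_multiple:
  fixes f :: "nat \<Rightarrow> nat \<Rightarrow> 'a :: comm_ring_1"
  assumes "k < n" "l < n" "k \<noteq> l"
  shows "det (mat n n (\<lambda>(i, j). if j = k then f i k + w * f i l else f i j)) =
    det (mat n n (\<lambda>(i, j). f i j))"
proof -
  have "det (mat n n (\<lambda>(i, j). if j = k then \<Sum>b\<in>UNIV. (if b then 1 else w) * f i (if b then k else l) else f i j))
      = (\<Sum>b\<in>UNIV. (if b then 1 else w) *
          det (mat n n (\<lambda>(i, j). if j = k then f i (if b then k else l) else f i j)))"
    by (rule det_col_sum[OF assms(1)])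
  moreover have "det (mat n n (\<lambda>(i, j). if j = k then f i l else f i j)) = 0"
    using assms by (intro det_equal_cols[of k n l]) auto
  moreover have "(\<lambda>(i, j). if j = k then f i k else f i j) = (\<lambda>(i, j). f i j)" by auto
  ultimately show ?thesis by (simp add: UNIV_bool add.commute cong: if_cong)
qed

lemma strict_mono_on_lessThan_SucI:
  fixes c :: "nat \<Rightarrow> nat"
  assumes "\<And>j. Suc j < n \<Longrightarrow> c j < c (Suc j)"
  shows "strict_mono_on {..<n} c"
proof (rule strict_mono_onI)
  fix a b assume "a \<in> {..<n}" "b \<in> {..<n}" "a < b"
  then have "b < n" "a < b" by auto
  from \<open>a < b\<close> \<open>b < n\<close> show "c a < c b"
  proof (induction b)
    case (Suc b)
    show ?case
    proof (cases "a = b")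
      case False
      with Suc have "c a < c b" by simp
      with assms[OF Suc.prems(2)] show ?thesis by simp
    qed (use assms Suc.prems in auto)
  qed simp
qed

text \<open>Columns are expanded from left to right; an expanded column can only collide with its
  left neighbour, and then the determinant vanishes.\<close>
lemma totally_nonnegative_add_prev_col:
  assumes M: "totally_nonnegative M" and s: "\<sigma> \<ge> 0"
  shows "totally_nonnegative (\<lambda>i j. \<sigma> * M i j + (if j = 0 then 0 else M i (j - 1)))"
  unfolding totally_nonnegative_def
proof (intro allI impI)
  fix n and r c :: "nat \<Rightarrow> nat"
  assume r: "strict_mono_on {..<n} r" and c: "strict_mono_on {..<n} c"
  let ?N = "\<lambda>i j. \<sigma> * M i j + (if j = 0 then 0 else M i (j - 1))"
  \<comment> \<open>\<open>k\<close> counts the leading columns already reduced to columns of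
    \<open>M\<close>. The claim ranges over all \<open>c\<close> because reducing a column may move
    its index one step to the left.\<close>
  have "0 \<le> det (mat n n (\<lambda>(i, j). if j < k then M (r i) (c j) else ?N (r i) (c j)))"
    if "k \<le> n" "strict_mono_on {..<n} c" for k c
    using that
  proof (induction k arbitrary: c rule: inc_induct)
    case base
    have "mat n n (\<lambda>(i, j). if j < n then M (r i) (c j) else ?N (r i) (c j)) =
       mat n n (\<lambda>(i, j). M (r i) (c j))" by (auto intro!: eq_matI)
    then show ?case using M r base by (simp add: totally_nonnegative_def)
  next
    case (step k)
    let ?U = "\<lambda>i j. if j < k then M (r i) (c j) else ?N (r i) (c j)"
    let ?V = "\<lambda>b i. if b then M (r i) (c k) else (if c k = 0 then 0 else M (r i) (c k - 1))"
    have "det (mat n n (\<lambda>(i, j). ?U i j)) =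
      det (mat n n (\<lambda>(i, j). if j = k then \<Sum>b\<in>UNIV. (if b then \<sigma> else 1) * ?V b i else ?U i j))"
      by (rule arg_cong[where f = det]) (auto intro!: eq_matI simp: UNIV_bool)
    also have "\<dots> = (\<Sum>b\<in>UNIV. (if b then \<sigma> else 1) * det (mat n n (\<lambda>(i, j). if j = k then ?V b i else ?U i j)))"
      by (rule det_col_sum) (use step.hyps in auto)
    also have "\<dots> = \<sigma> * det (mat n n (\<lambda>(i, j). if j = k then ?V True i else ?U i j)) +
        det (mat n n (\<lambda>(i, j). if j = k then ?V False i else ?U i j))"
      by (simp add: UNIV_bool)
    also have "\<dots> \<ge> 0"
    proof (intro add_nonneg_nonneg mult_nonneg_nonneg s)
      have "mat n n (\<lambda>(i, j). if j = k then ?V True i else ?U i j) =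
         mat n n (\<lambda>(i, j). if j < Suc k then M (r i) (c j) else ?N (r i) (c j))"
        by (auto intro!: eq_matI)
      then show "0 \<le> det (mat n n (\<lambda>(i, j). if j = k then ?V True i else ?U i j))"
        using step.IH step.prems by simp
      show "0 \<le> det (mat n n (\<lambda>(i, j). if j = k then ?V False i else ?U i j))"
      proof (cases "c k = 0")
        case True
        have "det (mat n n (\<lambda>(i, j). if j = k then ?V False i else ?U i j)) = 0"
          by (subst det_replace_col) (use step.hyps True in auto)
        then show ?thesis by simp
      next
        case ck: False
        show ?thesis
        proof (cases "k > 0 \<and> c (k - 1) = c k - 1")
          case True
          have "det (mat n n (\<lambda>(i, j). if j = k then ?V False i else ?U i j)) = 0"
            by (rule det_equal_cols[of k n "k - 1"]) (use step.hyps True ck in auto)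
          then show ?thesis by simp
        next
          case False
          define c' where "c' = c(k := c k - 1)"
          have lt: "c j < c (Suc j)" if "Suc j < n" for j
            using step.prems that by (simp add: strict_mono_on_def)
          have "strict_mono_on {..<n} c'"
          proof (rule strict_mono_on_lessThan_SucI)
            fix j assume j: "Suc j < n"
            show "c' j < c' (Suc j)"
              using lt[OF j] False ck by (auto simp: c'_def)
          qed
          moreover have "mat n n (\<lambda>(i, j). if j = k then ?V False i else ?U i j) =
             mat n n (\<lambda>(i, j). if j < Suc k then M (r i) (c' j) else ?N (r i) (c' j))"
            using ck by (auto intro!: eq_matI simp: c'_def)
          ultimately show ?thesis using step.IH by simp
        qed
      qed
    qed
    finally show ?case .
  qed
  from this[of 0 c] c show "0 \<le> det (mat n n (\<lambda>(i, j). ?N (r i) (c j)))" by simp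
qed

text \<open>Columns are expanded from right to left, after subtracting the left neighbour.\<close>
lemma totally_nonnegative_sum_cols:
  assumes M: "totally_nonnegative M"
  shows "totally_nonnegative (\<lambda>i j. \<Sum>l\<le>j. M i l)"
  unfolding totally_nonnegative_def
proof (intro allI impI)
  fix n and r c :: "nat \<Rightarrow> nat"
  assume r: "strict_mono_on {..<n} r" and c: "strict_mono_on {..<n} c"
  let ?S = "\<lambda>i j. \<Sum>l\<le>j. M i l"
  have "0 \<le> det (mat n n (\<lambda>(i, j). if j < k then ?S (r i) (c j) else M (r i) (c j)))"
    if "k \<le> n" "strict_mono_on {..<n} c" for k c
    using that
  proof (induction k arbitrary: c)
    case 0
    then show ?case using M r by (simp add: totally_nonnegative_def)
  next
    case (Suc k)
    let ?U = "\<lambda>i j. if j < Suc k then ?S (r i) (c j) else M (r i) (c j)"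
    \<comment> \<open>The columns left in the \<open>k\<close>-th partial sum once its left
      neighbour, still a partial sum, is subtracted. Any \<open>l\<close> from this range keeps the
      column indices increasing.\<close>
    define L where "L = (if k = 0 then {..c k} else {c (k - 1)<..c k})"
    have lt: "c j < c (Suc j)" if "Suc j < n" for j
      using Suc.prems that by (simp add: strict_mono_on_def)
    have "det (mat n n (\<lambda>(i, j). ?U i j)) =
      det (mat n n (\<lambda>(i, j). if j = k then \<Sum>l\<in>L. 1 * M (r i) l else ?U i j))"
    proof (cases "k = 0")
      case True
      then show ?thesis
        by (intro arg_cong[where f = det]) (auto intro!: eq_matI simp: L_def)
    next
      case False
      have "det (mat n n (\<lambda>(i, j). ?U i j)) =
          det (mat n n (\<lambda>(i, j). if j = k then ?U i k + (-1) * ?U i (k - 1) else ?U i j))"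
        by (rule det_col_add_multiple[symmetric]) (use Suc.prems False in auto)
      also have "\<dots> = det (mat n n (\<lambda>(i, j). if j = k then \<Sum>l\<in>L. 1 * M (r i) l else ?U i j))"
      proof -
        have *: "?S i (c k) = ?S i (c (k - 1)) + (\<Sum>l\<in>L. M i l)" for i
        proof -
          have "{..c k} = {..c (k - 1)} \<union> {c (k - 1)<..c k}"
            using lt[of "k - 1"] False Suc.prems by auto
          then show ?thesis using False
            by (simp add: L_def) (subst sum.union_disjoint, auto)
        qed
        show ?thesis
          by (rule arg_cong[where f = det]) (auto intro!: eq_matI simp: *)
      qed
      finally show ?thesis .
    qed
    also have "\<dots> = (\<Sum>l\<in>L. 1 * det (mat n n (\<lambda>(i, j). if j = k then M (r i) l else ?U i j)))"
      by (rule det_col_sum) (use Suc.prems in auto)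
    also have "\<dots> \<ge> 0"
    proof (intro sum_nonneg mult_nonneg_nonneg)
      fix l assume l: "l \<in> L"
      define c' where "c' = c(k := l)"
      have "strict_mono_on {..<n} c'"
      proof (rule strict_mono_on_lessThan_SucI)
        fix j assume j: "Suc j < n"
        show "c' j < c' (Suc j)"
          using lt[OF j] l by (auto simp: c'_def L_def split: if_splits)
      qed
      moreover have "mat n n (\<lambda>(i, j). if j = k then M (r i) l else ?U i j) =
         mat n n (\<lambda>(i, j). if j < k then ?S (r i) (c' j) else M (r i) (c' j))"
        by (auto intro!: eq_matI simp: c'_def)
      ultimately show "0 \<le> det (mat n n (\<lambda>(i, j). if j = k then M (r i) l else ?U i j))"
        using Suc.IH Suc.prems by simp
    qed simp
    finally show ?case .
  qed
  from this[of n c] c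
  have "0 \<le> det (mat n n (\<lambda>(i, j). if j < n then ?S (r i) (c j) else M (r i) (c j)))" by simp
  also have "mat n n (\<lambda>(i, j). if j < n then ?S (r i) (c j) else M (r i) (c j)) =
     mat n n (\<lambda>(i, j). ?S (r i) (c j))" by (auto intro!: eq_matI)
  finally show "0 \<le> det (mat n n (\<lambda>(i, j). ?S (r i) (c j)))" .
qed

text \<open>On generating functions this is multiplication by \<open>\<sigma> + x\<close>.\<close>

lemma polya_frequency_linear_factor:
  assumes "polya_frequency a" "\<sigma> \<ge> 0"
  shows "polya_frequency (\<lambda>k. \<sigma> * a k + (if k = 0 then 0 else a (k - 1)))"
proof -
  have "toeplitz (\<lambda>k. \<sigma> * a k + (if k = 0 then 0 else a (k - 1))) =
    (\<lambda>i j. \<sigma> * toeplitz a i j + (if j = 0 then 0 else toeplitz a i (j - 1)))"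
    by (auto simp: toeplitz_def fun_eq_iff diff_commute)
  then show ?thesis
    using totally_nonnegative_add_prev_col assms by (simp add: polya_frequency_def)
qed

text \<open>On generating functions this is multiplication by \<open>1 / (1 - x)\<close>.\<close>

lemma polya_frequency_partial_sums:
  assumes "polya_frequency a"
  shows "polya_frequency (\<lambda>k. \<Sum>l\<le>k. a l)"
proof -
  have "(\<Sum>l\<le>j. toeplitz a i l) = toeplitz (\<lambda>k. \<Sum>l\<le>k. a l) i j" for i j
  proof (cases "i \<le> j")
    case True
    have "(\<Sum>l\<le>j. toeplitz a i l) = (\<Sum>l\<in>{i..j}. a (l - i))"
      using True by (intro sum.mono_neutral_cong_right) (auto simp: toeplitz_def)
    also have "\<dots> = (\<Sum>l\<le>j - i. a l)"
      by (rule sum.reindex_bij_witness[of _ "\<lambda>l. l + i" "\<lambda>l. l - i"]) (use True in auto)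
    finally show ?thesis using True by (simp add: toeplitz_def)
  qed (auto simp: toeplitz_def)
  then have "toeplitz (\<lambda>k. \<Sum>l\<le>k. a l) = (\<lambda>i j. \<Sum>l\<le>j. toeplitz a i l)" by auto
  then show ?thesis
    using totally_nonnegative_sum_cols assms by (simp add: polya_frequency_def)
qed

lemma polya_frequency_scale:
  assumes "polya_frequency a" "s \<ge> 0"
  shows "polya_frequency (\<lambda>k. s * a k)"
proof -
  have "mat n n (\<lambda>(i, j). toeplitz (\<lambda>k. s * a k) (r i) (c j)) =
    s \<cdot>\<^sub>m mat n n (\<lambda>(i, j). toeplitz a (r i) (c j))" for n and r c :: "nat \<Rightarrow> nat"
    by (auto intro!: eq_matI simp: toeplitz_def)
  then show ?thesis using assms
    by (simp add: polya_frequency_def totally_nonnegative_def)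
qed

text \<open>Equal cardinality turns the inclusion into an equality, and the \<open>i\<close>-th
  value of an increasing enumeration is the element with exactly \<open>i\<close> elements of the
  set below it.\<close>

lemma strict_mono_on_unique_enumeration:
  fixes r c :: "nat \<Rightarrow> nat"
  assumes r: "strict_mono_on {..<n} r" and c: "strict_mono_on {..<n} c"
    and sub: "r ` {..<n} \<subseteq> c ` {..<n}"
  shows "i < n \<Longrightarrow> r i = c i"
proof -
  have inj: "inj_on r {..<n}" "inj_on c {..<n}"
    using strict_mono_on_imp_inj_on[OF r] strict_mono_on_imp_inj_on[OF c] by auto
  have eq: "r ` {..<n} = c ` {..<n}"
    by (rule card_subset_eq) (use sub inj in \<open>simp_all add: card_image\<close>)
  assume i: "i < n"
  have count: "card {x \<in> f ` {..<n}. x < f i} = i"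
    if "strict_mono_on {..<n} f" for f :: "nat \<Rightarrow> nat"
  proof -
    have "{x \<in> f ` {..<n}. x < f i} = f ` {..<i}"
    proof (intro equalityI subsetI)
      fix x assume "x \<in> {x \<in> f ` {..<n}. x < f i}"
      then obtain l where "l < n" "x = f l" "f l < f i" by blast
      moreover have "l < i"
        using strict_mono_on_less[OF that, of l i] i calculation by simp
      ultimately show "x \<in> f ` {..<i}" by blast
    next
      fix x assume "x \<in> f ` {..<i}"
      then obtain l where "l < i" "x = f l" by blast
      moreover have "f l < f i"
        using strict_mono_on_less[OF that, of l i] i calculation by simp
      ultimately show "x \<in> {x \<in> f ` {..<n}. x < f i}" using i by auto
    qed
    moreover have "inj_on f {..<i}"
      using strict_mono_on_imp_inj_on[OF that] i by (auto intro: inj_on_subset)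
    ultimately show ?thesis by (simp add: card_image)
  qed
  show "r i = c i"
  proof (rule ccontr)
    assume ne: "r i \<noteq> c i"
    have *: "card {x \<in> c ` {..<n}. x < r i} = i" using count[OF r] eq by simp
    have **: "card {x \<in> c ` {..<n}. x < c i} = i" using count[OF c] by simp
    have mem: "r i \<in> c ` {..<n}" "c i \<in> c ` {..<n}" using i eq by auto
    have "card {x \<in> c ` {..<n}. x < x1} < card {x \<in> c ` {..<n}. x < x2}"
      if "x1 < x2" "x1 \<in> c ` {..<n}" for x1 x2
    proof (rule psubset_card_mono)
      show "{x \<in> c ` {..<n}. x < x1} \<subset> {x \<in> c ` {..<n}. x < x2}"
        using that by (intro psubsetI) (fastforce, blast)
    qed simp
    from this[OF _ mem(1), of "c i"] this[OF _ mem(2), of "r i"] ne * ** show False by linarith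
  qed
qed

text \<open>Minors of the identity matrix: equal row and column sets give an identity matrix again,
  otherwise some row vanishes.\<close>

lemma polya_frequency_delta: "polya_frequency (\<lambda>k. if k = 0 then 1 else 0)"
  unfolding polya_frequency_def totally_nonnegative_def
proof (intro allI impI)
  fix n and r c :: "nat \<Rightarrow> nat"
  assume r: "strict_mono_on {..<n} r" and c: "strict_mono_on {..<n} c"
  have T: "toeplitz (\<lambda>k. if k = 0 then 1 else 0) i j = (if i = j then 1 else 0)" for i j
    by (simp add: toeplitz_def)
  let ?A = "mat n n (\<lambda>(i, j). toeplitz (\<lambda>k. if k = 0 then 1 else 0) (r i) (c j))"
  show "0 \<le> det ?A"
  proof (cases "r ` {..<n} \<subseteq> c ` {..<n}")
    case True
    have "r i = c i" if "i < n" for i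
      using strict_mono_on_unique_enumeration[OF r c True] that .
    moreover have "c i = c j \<longleftrightarrow> i = j" if "i < n" "j < n" for i j
      using that strict_mono_on_imp_inj_on[OF c] by (auto simp: inj_on_def)
    ultimately have "?A = 1\<^sub>m n" by (auto intro!: eq_matI simp: T)
    then show ?thesis by simp
  next
    case False
    then obtain i where i: "i < n" "r i \<notin> c ` {..<n}" by auto
    have "det ?A = (\<Sum>j<n. ?A $$ (i, j) * cofactor ?A i j)"
      by (rule laplace_expansion_row) (use i in auto)
    also have "\<dots> = 0" by (rule sum.neutral) (use i in \<open>auto simp: T\<close>)
    finally show ?thesis by simp
  qed
qed

section \<open>Poles of generating functions of Polya frequency sequences\<close>

text \<open>Only minors with consecutive columns: unlike total nonnegativity itself, this property visibly
  survives the removal of a pole.\<close>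
definition col_pf :: "(nat \<Rightarrow> real) \<Rightarrow> bool" where
  "col_pf a \<longleftrightarrow> (\<forall>n r k. strict_mono_on {..<n} r \<longrightarrow>
     0 \<le> det (mat n n (\<lambda>(i, j). toeplitz a (r i) (k + j))))"

section \<open>Complementary minors and the reciprocal series\<close>

lemma det_zero_row:
  assumes "k < n" "\<And>j. j < n \<Longrightarrow> f k j = 0"
  shows "det (mat n n (\<lambda>(i, j). f i j)) = (0 :: 'a :: comm_ring_1)"
proof -
  let ?A = "mat n n (\<lambda>(i, j). f i j)"
  have "det ?A = (\<Sum>j<n. ?A $$ (k, j) * cofactor ?A k j)"
    by (rule laplace_expansion_row) (use assms(1) in auto)
  also have "\<dots> = 0" by (rule sum.neutral) (use assms in auto)
  finally show ?thesis .
qed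

text \<open>In each Leibniz term the signs multiply to 1, since a permutation only reorders the
  factors \<open>(-1) ^ i\<close>.\<close>

lemma det_checkerboard:
  fixes f :: "nat \<Rightarrow> nat \<Rightarrow> 'a :: comm_ring_1"
  shows "det (mat n n (\<lambda>(i, j). (-1) ^ (i + j) * f i j)) = det (mat n n (\<lambda>(i, j). f i j))"
proof -
  have "(\<Prod>i = 0..<n. (-1) ^ (i + p i) * f i (p i)) = (\<Prod>i = 0..<n. f i (p i))"
    if "p permutes {0..<n}" for p
  proof -
    have "(\<Prod>i = 0..<n. (-1 :: 'a) ^ p i) = (\<Prod>i = 0..<n. (-1) ^ i)"
      using prod.permute[OF that, of "\<lambda>i. (-1 :: 'a) ^ i"] by (simp add: o_def)
    then have "(\<Prod>i = 0..<n. (-1 :: 'a) ^ (i + p i)) = (\<Prod>i = 0..<n. (-1) ^ i * (-1) ^ i)"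
      by (simp only: power_add prod.distrib)
    also have "\<dots> = (\<Prod>i = 0..<n. 1)"
      by (rule prod.cong) (simp_all add: power_mult_distrib[symmetric])
    finally show ?thesis by (simp add: prod.distrib)
  qed
  moreover have "(\<Prod>i = 0..<n. mat n n (\<lambda>(i, j). g i j) $$ (i, p i)) = (\<Prod>i = 0..<n. g i (p i))"
    if "p permutes {0..<n}" for p and g :: "nat \<Rightarrow> nat \<Rightarrow> 'a"
    by (rule prod.cong) (use permutes_in_image[OF that] in auto)
  ultimately show ?thesis
    by (simp add: det_def'[of _ n])
qed

text \<open>The first \<open>m\<close> columns are unit vectors at the rows missed by
  \<open>r\<close>; expanding along them leaves the minor of \<open>W\<close> in the rows
  \<open>r\<close>. Their signs cancel the cofactor signs. \<open>W\<close> is quantified inside the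
  existential so that \<open>s\<close> depends on \<open>r\<close> alone.\<close>

lemma det_unit_cols_complement:
  fixes r :: "nat \<Rightarrow> nat"
  assumes "strict_mono_on {..<n} r" "r ` {..<n} \<subseteq> {..<n + m}"
  shows "\<exists>s. strict_mono_on {..<m} s \<and> s ` {..<m} \<subseteq> {..<n + m} - r ` {..<n} \<and>
    (\<forall>W :: nat \<Rightarrow> nat \<Rightarrow> 'a :: comm_ring_1.
       det (mat (n + m) (n + m) (\<lambda>(i, j). if j < m then if i = s j then (-1) ^ (i + j) else 0
                                            else W i (j - m))) =
       det (mat n n (\<lambda>(i, j). W (r i) j)))"
  using assms
proof (induction m arbitrary: r)
  case 0
  have "r i = i" if "i < n" for i
    by (rule strict_mono_on_unique_enumeration[of n r "\<lambda>i. i"]) (use 0 that in \<open>auto simp: strict_mono_on_def\<close>)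
  then have "mat n n (\<lambda>(i, j). W (r i) j) = mat n n (\<lambda>(i, j). W i j)" for W :: "nat \<Rightarrow> nat \<Rightarrow> 'a"
    by (auto intro!: eq_matI)
  then show ?case by (intro exI[of _ "\<lambda>_. 0"]) (auto simp: strict_mono_on_def)
next
  case (Suc m)
  \<comment> \<open>The smallest row missed by \<open>r\<close> carries the first unit vector.
    Deleting that row and column \<open>0\<close> renumbers the remaining rows, which turns
    \<open>r\<close> into \<open>r'\<close>.\<close>
  define i0 where "i0 = (LEAST i. i \<notin> r ` {..<n})"
  have "\<exists>i < n + Suc m. i \<notin> r ` {..<n}"
  proof (rule ccontr)
    assume "\<not> ?thesis"
    then have "{..<n + Suc m} \<subseteq> r ` {..<n}" by auto
    from card_mono[OF _ this] card_image_le[of "{..<n}" r] show False by simp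
  qed
  then have i0: "i0 \<notin> r ` {..<n}" "i0 < n + Suc m"
    unfolding i0_def using LeastI[of "\<lambda>i. i \<notin> r ` {..<n}"] Least_le[of "\<lambda>i. i \<notin> r ` {..<n}"]
    by (blast, metis le_less_trans)
  have below: "i \<in> r ` {..<n}" if "i < i0" for i
    using not_less_Least[of i "\<lambda>i. i \<notin> r ` {..<n}"] that i0_def by blast
  have ne: "r i \<noteq> i0" if "i < n" for i using i0(1) that by auto
  define r' where "r' i = delete_index i0 (r i)" for i
  have ins: "insert_index i0 (r' i) = r i" if "i < n" for i
    unfolding r'_def by (rule insert_delete_index[OF ne[OF that]])
  have "strict_mono_on {..<n} r'"
  proof (rule strict_mono_onI)
    fix i j assume ij: "i \<in> {..<n}" "j \<in> {..<n}" "i < j"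
    then have "r i < r j" using Suc.prems(1) by (simp add: strict_mono_on_def)
    then show "r' i < r' j" using ne[of i] ne[of j] ij
      by (auto simp: r'_def delete_index_def)
  qed
  moreover have "r' ` {..<n} \<subseteq> {..<n + m}"
  proof
    fix x assume "x \<in> r' ` {..<n}"
    then obtain i where i: "i < n" "x = r' i" by auto
    have "r i < n + Suc m" using Suc.prems(2) i by auto
    then show "x \<in> {..<n + m}" using i0(2) ne[OF i(1)] by (auto simp: i r'_def delete_index_def)
  qed
  ultimately obtain s' where s': "strict_mono_on {..<m} s'" "s' ` {..<m} \<subseteq> {..<n + m} - r' ` {..<n}"
    and IH: "\<And>W :: nat \<Rightarrow> nat \<Rightarrow> 'a. det (mat (n + m) (n + m) (\<lambda>(i, j). if j < m then if i = s' j then (-1) ^ (i + j) else 0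
                                            else W i (j - m))) =
       det (mat n n (\<lambda>(i, j). W (r' i) j))"
    using Suc.IH[of r'] by blast
  \<comment> \<open>All rows before \<open>i0\<close> belong to \<open>r\<close>, so the other
    missed rows lie after \<open>i0\<close> and reinserting row \<open>i0\<close> simply raises them
    by one.\<close>
  have ge: "i0 \<le> s' j" if "j < m" for j
  proof (rule ccontr)
    assume lt: "\<not> i0 \<le> s' j"
    then obtain i where "i < n" "r i = s' j" using below[of "s' j"] by auto
    then have "s' j = r' i" using lt by (simp add: r'_def delete_index_def)
    then show False using s'(2) that \<open>i < n\<close> by auto
  qed
  define s where "s j = (case j of 0 \<Rightarrow> i0 | Suc j \<Rightarrow> Suc (s' j))" for j
  have "strict_mono_on {..<Suc m} s"
  proof (rule strict_mono_on_lessThan_SucI)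
    fix j assume j: "Suc j < Suc m"
    show "s j < s (Suc j)"
    proof (cases j)
      case 0
      then show ?thesis using ge[of 0] j by (simp add: s_def)
    next
      case (Suc l)
      then show ?thesis using s'(1) j by (simp add: s_def strict_mono_on_def)
    qed
  qed
  moreover have "s ` {..<Suc m} \<subseteq> {..<n + Suc m} - r ` {..<n}"
  proof
    fix x assume "x \<in> s ` {..<Suc m}"
    then obtain j where j: "j < Suc m" "x = s j" by auto
    show "x \<in> {..<n + Suc m} - r ` {..<n}"
    proof (cases j)
      case 0
      then show ?thesis using i0 j by (simp add: s_def)
    next
      case (Suc l)
      then have l: "l < m" "x = Suc (s' l)" using j by (auto simp: s_def)
      have False if i: "i < n" "r i = Suc (s' l)" for i
      proof -
        have "r' i = s' l" using i ge[OF l(1)] by (simp add: r'_def delete_index_def)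
        then show False using s'(2) l i by blast
      qed
      moreover have "s' l < n + m" using s'(2) l by auto
      ultimately show ?thesis using l by force
    qed
  qed
  moreover have "det (mat (n + Suc m) (n + Suc m) (\<lambda>(i, j). if j < Suc m then if i = s j then (-1) ^ (i + j) else 0
                                            else W i (j - Suc m))) =
       det (mat n n (\<lambda>(i, j). W (r i) j))" (is "det ?A = _") for W :: "nat \<Rightarrow> nat \<Rightarrow> 'a"
  proof -
    have "det ?A = (\<Sum>i<n + Suc m. ?A $$ (i, 0) * cofactor ?A i 0)"
      by (rule laplace_expansion_column) auto
    also have "\<dots> = (\<Sum>i<n + Suc m. if i = i0 then (-1) ^ i0 * cofactor ?A i0 0 else 0)"
      by (rule sum.cong) (auto simp: s_def)
    also have "\<dots> = det (mat_delete ?A i0 0)"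
      using i0(2) by (simp add: cofactor_def power_add[symmetric] mult.assoc[symmetric])
    also have "mat_delete ?A i0 0 = mat (n + m) (n + m) (\<lambda>(i, j). if j < m then if i = s' j then (-1) ^ (i + j) else 0
                                            else W (insert_index i0 i) (j - m))"
    proof (rule eq_matI, goal_cases)
      case (1 i j)
      then have ij: "i < n + m" "j < n + m" by auto
      have "mat_delete ?A i0 0 $$ (i, j) = (if j < m then if insert_index i0 i = Suc (s' j)
          then (-1) ^ (insert_index i0 i + Suc j) else 0 else W (insert_index i0 i) (j - m))"
        using ij by (simp add: mat_delete_def s_def insert_index_def)
      moreover have "insert_index i0 i = Suc (s' j) \<longleftrightarrow> i = s' j" if "j < m"
        using ge[OF that] by (auto simp: insert_index_def)
      moreover have "insert_index i0 (s' j) = Suc (s' j)" if "j < m"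
        using ge[OF that] by simp
      ultimately show ?case using ij by auto
    qed (auto simp: mat_delete_def)
    also have "det \<dots> = det (mat n n (\<lambda>(i, j). W (insert_index i0 (r' i)) j))"
      by (rule IH)
    also have "mat n n (\<lambda>(i, j). W (insert_index i0 (r' i)) j) = mat n n (\<lambda>(i, j). W (r i) j)"
      by (auto intro!: eq_matI simp: ins)
    finally show ?thesis .
  qed
  ultimately show ?case by blast
qed

text \<open>Truncation to size \<open>n\<close> is harmless because both factors are upper
  triangular: only \<open>l\<close> between \<open>i\<close> and \<open>j\<close>
  contributes.\<close>

lemma toeplitz_convolution:
  assumes "i < n" "j < n"
  shows "(\<Sum>l<n. toeplitz a i l * toeplitz b l j) = toeplitz (\<lambda>k. \<Sum>l\<le>k. a l * b (k - l)) i j"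
proof (cases "i \<le> j")
  case True
  have "(\<Sum>l<n. toeplitz a i l * toeplitz b l j) = (\<Sum>l\<in>{i..j}. a (l - i) * b (j - l))"
    using assms by (intro sum.mono_neutral_cong_right) (auto simp: toeplitz_def)
  also have "\<dots> = (\<Sum>l\<le>j - i. a l * b (j - i - l))"
    by (rule sum.reindex_bij_witness[of _ "\<lambda>l. l + i" "\<lambda>l. l - i"]) (use True in auto)
  finally show ?thesis using True by (simp add: toeplitz_def)
next
  case False
  then have "(\<Sum>l<n. toeplitz a i l * toeplitz b l j) = 0"
    by (intro sum.neutral) (auto simp: toeplitz_def)
  then show ?thesis using False by (simp add: toeplitz_def)
qed

text \<open>Jacobi's complementary minor identity: replacing the first columns of the inverse of the signed
  Toeplitz matrix \<open>M\<close> of \<open>a\<close> by unit vectors gives a matrix \<open>Y\<close> for which \<open>M * Y\<close> is block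
  triangular.\<close>
lemma col_pf_inverse:
  assumes a: "polya_frequency a" "a 0 > 0"
    and inv: "\<And>k. (\<Sum>l\<le>k. (-1) ^ l * a l * b (k - l)) = (if k = 0 then 1 else 0)"
  shows "col_pf b"
  unfolding col_pf_def
proof (intro allI impI)
  fix n k and r :: "nat \<Rightarrow> nat"
  assume r: "strict_mono_on {..<n} r"
  show "0 \<le> det (mat n n (\<lambda>(i, j). toeplitz b (r i) (k + j)))"
  proof (cases "r ` {..<n} \<subseteq> {..<n + k}")
    case False
    then obtain i where "i < n" "r i \<ge> n + k" by force
    then have "det (mat n n (\<lambda>(i, j). toeplitz b (r i) (k + j))) = 0"
      by (intro det_zero_row[of i]) (auto simp: toeplitz_def)
    then show ?thesis by simp
  next
    case True
    obtain s where s: "strict_mono_on {..<k} s" "s ` {..<k} \<subseteq> {..<n + k} - r ` {..<n}"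
      and dets: "\<And>W :: nat \<Rightarrow> nat \<Rightarrow> real. det (mat (n + k) (n + k) (\<lambda>(i, j). if j < k then if i = s j then (-1) ^ (i + j) else 0
                                            else W i (j - k))) = det (mat n n (\<lambda>(i, j). W (r i) j))"
      using det_unit_cols_complement[OF r True, where ?'a = real] by blast
    define a' where "a' l = (-1) ^ l * a l" for l
    define M where "M = mat (n + k) (n + k) (\<lambda>(i, j). toeplitz a' i j)"
    define Y where "Y = mat (n + k) (n + k) (\<lambda>(i, j). if j < k then if i = s j then (-1) ^ (i + j) else 0
                                            else toeplitz b i (k + (j - k)))"
    define A1 where "A1 = mat k k (\<lambda>(i, j). (-1) ^ (i + j) * toeplitz a i (s j))"
    define A3 where "A3 = mat n k (\<lambda>(i, j). toeplitz a' (i + k) (s j) * (-1) ^ (s j + j))"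
    have sj: "s j < n + k" if "j < k" for j using s(2) that by auto
    have "M * Y = four_block_mat A1 (0\<^sub>m k n) A3 (1\<^sub>m n)"
    proof (rule eq_matI, goal_cases)
      case (1 i j)
      then have ij: "i < n + k" "j < n + k" by (auto simp: A1_def)
      have MY: "(M * Y) $$ (i, j) = (\<Sum>l<n + k. M $$ (i, l) * Y $$ (l, j))"
        using ij by (simp add: M_def Y_def scalar_prod_def atLeast0LessThan)
      show ?case
      proof (cases "j < k")
        case True
        have "(\<Sum>l<n + k. M $$ (i, l) * Y $$ (l, j)) =
            (\<Sum>l<n + k. if l = s j then toeplitz a' i (s j) * (-1) ^ (s j + j) else 0)"
          by (rule sum.cong) (use ij True in \<open>auto simp: M_def Y_def\<close>)
        also have "\<dots> = toeplitz a' i (s j) * (-1) ^ (s j + j)" using sj[OF True] by simp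
        finally have *: "(M * Y) $$ (i, j) = toeplitz a' i (s j) * (-1) ^ (s j + j)" using MY by simp
        have sgn: "toeplitz a' i (s j) * (-1) ^ (s j + j) = (-1) ^ (i + j) * toeplitz a i (s j)"
        proof (cases "i \<le> s j")
          case True
          then obtain d where "s j = i + d" using le_Suc_ex by blast
          then show ?thesis by (simp add: toeplitz_def a'_def power_add power_mult_distrib[symmetric])
        qed (simp add: toeplitz_def)
        show ?thesis
          using ij True * sgn by (auto simp: four_block_mat_def A1_def A3_def)
      next
        case False
        have "(\<Sum>l<n + k. M $$ (i, l) * Y $$ (l, j)) = (\<Sum>l<n + k. toeplitz a' i l * toeplitz b l j)"
          by (rule sum.cong) (use ij False in \<open>auto simp: M_def Y_def\<close>)
        also have "\<dots> = toeplitz (\<lambda>k. \<Sum>l\<le>k. a' l * b (k - l)) i j"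
          by (rule toeplitz_convolution) (use ij in auto)
        also have "\<dots> = (if i = j then 1 else 0)"
          unfolding a'_def inv by (auto simp: toeplitz_def)
        finally show ?thesis using ij False MY
          by (auto simp: four_block_mat_def A1_def A3_def)
      qed
    qed (auto simp: M_def Y_def A1_def A3_def)
    then have "det (M * Y) = det A1 * det (1\<^sub>m n)"
      by (simp only:, intro det_four_block_mat_upper_right_zero) (auto simp: A1_def A3_def)
    \<comment> \<open>The signs in \<open>A1\<close> form a checkerboard, so \<open>det A1\<close>
      is the minor of the Toeplitz matrix of \<open>a\<close> with rows \<open>0, ..., k - 1\<close>
      and columns \<open>s\<close>.\<close>
    moreover have "det A1 \<ge> 0"
      using a(1) s(1) by (simp add: A1_def det_checkerboard polya_frequency_def totally_nonnegative_def strict_mono_on_def)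
    moreover have "det (M * Y) = det M * det Y"
      by (rule det_mult) (auto simp: M_def Y_def)
    moreover have "det M > 0"
    proof -
      have "det M = prod_list (diag_mat M)"
        by (rule det_upper_triangular) (auto simp: M_def toeplitz_def)
      also have "diag_mat M = replicate (n + k) (a 0)"
        by (intro nth_equalityI) (auto simp: diag_mat_def M_def toeplitz_def a'_def)
      finally show ?thesis using a(2) by simp
    qed
    ultimately have "det Y \<ge> 0" by (metis det_one mult.right_neutral zero_le_mult_iff less_le_not_le)
    then show ?thesis unfolding Y_def using dets[of "\<lambda>i j. toeplitz b i (k + j)"] by simp
  qed
qed

section \<open>Small minors and ratios of consecutive terms\<close>

lemma det_mat_2: "det (mat 2 2 (\<lambda>(i, j). f i j)) = f 0 0 * f 1 1 - f 0 1 * (f 1 0 :: 'a :: comm_ring_1)"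
proof -
  have "det (mat 2 2 (\<lambda>(i, j). f i j)) = (\<Sum>j<2. mat 2 2 (\<lambda>(i, j). f i j) $$ (0, j) * cofactor (mat 2 2 (\<lambda>(i, j). f i j)) 0 j)"
    by (rule laplace_expansion_row) auto
  moreover have "det (mat_delete (mat 2 2 (\<lambda>(i, j). f i j)) 0 j) = f 1 (1 - j)" if "j < 2" for j
    by (subst det_single) (use that in \<open>auto simp: mat_delete_def\<close>)
  ultimately show ?thesis by (simp add: numeral_2_eq_2 cofactor_def)
qed

lemma polya_frequency_imp_col_pf: "polya_frequency a \<Longrightarrow> col_pf a"
  unfolding col_pf_def polya_frequency_def totally_nonnegative_def
proof (intro allI impI)
  fix n k and r :: "nat \<Rightarrow> nat"
  assume a: "\<forall>n r c. strict_mono_on {..<n} r \<longrightarrow> strict_mono_on {..<n} c \<longrightarrow>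
           0 \<le> det (mat n n (\<lambda>(i, j). toeplitz a (r i) (c j)))" and r: "strict_mono_on {..<n} r"
  have "strict_mono_on {..<n} (\<lambda>j. k + j)" by (simp add: strict_mono_on_def)
  with a r show "0 \<le> det (mat n n (\<lambda>(i, j). toeplitz a (r i) (k + j)))" by blast
qed

lemma col_pf_nonneg:
  assumes "col_pf a"
  shows "a k \<ge> 0"
proof -
  have "strict_mono_on {..<Suc 0} (\<lambda>_. 0 :: nat)" by (auto simp: strict_mono_on_def)
  then have "0 \<le> det (mat (Suc 0) (Suc 0) (\<lambda>(i, j). toeplitz a 0 (k + j)))"
    using assms[unfolded col_pf_def] by fast
  also have "det (mat (Suc 0) (Suc 0) (\<lambda>(i, j). toeplitz a 0 (k + j))) = a k"
    by (subst det_single) (auto simp: toeplitz_def)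
  finally show ?thesis .
qed

text \<open>The minor on rows \<open>0\<close>, \<open>l\<close> and columns \<open>k\<close>,
  \<open>Suc k\<close>. Taking \<open>l = 1\<close> yields log-concavity; taking
  \<open>l = k\<close> shows that a zero term cannot be followed by a positive one.\<close>

lemma col_pf_2_minor:
  assumes "col_pf a" "l > 0"
  shows "a (Suc k) * toeplitz a l k \<le> a k * toeplitz a l (Suc k)"
proof -
  have "strict_mono_on {..<2} (\<lambda>i :: nat. if i = 0 then 0 else l)"
    using assms by (auto simp: strict_mono_on_def less_2_cases_iff)
  then have "0 \<le> det (mat 2 2 (\<lambda>(i, j). toeplitz a (if i = 0 then 0 else l) (k + j)))"
    using assms(1)[unfolded col_pf_def] by fast
  also have "\<dots> = a k * toeplitz a l (Suc k) - a (Suc k) * toeplitz a l k"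
    by (subst det_mat_2) (auto simp: toeplitz_def)
  finally show ?thesis by simp
qed

lemma col_pf_log_concave:
  assumes "col_pf a"
  shows "a k * a (Suc (Suc k)) \<le> (a (Suc k))\<^sup>2"
  using col_pf_2_minor[OF assms, of 1 "Suc k"] by (simp add: toeplitz_def power2_eq_square mult.commute)

lemma col_pf_zero_tail:
  assumes "col_pf a" "a 0 > 0" "a k = 0" "l \<ge> k"
  shows "a l = 0"
  using assms(4)
proof (induction l rule: dec_induct)
  case (step l)
  have "l > 0" using step assms by (cases l) auto
  then have "a (Suc l) * a 0 \<le> a l * a 1"
    using col_pf_2_minor[OF assms(1), of l l] by (simp add: toeplitz_def)
  then have "a (Suc l) \<le> 0" using step assms(2) by (simp add: mult_le_0_iff)
  with col_pf_nonneg[OF assms(1), of "Suc l"] show ?case by simp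
qed (rule assms)

lemma col_pf_ratio_convergent:
  assumes "col_pf a" and pos: "\<And>k. a k > 0"
  obtains \<mu> where "\<mu> \<ge> 0" "(\<lambda>k. a (Suc k) / a k) \<longlonglongrightarrow> \<mu>"
proof -
  have "decseq (\<lambda>k. a (Suc k) / a k)"
    using col_pf_log_concave[OF assms(1)] pos
    by (intro decseq_SucI) (simp add: field_simps power2_eq_square)
  moreover have "0 \<le> a (Suc k) / a k" for k using pos by (simp add: less_imp_le)
  ultimately obtain L where "(\<lambda>k. a (Suc k) / a k) \<longlonglongrightarrow> L" "\<And>k. L \<le> a (Suc k) / a k"
    using decseq_convergent[of "\<lambda>k. a (Suc k) / a k" 0] by auto
  moreover have "L \<ge> 0"
    using calculation(1) \<open>\<And>k. 0 \<le> a (Suc k) / a k\<close> by (intro LIMSEQ_le_const) auto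
  ultimately show ?thesis using that by blast
qed

lemma ratio_power_limit:
  fixes a :: "nat \<Rightarrow> real"
  assumes pos: "\<And>k. a k > 0" and lim: "(\<lambda>k. a (Suc k) / a k) \<longlonglongrightarrow> \<mu>"
  shows "(\<lambda>k. a (k + j) / a k) \<longlonglongrightarrow> \<mu> ^ j"
proof (induction j)
  case 0
  have "a k / a k = 1" for k using pos[of k] by simp
  then show ?case by simp
next
  case (Suc j)
  have "(\<lambda>k. a (Suc (k + j)) / a (k + j) * (a (k + j) / a k)) \<longlonglongrightarrow> \<mu> * \<mu> ^ j"
    by (intro tendsto_mult Suc.IH LIMSEQ_ignore_initial_segment[OF lim, of j])
  moreover have "a (Suc (k + j)) / a (k + j) * (a (k + j) / a k) = a (k + Suc j) / a k" for k
    using less_imp_neq[OF pos[of "k + j"]] by simp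
  ultimately show ?case by (simp only: power_Suc)
qed

text \<open>Border the minor by a row far above the others: after division by its first entry that row
  tends to the powers of \<open>\<mu>\<close>, and column operations turn the limit into a minor of the new sequence.\<close>
lemma col_pf_remove_pole:
  assumes a: "col_pf a" and pos: "\<And>k. a k > 0" and lim: "(\<lambda>k. a (Suc k) / a k) \<longlonglongrightarrow> \<mu>"
  shows "col_pf (\<lambda>k. a k - \<mu> * (if k = 0 then 0 else a (k - 1)))" (is "col_pf ?c")
  unfolding col_pf_def
proof (intro allI impI)
  fix n k and r :: "nat \<Rightarrow> nat"
  assume r: "strict_mono_on {..<n} r"
  define T where "T i q = (if q = 0 then 0 else toeplitz a i (q - 1))" for i q
  define U where "U i j = T (r (i - 1)) (k + j)" for i j
  define cof where "cof j = cofactor (mat (Suc n) (Suc n) (\<lambda>(i, j). U i j)) 0 j" for j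
  have expand: "det (mat (Suc n) (Suc n) (\<lambda>(i, j). if i = 0 then v j else U i j)) = (\<Sum>j<Suc n. v j * cof j)" for v
    unfolding cof_def by (rule det_replace_row) simp
  have nonneg: "0 \<le> (\<Sum>j<Suc n. a (k + t + j) / a (k + t) * cof j)" for t
  proof -
    \<comment> \<open>Toeplitz entries depend only on the difference of indices. Moving the given
      rows down by \<open>Suc t\<close> and the columns by \<open>t\<close> therefore reproduces
      \<open>U\<close>, while row \<open>0\<close>, free because of the extra step, reads
      \<open>a (k + t + j)\<close>.\<close>
    define R where "R i = (if i = 0 then 0 else r (i - 1) + Suc t)" for i
    have "strict_mono_on {..<Suc n} R"
    proof (rule strict_mono_onI)
      fix i j assume ij: "i \<in> {..<Suc n}" "j \<in> {..<Suc n}" "i < j"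
      show "R i < R j"
      proof (cases "i = 0")
        case False
        then have "r (i - 1) < r (j - 1)" using r ij by (intro strict_mono_onD[OF r]) auto
        then show ?thesis using ij False by (simp add: R_def)
      qed (use ij in \<open>simp add: R_def\<close>)
    qed
    then have "0 \<le> det (mat (Suc n) (Suc n) (\<lambda>(i, j). toeplitz a (R i) (k + t + j)))"
      using a by (simp add: col_pf_def)
    also have "mat (Suc n) (Suc n) (\<lambda>(i, j). toeplitz a (R i) (k + t + j)) =
        mat (Suc n) (Suc n) (\<lambda>(i, j). if i = 0 then a (k + t + j) else U i j)"
      by (rule eq_matI) (auto simp: R_def U_def T_def toeplitz_def)
    finally have "0 \<le> (\<Sum>j<Suc n. a (k + t + j) * cof j)" unfolding expand .
    then have "0 \<le> (\<Sum>j<Suc n. a (k + t + j) * cof j) / a (k + t)" using pos[of "k + t"] by simp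
    then show ?thesis by (simp only: sum_divide_distrib times_divide_eq_left)
  qed
  have "(\<lambda>t. a (k + t + j) / a (k + t)) \<longlonglongrightarrow> \<mu> ^ j" for j
    using LIMSEQ_ignore_initial_segment[OF ratio_power_limit[OF pos lim, of j], of k] by (simp add: add.commute)
  then have "(\<lambda>t. \<Sum>j<Suc n. a (k + t + j) / a (k + t) * cof j) \<longlonglongrightarrow> (\<Sum>j<Suc n. \<mu> ^ j * cof j)"
    by (intro tendsto_sum tendsto_mult_right)
  then have "0 \<le> (\<Sum>j<Suc n. \<mu> ^ j * cof j)"
    by (rule LIMSEQ_le_const) (use nonneg in auto)
  also have "\<dots> = det (mat (Suc n) (Suc n) (\<lambda>(i, j). if i = 0 then \<mu> ^ j else U i j))" (is "_ = det ?X")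
    unfolding expand ..
  \<comment> \<open>The bidiagonal factor subtracts \<open>\<mu>\<close> times the previous column.
    The bordering row of powers becomes \<open>1, 0, ..., 0\<close>, and the other rows acquire the
    entries of the new sequence.\<close>
  also have "\<dots> = det (?X * mat (Suc n) (Suc n) (\<lambda>(i, j). if i = j then 1 else if Suc i = j then -\<mu> else 0))"
    (is "_ = det (_ * ?E)")
  proof -
    have "det ?E = prod_list (diag_mat ?E)" by (rule det_upper_triangular) auto
    also have "diag_mat ?E = replicate (Suc n) 1"
      by (intro nth_equalityI) (auto simp: diag_mat_def simp del: replicate_Suc upt_Suc)
    finally have "det ?E = 1" by simp
    moreover have "det (?X * ?E) = det ?X * det ?E" by (rule det_mult) auto
    ultimately show ?thesis by simp
  qed
  also have "?X * ?E = mat (Suc n) (Suc n) (\<lambda>(i, j). if i = 0 then (if j = 0 then 1 else 0)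
      else if j = 0 then U i 0 else toeplitz ?c (r (i - 1)) (k + (j - 1)))" (is "_ = ?Z")
  proof (rule eq_matI, goal_cases)
    case (1 i j)
    then have ij: "i < Suc n" "j < Suc n" by auto
    have "(?X * ?E) $$ (i, j) = (\<Sum>l<Suc n. ?X $$ (i, l) * ?E $$ (l, j))"
      using ij by (simp add: scalar_prod_def atLeast0LessThan)
    also have "\<dots> = (\<Sum>l<Suc n. (if l = j then ?X $$ (i, j) else 0) + (if Suc l = j then - \<mu> * ?X $$ (i, j - 1) else 0))"
      by (rule sum.cong) (use ij in auto)
    also have "\<dots> = ?X $$ (i, j) + (\<Sum>l<Suc n. if Suc l = j then - \<mu> * ?X $$ (i, j - 1) else 0)"
      using ij by (simp add: sum.distrib del: sum.lessThan_Suc)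
    also have "(\<Sum>l<Suc n. if Suc l = j then - \<mu> * ?X $$ (i, j - 1) else 0) =
        (if j = 0 then 0 else - \<mu> * ?X $$ (i, j - 1))"
    proof (cases j)
      case (Suc j')
      then have "(\<Sum>l<Suc n. if Suc l = j then - \<mu> * ?X $$ (i, j - 1) else 0) =
        (\<Sum>l<Suc n. if l = j' then - \<mu> * ?X $$ (i, j - 1) else 0)" by (intro sum.cong) auto
      then show ?thesis using Suc ij by (simp del: sum.lessThan_Suc)
    qed (auto intro: sum.neutral)
    finally have *: "(?X * ?E) $$ (i, j) = ?X $$ (i, j) + (if j = 0 then 0 else - \<mu> * ?X $$ (i, j - 1))" .
    show ?case
    proof (cases "j = 0")
      case True
      then show ?thesis using * ij by auto
    next
      case False
      then obtain j' where j': "j = Suc j'" by (cases j) auto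
      show ?thesis
      proof (cases "i = 0")
        case True
        then show ?thesis using * ij j' by simp
      next
        case False
        have "T x (k + j) - \<mu> * T x (k + j') = toeplitz ?c x (k + j')" for x
          by (auto simp: T_def j' toeplitz_def)
        then show ?thesis using * ij j' False by (simp add: U_def)
      qed
    qed
  qed auto
  also have "det ?Z = (\<Sum>j<Suc n. ?Z $$ (0, j) * cofactor ?Z 0 j)"
    by (rule laplace_expansion_row) auto
  also have "\<dots> = (\<Sum>j<Suc n. if j = 0 then cofactor ?Z 0 0 else 0)"
    by (rule sum.cong) auto
  also have "\<dots> = det (mat_delete ?Z 0 0)" by (simp add: cofactor_def del: sum.lessThan_Suc)
  also have "mat_delete ?Z 0 0 = mat n n (\<lambda>(i, j). toeplitz ?c (r i) (k + j))"
    by (rule eq_matI) (auto simp: mat_delete_def)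
  finally show "0 \<le> det (mat n n (\<lambda>(i, j). toeplitz ?c (r i) (k + j)))" .
qed

text \<open>The ratio of consecutive terms converges to some \<open>\<mu>\<close>, and dividing the linear recurrence
  satisfied by \<open>a\<close> by \<open>a k\<close> shows in the limit that \<open>1 / \<mu>\<close> is a root of \<open>q\<close>.\<close>
lemma col_pf_rational_denominator:
  fixes q N :: "real poly"
  assumes "col_pf a" "a 0 > 0" "fps_of_poly q * Abs_fps a = fps_of_poly N"
    "coprime q N" "coeff q 0 \<noteq> 0"
  shows "\<exists>ls. (\<forall>l\<in>set ls. l > 0) \<and> q = smult (coeff q 0) (\<Prod>l\<leftarrow>ls. [:1, -l:])"
  using assms
proof (induction "degree q" arbitrary: q a)
  case 0
  then obtain x where "q = [:x:]" by (metis degree_eq_zeroE)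
  then show ?case by (intro exI[of _ "[]"]) simp
next
  case (Suc m q a)
  have q0: "q \<noteq> 0" using Suc.prems by auto
  \<comment> \<open>A zero term would make the series a polynomial, so \<open>q\<close>, of positive
    degree, would divide the coprime polynomial \<open>N\<close>.\<close>
  have nz: "a k \<noteq> 0" for k
  proof
    assume k: "a k = 0"
    define p where "p = (\<Sum>l<k. monom (a l) l)"
    have "Abs_fps a = fps_of_poly p"
    proof (rule fps_ext)
      fix n
      show "fps_nth (Abs_fps a) n = fps_nth (fps_of_poly p) n"
        using col_pf_zero_tail[OF Suc.prems(1,2) k, of n] by (auto simp: p_def coeff_sum)
    qed
    then have "fps_of_poly (q * p) = fps_of_poly N" using Suc.prems(3) by (simp add: fps_of_poly_mult)
    then have "q dvd N" by (auto simp: fps_of_poly_eq_iff)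
    then have "is_unit q" using Suc.prems(4) by (meson coprime_common_divisor dvd_refl)
    then show False using Suc.hyps(2) by (simp add: is_unit_iff_degree q0)
  qed
  have pos: "a k > 0" for k using nz[of k] col_pf_nonneg[OF Suc.prems(1), of k] by simp
  obtain \<mu> where \<mu>: "\<mu> \<ge> 0" "(\<lambda>k. a (Suc k) / a k) \<longlonglongrightarrow> \<mu>"
    by (rule col_pf_ratio_convergent[OF Suc.prems(1) pos])
  let ?d = "degree q"
  have "(\<Sum>i\<le>?d. coeff q i * \<mu> ^ (?d - i)) = 0"
  proof -
    have "(\<lambda>k. \<Sum>i\<le>?d. coeff q i * (a (k + (?d - i)) / a k)) \<longlonglongrightarrow> (\<Sum>i\<le>?d. coeff q i * \<mu> ^ (?d - i))"
      by (intro tendsto_sum tendsto_mult_left ratio_power_limit pos \<mu>)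
    moreover have "(\<Sum>i\<le>?d. coeff q i * (a (k + (?d - i)) / a k)) = 0" if "k > degree N" for k
    proof -
      have "(\<Sum>i\<le>k + ?d. coeff q i * a (k + ?d - i)) = fps_nth (fps_of_poly q * Abs_fps a) (k + ?d)"
        by (simp add: fps_mult_nth atMost_atLeast0)
      also have "\<dots> = 0" unfolding Suc.prems(3) using that by (simp add: coeff_eq_0)
      also have "(\<Sum>i\<le>k + ?d. coeff q i * a (k + ?d - i)) = (\<Sum>i\<le>?d. coeff q i * a (k + (?d - i)))"
        by (intro sum.mono_neutral_cong_right) (auto simp: coeff_eq_0)
      finally have "(\<Sum>i\<le>?d. coeff q i * a (k + (?d - i))) / a k = 0" by simp
      then show ?thesis by (simp only: sum_divide_distrib times_divide_eq_right)
    qed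
    then have "(\<lambda>k. \<Sum>i\<le>?d. coeff q i * (a (k + (?d - i)) / a k)) \<longlonglongrightarrow> 0"
      by (intro tendsto_eventually eventually_sequentiallyI[of "Suc (degree N)"]) auto
    ultimately show ?thesis using LIMSEQ_unique by blast
  qed
  \<comment> \<open>If \<open>\<mu>\<close> were 0, the limit relation would collapse to the
    vanishing of the leading coefficient of \<open>q\<close>.\<close>
  moreover have "(\<Sum>i\<le>?d. coeff q i * \<mu> ^ (?d - i)) = coeff q ?d" if "\<mu> = 0"
  proof -
    have "(\<Sum>i\<le>?d. coeff q i * \<mu> ^ (?d - i)) = (\<Sum>i\<le>?d. if i = ?d then coeff q ?d else 0)"
      by (rule sum.cong) (auto simp: that)
    then show ?thesis by simp
  qed
  ultimately have \<mu>0: "\<mu> > 0" using \<mu>(1) q0 by (cases "\<mu> = 0") auto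
  have "poly q (1 / \<mu>) = (\<Sum>i\<le>?d. coeff q i * \<mu> ^ (?d - i)) / \<mu> ^ ?d"
    unfolding poly_altdef sum_divide_distrib
  proof (rule sum.cong)
    fix i assume "i \<in> {..?d}"
    then have "\<mu> ^ ?d = \<mu> ^ (?d - i) * \<mu> ^ i" by (simp add: power_add[symmetric])
    then show "coeff q i * (1 / \<mu>) ^ i = coeff q i * \<mu> ^ (?d - i) / \<mu> ^ ?d"
      using \<mu>0 by (simp add: power_one_over)
  qed simp
  then have "poly q (1 / \<mu>) = 0" using \<open>(\<Sum>i\<le>?d. coeff q i * \<mu> ^ (?d - i)) = 0\<close> by simp
  then have "[:- (1 / \<mu>), 1:] dvd q" by (simp add: poly_eq_0_iff_dvd)
  moreover have "[:1, -\<mu>:] = smult (-\<mu>) [:- (1 / \<mu>), 1:]" using \<mu>0 by simp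
  ultimately have "[:1, -\<mu>:] dvd q" using \<mu>0 by (simp only: smult_dvd_iff) simp
  then obtain q' where q': "q = [:1, -\<mu>:] * q'" by blast
  define c where "c k = a k - \<mu> * (if k = 0 then 0 else a (k - 1))" for k
  have q'0: "q' \<noteq> 0" using q' q0 by auto
  have "degree q = degree [:1, -\<mu>:] + degree q'"
    unfolding q' by (rule degree_mult_eq) (use q'0 in auto)
  then have "m = degree q'" using Suc.hyps(2) \<mu>0 by simp
  moreover have "col_pf c" unfolding c_def by (rule col_pf_remove_pole[OF Suc.prems(1) pos \<mu>(2)])
  moreover have "c 0 > 0" using Suc.prems(2) by (simp add: c_def)
  moreover have "fps_of_poly q' * Abs_fps c = fps_of_poly N"
  proof -
    have "Abs_fps c = fps_of_poly [:1, -\<mu>:] * Abs_fps a"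
    proof (rule fps_ext)
      fix n
      show "fps_nth (Abs_fps c) n = fps_nth (fps_of_poly [:1, -\<mu>:] * Abs_fps a) n"
        by (cases n) (simp_all add: c_def fps_of_poly_pCons ring_distribs mult.assoc fps_X_mult_nth)
    qed
    then have "fps_of_poly q' * Abs_fps c = fps_of_poly q * Abs_fps a"
      by (simp only: q' fps_of_poly_mult ac_simps)
    then show ?thesis using Suc.prems(3) by simp
  qed
  moreover have "coprime q' N" using Suc.prems(4) unfolding q' by (rule coprime_divisors[OF dvd_triv_right dvd_refl])
  moreover have c0: "coeff q 0 = coeff q' 0" unfolding q' by (simp add: coeff_mult)
  ultimately obtain ls where ls: "\<forall>l\<in>set ls. l > 0" "q' = smult (coeff q' 0) (\<Prod>l\<leftarrow>ls. [:1, -l:])"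
    using Suc.hyps(1)[of q' c] Suc.prems(5) by auto
  have "q = [:1, -\<mu>:] * smult (coeff q 0) (\<Prod>l\<leftarrow>ls. [:1, -l:])"
    by (rule trans[OF q' arg_cong[OF ls(2), of "(*) [:1, -\<mu>:]", folded c0]])
  then have "q = smult (coeff q 0) (\<Prod>l\<leftarrow>\<mu> # ls. [:1, -l:])"
    by (simp only: list.simps(9) mult_smult_right prod_list.Cons)
  then show ?case using ls(1) \<mu>0 by (intro exI[of _ "\<mu> # ls"]) auto
qed

section \<open>The semicircle functional on polynomials with zeros in a half-plane\<close>

lemma complex_poly_factor_list:
  fixes p :: "complex poly"
  assumes "p \<noteq> 0"
  obtains zs where "p = smult (lead_coeff p) (\<Prod>z\<leftarrow>zs. [:-z, 1:])" "length zs = degree p"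
    "\<And>z. z \<in> set zs \<Longrightarrow> poly p z = 0"
proof -
  obtain A where A: "size A = degree p" "p = smult (lead_coeff p) (\<Prod>x\<in>#A. [:-x, 1:])"
    using alg_closed_imp_factorization[OF assms] by blast
  obtain zs where zs: "mset zs = A" using ex_mset by blast
  have p: "p = smult (lead_coeff p) (\<Prod>z\<leftarrow>zs. [:-z, 1:])"
    using A(2) unfolding zs[symmetric] by (simp only: prod_mset_prod_list mset_map[symmetric])
  have "poly (\<Prod>z\<leftarrow>zs. [:-z, 1:]) z = 0" if "z \<in> set zs" for z
    using that by (induction zs) auto
  then have "poly p z = 0" if "z \<in> set zs" for z
    using that by (subst p) simp
  then show ?thesis using that p A(1) zs by (metis size_mset)
qed

text \<open>The Gauss-Lucas argument: \<open>p' / p\<close> is the sum of the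
  \<open>1 / (z - \<zeta>)\<close>, and \<open>Re (cnj u / w) = Re (u * w) / |w|^2\<close>. The
  non-strict bound is carried along because the empty sum is 0.\<close>

lemma logarithmic_derivative_Re:
  fixes u z :: complex
  assumes "\<And>\<zeta>. \<zeta> \<in> set zs \<Longrightarrow> Re (u * (z - \<zeta>)) > 0"
  defines "p \<equiv> (\<Prod>\<zeta>\<leftarrow>zs. [:-\<zeta>, 1:])"
  shows "poly p z \<noteq> 0 \<and> Re (cnj u * (poly (pderiv p) z / poly p z)) \<ge> 0 \<and>
    (zs \<noteq> [] \<longrightarrow> Re (cnj u * (poly (pderiv p) z / poly p z)) > 0)"
  using assms(1) unfolding p_def
proof (induction zs)
  case (Cons \<zeta> zs)
  let ?q = "\<Prod>\<zeta>\<leftarrow>zs. [:-\<zeta>, 1:]"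
  have IH: "poly ?q z \<noteq> 0" "Re (cnj u * (poly (pderiv ?q) z / poly ?q z)) \<ge> 0"
    using Cons by auto
  have pos: "Re (u * (z - \<zeta>)) > 0" using Cons.prems by simp
  then have nz: "z - \<zeta> \<noteq> 0" by auto
  have "poly (pderiv ([:-\<zeta>, 1:] * ?q)) z / poly ([:-\<zeta>, 1:] * ?q) z
      = 1 / (z - \<zeta>) + poly (pderiv ?q) z / poly ?q z"
    using nz IH(1) by (simp add: pderiv_mult pderiv_pCons field_simps del: mult_pCons_left)
  moreover have "Re (cnj u * (1 / (z - \<zeta>))) > 0"
  proof -
    have "cnj u * (1 / (z - \<zeta>)) = cnj (u * (z - \<zeta>)) / of_real ((cmod (z - \<zeta>))\<^sup>2)"
      using nz by (simp add: complex_div_cnj[of 1])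
    then have "Re (cnj u * (1 / (z - \<zeta>))) = Re (u * (z - \<zeta>)) / (cmod (z - \<zeta>))\<^sup>2"
      by (simp only: Re_divide_of_real cnj.simps)
    then show ?thesis using pos nz by simp
  qed
  moreover have "poly ([:-\<zeta>, 1:] * ?q) z \<noteq> 0" using nz IH(1) by simp
  ultimately show ?case using IH(2)
    by (simp add: ring_distribs del: mult_pCons_left)
qed simp

text \<open>At a zero outside the half-plane the logarithmic derivative would be
  \<open>- 1 / s\<close>, which lies on the wrong side. The condition on \<open>s\<close> is not
  strict: if \<open>Re (u * s) = 0\<close>, both \<open>s\<close> and \<open>-s\<close> are
  admissible, and this boundary case is the one used below.\<close>

lemma add_smult_pderiv_roots:
  fixes p :: "complex poly"
  assumes p: "p \<noteq> 0" and roots: "\<And>z. poly p z = 0 \<Longrightarrow> Re (u * z) \<le> \<kappa>"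
    and s: "Re (u * s) \<ge> 0" and z: "poly (p + smult s (pderiv p)) z = 0"
  shows "Re (u * z) \<le> \<kappa>"
proof (rule ccontr)
  assume neg: "\<not> ?thesis"
  obtain zs where zs: "p = smult (lead_coeff p) (\<Prod>z\<leftarrow>zs. [:-z, 1:])" "\<And>z. z \<in> set zs \<Longrightarrow> poly p z = 0"
    using complex_poly_factor_list[OF p] by metis
  define q where "q = (\<Prod>z\<leftarrow>zs. [:-z, 1:])"
  have l0: "lead_coeff p \<noteq> 0" using p by simp
  have "Re (u * (z - \<zeta>)) > 0" if "\<zeta> \<in> set zs" for \<zeta>
    using roots[OF zs(2)[OF that]] neg by (simp add: algebra_simps)
  from logarithmic_derivative_Re[OF this]
  have q: "poly q z \<noteq> 0" "zs \<noteq> [] \<Longrightarrow> Re (cnj u * (poly (pderiv q) z / poly q z)) > 0"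
    unfolding q_def by blast+
  have "p + smult s (pderiv p) = smult (lead_coeff p) (q + smult s (pderiv q))"
    by (subst (1 2) zs(1)) (simp add: q_def[symmetric] pderiv_smult smult_add_right mult.commute)
  with z l0 have eq: "poly q z + s * poly (pderiv q) z = 0" by simp
  have "zs \<noteq> []" using eq q(1) unfolding q_def by auto
  note pos = q(2)[OF this]
  have s0: "s \<noteq> 0" using eq q(1) by auto
  have "poly (pderiv q) z / poly q z = - (1 / s)"
    using eq q(1) s0 by (simp add: field_simps eq_neg_iff_add_eq_0)
  moreover have "cnj u * (- (1 / s)) = - (cnj (u * s) / of_real ((cmod s)\<^sup>2))"
    by (simp add: complex_div_cnj[of 1])
  then have "Re (cnj u * (- (1 / s))) = - (Re (u * s) / (cmod s)\<^sup>2)"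
    by (simp only: Re_divide_of_real uminus_complex.sel) simp
  moreover have "Re (u * s) / (cmod s)\<^sup>2 \<ge> 0" using s by simp
  ultimately show False using pos by simp
qed

lemma coeff_add_smult_pderiv_top:
  fixes p :: "'a :: {comm_semiring_1,semiring_no_zero_divisors,semiring_char_0} poly"
  shows "coeff (p + smult s (pderiv p)) (degree p) = lead_coeff p"
    and "degree (p + smult s (pderiv p)) \<le> degree p"
proof -
  show "coeff (p + smult s (pderiv p)) (degree p) = lead_coeff p"
    by (simp add: coeff_pderiv coeff_eq_0)
  have "degree (pderiv p) \<le> degree p" by (simp add: degree_pderiv)
  then show "degree (p + smult s (pderiv p)) \<le> degree p"
    by (meson degree_add_le degree_smult_le order_refl order_trans)
qed

lemma monic_add_smult_pderiv:
  fixes p :: "complex poly"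
  assumes "lead_coeff p = 1"
  shows "lead_coeff (p + smult s (pderiv p)) = 1" "degree (p + smult s (pderiv p)) = degree p"
proof -
  have "coeff (p + smult s (pderiv p)) (degree p) = 1"
    using assms coeff_add_smult_pderiv_top(1)[of p s] by simp
  then have "degree p \<le> degree (p + smult s (pderiv p))" by (intro le_degree) simp
  with coeff_add_smult_pderiv_top(2)[of p s] show d: "degree (p + smult s (pderiv p)) = degree p"
    by simp
  show "lead_coeff (p + smult s (pderiv p)) = 1"
    unfolding d by fact
qed

text \<open>Over the complex numbers \<open>1 + c D^2\<close> factors into \<open>1 + s D\<close>
  and \<open>1 - s D\<close> with \<open>s\<close> purely imaginary, and each factor keeps the
  half-plane.\<close>

lemma add_smult_pderiv2_roots:
  fixes p :: "complex poly"
  assumes p: "lead_coeff p = 1" and roots: "\<And>z. poly p z = 0 \<Longrightarrow> Re z \<le> \<kappa>" and c: "c \<ge> 0"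
  defines "q \<equiv> p + smult (of_real c) (pderiv (pderiv p))"
  shows "lead_coeff q = 1" "degree q = degree p" "\<And>z. poly q z = 0 \<Longrightarrow> Re z \<le> \<kappa>"
proof -
  define s where "s = \<i> * of_real (sqrt c)"
  define r where "r = p + smult s (pderiv p)"
  have "s * s = - of_real c"
    using c by (simp add: s_def algebra_simps flip: of_real_mult)
  then have q: "q = r + smult (-s) (pderiv r)"
    by (simp add: q_def r_def pderiv_add pderiv_smult smult_add_right)
  have r: "lead_coeff r = 1" "degree r = degree p"
    unfolding r_def by (rule monic_add_smult_pderiv[OF p])+
  show "lead_coeff q = 1" "degree q = degree p"
    unfolding q using monic_add_smult_pderiv[OF r(1), of "-s"] r(2) by auto
  have nz: "p \<noteq> 0" "r \<noteq> 0" using p r by auto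
  have r_roots: "Re (1 * z) \<le> \<kappa>" if "poly r z = 0" for z
    by (rule add_smult_pderiv_roots[of p 1 \<kappa> s]) (use nz that roots in \<open>auto simp: r_def s_def\<close>)
  show "Re z \<le> \<kappa>" if "poly q z = 0" for z
    using add_smult_pderiv_roots[of r 1 \<kappa> "-s" z] nz r_roots that q by (simp add: s_def)
qed

text \<open>The sum below is the value at 0 of \<open>M(D\<^sup>2) p\<close>, where \<open>D\<close> is differentiation.\<close>
lemma even_differential_operator_bound:
  fixes p :: "complex poly"
  assumes "\<And>c. c \<in> set cs \<Longrightarrow> c \<ge> 0" "lead_coeff p = 1" "\<And>z. poly p z = 0 \<Longrightarrow> Re z \<le> - \<epsilon>" "\<epsilon> \<ge> 0"
    "degree p \<le> N"
  shows "\<epsilon> ^ degree p \<le> norm (\<Sum>j\<le>N. coeff (\<Prod>c\<leftarrow>cs. [:1, of_real c:]) j * (fact (2 * j) * coeff p (2 * j)))"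
  using assms
proof (induction cs arbitrary: p)
  case Nil
  have "(\<Sum>j\<le>N. coeff (\<Prod>c\<leftarrow>[]. [:1, of_real c:]) j * (fact (2 * j) * coeff p (2 * j))) =
      (\<Sum>j\<le>N. if j = 0 then coeff p 0 else 0)"
    by (rule sum.cong) (auto simp: coeff_1)
  also have "\<dots> = coeff p 0" by simp
  also have "\<epsilon> ^ degree p \<le> norm (coeff p 0)"
  proof -
    have "p \<noteq> 0" using Nil.prems(2) by auto
    then obtain zs where zs: "p = smult (lead_coeff p) (\<Prod>z\<leftarrow>zs. [:-z, 1:])" "length zs = degree p"
      "\<And>z. z \<in> set zs \<Longrightarrow> poly p z = 0"
      using complex_poly_factor_list by metis
    have "\<epsilon> \<le> norm z" if "z \<in> set zs" for z
      using Nil.prems(3)[OF zs(3)[OF that]] abs_Re_le_cmod[of z] by linarith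
    then have "\<epsilon> ^ length zs \<le> norm (poly (\<Prod>z\<leftarrow>zs. [:-z, 1:]) 0)"
      using \<open>\<epsilon> \<ge> 0\<close> by (induction zs) (auto simp: norm_mult intro!: mult_mono)
    moreover have "p = (\<Prod>z\<leftarrow>zs. [:-z, 1:])" using zs(1) Nil.prems(2) by simp
    ultimately show ?thesis using zs(2) by (simp add: poly_0_coeff_0)
  qed
  finally show ?case .
next
  case (Cons c cs)
  define q where "q = p + smult (of_real c) (pderiv (pderiv p))"
  define M where "M = (\<Prod>c\<leftarrow>cs. [:1, complex_of_real c:])"
  note q = add_smult_pderiv2_roots[OF Cons.prems(2,3), of c, folded q_def]
  have c: "c \<ge> 0" using Cons.prems by simp
  have shift: "coeff (pCons 0 (smult x M)) n = x * coeff (pCons 0 M) n" for x n by (cases n) auto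
  have "\<epsilon> ^ degree q \<le> norm (\<Sum>j\<le>N. coeff M j * (fact (2 * j) * coeff q (2 * j)))"
    unfolding M_def by (rule Cons.IH) (use Cons.prems q c in auto)
  also have "(\<Sum>j\<le>N. coeff M j * (fact (2 * j) * coeff q (2 * j))) =
     (\<Sum>j\<le>N. coeff M j * (fact (2 * j) * coeff p (2 * j))) +
     of_real c * (\<Sum>j\<le>N. coeff M j * (fact (2 * Suc j) * coeff p (2 * Suc j)))"
    by (simp add: q_def coeff_pderiv sum.distrib sum_distrib_left algebra_simps)
  \<comment> \<open>The summand \<open>j = N\<close> vanishes because \<open>2 * Suc N\<close>
    exceeds the degree of \<open>p\<close>; this makes room for the index shift.\<close>
  also have "(\<Sum>j\<le>N. coeff M j * (fact (2 * Suc j) * coeff p (2 * Suc j))) =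
     (\<Sum>j<N. coeff M j * (fact (2 * Suc j) * coeff p (2 * Suc j)))"
    using Cons.prems(5) by (simp add: lessThan_Suc_atMost[symmetric] coeff_eq_0)
  also have "\<dots> = (\<Sum>j\<le>N. coeff (pCons 0 M) j * (fact (2 * j) * coeff p (2 * j)))"
    by (simp add: sum.atMost_shift)
  also have "(\<Sum>j\<le>N. coeff M j * (fact (2 * j) * coeff p (2 * j))) + of_real c * \<dots> =
     (\<Sum>j\<le>N. coeff ([:1, of_real c:] * M) j * (fact (2 * j) * coeff p (2 * j)))"
    by (simp add: shift sum.distrib sum_distrib_left algebra_simps)
  finally show ?case using q(2) c by (simp add: M_def)
qed

text \<open>The binomial theorem for \<open>(1 + D)^k\<close>: only the term with
  \<open>D^(n - l)\<close> takes \<open>x^n\<close> to a multiple of \<open>x^l\<close>.\<close>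

lemma pderiv_shift_monom_coeff:
  "coeff (((\<lambda>p. p + smult 1 (pderiv p)) ^^ k) (monom 1 n)) l =
    (if l \<le> n then of_nat (k choose (n - l)) * fact n / fact l else (0 :: 'a :: field_char_0))"
proof (induction k arbitrary: l)
  case 0
  then show ?case by (auto simp: binomial_eq_0_iff)
next
  case (Suc k)
  have "coeff (((\<lambda>p. p + smult 1 (pderiv p)) ^^ Suc k) (monom 1 n)) l =
      coeff (((\<lambda>p. p + smult 1 (pderiv p)) ^^ k) (monom 1 n)) l +
      of_nat (Suc l) * coeff (((\<lambda>p. p + smult 1 (pderiv p)) ^^ k) (monom (1 :: 'a) n)) (Suc l)"
    by (simp add: coeff_pderiv)
  also have "\<dots> = (if l \<le> n then of_nat (Suc k choose (n - l)) * fact n / fact l else 0)"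
  proof (cases "Suc l \<le> n")
    case True
    then have nl: "n - l = Suc (n - Suc l)" by simp
    have "of_nat (Suc l) * (of_nat (k choose (n - Suc l)) * fact n / fact (Suc l)) =
      of_nat (k choose (n - Suc l)) * fact n / (fact l :: 'a)"
      by (simp add: field_simps del: of_nat_Suc)
    then show ?thesis using True unfolding Suc.IH nl
      by (simp add: add_divide_distrib ring_distribs del: fact_Suc)
  next
    case False
    then show ?thesis unfolding Suc.IH by (cases "l = n") auto
  qed
  finally show ?case .
qed

text \<open>Up to a constant this is the Laguerre polynomial with parameter 1 at \<open>-z\<close>; times \<open>z\<close> it is
  proportional to \<open>(1 + D)\<^sup>m z\<^sup>m\<^sup>+\<^sup>1\<close>, and \<open>1 + D\<close> keeps zeros real.\<close>
lemma binomial_Suc_fact_poly_real_rooted: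
  assumes "(\<Sum>j\<le>m. of_nat (m choose j) / fact (Suc j) * z ^ j) = (0 :: complex)"
  shows "Im z = 0"
proof -
  define T where "T = (\<lambda>p :: complex poly. p + smult 1 (pderiv p))"
  define n where "n = Suc m"
  \<comment> \<open>The two values of \<open>u\<close> describe the closed upper and lower
    half-planes, so together they say that all zeros are real. The choice \<open>s = 1\<close> lies
    on the common boundary.\<close>
  have inv: "lead_coeff ((T ^^ k) (monom 1 n)) = 1 \<and>
     (\<forall>u\<in>{\<i>, -\<i>}. \<forall>z. poly ((T ^^ k) (monom 1 n)) z = 0 \<longrightarrow> Re (u * z) \<le> 0)" for k
  proof (induction k)
    case 0
    then show ?case by (auto simp: poly_monom degree_monom_eq)
  next
    case (Suc k)
    let ?p = "(T ^^ k) (monom 1 n)"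
    have nz: "?p \<noteq> 0" using Suc by auto
    have "Re (u * z) \<le> 0" if "u \<in> {\<i>, -\<i>}" "poly ((T ^^ Suc k) (monom 1 n)) z = 0" for u z
    proof (rule add_smult_pderiv_roots[OF nz, of u 0 1 z])
      show "\<And>z. poly ?p z = 0 \<Longrightarrow> Re (u * z) \<le> 0" using Suc that(1) by blast
      show "0 \<le> Re (u * 1)" using that(1) by auto
      show "poly (?p + smult 1 (pderiv ?p)) z = 0" using that(2) by (simp add: T_def)
    qed
    moreover have "lead_coeff ((T ^^ Suc k) (monom 1 n)) = 1"
      using monic_add_smult_pderiv(1)[of ?p 1] Suc by (simp add: T_def)
    ultimately show ?case by blast
  qed
  let ?p = "(T ^^ m) (monom 1 n)"
  have c: "coeff ?p l = (if l \<le> n then of_nat (m choose (n - l)) * fact n / fact l else 0)" for l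
    unfolding T_def by (rule pderiv_shift_monom_coeff)
  have "degree ?p \<le> n" by (rule degree_le) (simp add: c)
  then have "poly ?p z = (\<Sum>l\<le>n. coeff ?p l * z ^ l)"
    unfolding poly_altdef by (intro sum.mono_neutral_left) (auto simp: coeff_eq_0)
  also have "\<dots> = (\<Sum>j\<le>m. coeff ?p (Suc j) * z ^ Suc j)"
  proof -
    have "coeff ?p 0 = 0" unfolding c by (simp add: n_def)
    then show ?thesis unfolding n_def by (subst sum.atMost_Suc_shift) simp
  qed
  also have "\<dots> = fact n * z * (\<Sum>j\<le>m. of_nat (m choose j) / fact (Suc j) * z ^ j)"
    unfolding sum_distrib_left
  proof (rule sum.cong)
    fix j assume "j \<in> {..m}"
    then have "coeff ?p (Suc j) = of_nat (m choose j) * fact n / fact (Suc j)"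
      unfolding c by (simp add: n_def binomial_symmetric[of j m] del: fact_Suc)
    then show "coeff ?p (Suc j) * z ^ Suc j = fact n * z * (of_nat (m choose j) / fact (Suc j) * z ^ j)"
      by (simp add: ac_simps del: fact_Suc)
  qed simp
  finally have "poly ?p z = 0" using assms by simp
  then have "Re (\<i> * z) \<le> 0" "Re (-\<i> * z) \<le> 0" using inv[of m] by blast+
  then show ?thesis by simp
qed

text \<open>A zero \<open>t < 0\<close> contributes the factor \<open>1 + c x\<close> with
  \<open>c = - 1 / t\<close>, and the constant term 1 removes the scalar. This is the shape on which
  the differential operator bound acts.\<close>

lemma complex_poly_negative_roots:
  fixes p :: "complex poly"
  assumes "coeff p 0 = 1" and roots: "\<And>z. poly p z = 0 \<Longrightarrow> \<exists>t<0. z = of_real t"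
  shows "\<exists>cs. (\<forall>c\<in>set cs. c \<ge> 0) \<and> p = (\<Prod>c\<leftarrow>cs. [:1, complex_of_real c:])"
proof -
  have "p \<noteq> 0" using assms(1) by auto
  then obtain zs where zs: "p = smult (lead_coeff p) (\<Prod>z\<leftarrow>zs. [:-z, 1:])" "\<And>z. z \<in> set zs \<Longrightarrow> poly p z = 0"
    using complex_poly_factor_list by metis
  have "\<exists>cs k. (\<forall>c\<in>set cs. c \<ge> 0) \<and> (\<Prod>z\<leftarrow>zs. [:-z, 1:]) = smult k (\<Prod>c\<leftarrow>cs. [:1, complex_of_real c:])"
    using zs(2)
  proof (induction zs)
    case Nil
    show ?case by (intro exI[of _ "[]"] exI[of _ 1]) simp
  next
    case (Cons z zs)
    then obtain cs k where IH: "\<forall>c\<in>set cs. c \<ge> 0"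
      "(\<Prod>z\<leftarrow>zs. [:-z, 1:]) = smult k (\<Prod>c\<leftarrow>cs. [:1, complex_of_real c:])" by auto
    obtain t where t: "t < 0" "z = of_real t" using Cons.prems[of z] roots[of z] by auto
    have "[:-z, 1:] = smult (-z) [:1, complex_of_real (- 1 / t):]" using t by simp
    then have "(\<Prod>z\<leftarrow>z # zs. [:-z, 1:]) = smult (-z * k) (\<Prod>c\<leftarrow>(- 1 / t) # cs. [:1, complex_of_real c:])"
      by (simp only: list.map prod_list.Cons IH(2) mult_smult_left mult_smult_right smult_smult mult.commute[of k])
    moreover have "- 1 / t \<ge> 0" using t by (simp add: divide_nonneg_neg)
    ultimately show ?case using IH(1)
      by (intro exI[of _ "(- 1 / t) # cs"] exI[of _ "-z * k"]) auto
  qed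
  then obtain cs k where cs: "\<forall>c\<in>set cs. c \<ge> 0"
    "(\<Prod>z\<leftarrow>zs. [:-z, 1:]) = smult k (\<Prod>c\<leftarrow>cs. [:1, complex_of_real c:])" by blast
  have "coeff (\<Prod>c\<leftarrow>cs. [:1, complex_of_real c:]) 0 = 1" by (induction cs) (auto simp: coeff_mult)
  moreover have p: "p = smult (lead_coeff p * k) (\<Prod>c\<leftarrow>cs. [:1, complex_of_real c:])"
    using zs(1) cs(2) by (metis smult_smult)
  ultimately have "lead_coeff p * k = 1" using assms(1) by (metis coeff_smult mult.right_neutral)
  then show ?thesis using p cs(1) by auto
qed

lemma binomial_over_power_limit:
  "(\<lambda>m. real (m choose j) / real m ^ j) \<longlonglongrightarrow> 1 / fact j"
proof -
  have "real (m choose j) / real m ^ j = (\<Prod>i<j. (1 - real i / real m)) / fact j" if "m > 0" for m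
  proof -
    have "real (m choose j) = (\<Prod>i<j. (real m - real i)) / fact j"
      by (simp add: binomial_gbinomial gbinomial_prod_rev atLeast0LessThan)
    moreover have "(\<Prod>i<j. (real m - real i)) = (\<Prod>i<j. real m * (1 - real i / real m))"
      using that by (intro prod.cong) (auto simp: field_simps)
    ultimately show ?thesis using that by (simp add: prod.distrib)
  qed
  moreover have "(\<lambda>m. (\<Prod>i<j. (1 - real i / real m)) / fact j) \<longlonglongrightarrow> (\<Prod>i<j. (1 - 0)) / fact j"
    by (intro tendsto_intros lim_const_over_n) auto
  ultimately show ?thesis
    by (auto elim!: Lim_transform_eventually intro!: eventually_sequentiallyI[of 1])
qed

text \<open>The sum is the value at 0 of \<open>J(D) p\<close> for the entire function \<open>J(D) = \<Sum>j. D\<^sup>2\<^sup>j / (j! (j + 1)!)\<close>. It is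
  the limit of the \<open>M(D\<^sup>2) p\<close> for the rescaled real-rooted polynomials \<open>M\<close> above, which are bounded away from 0 uniformly.\<close>
lemma catalan_functional_nonzero:
  fixes ws :: "complex list"
  assumes "\<And>w. w \<in> set ws \<Longrightarrow> Re w > 0" "length ws \<le> N"
  shows "(\<Sum>j\<le>N. fact (2 * j) / (fact j * fact (Suc j)) * coeff (\<Prod>w\<leftarrow>ws. [:w, 1:]) (2 * j)) \<noteq> 0"
proof -
  define p where "p = (\<Prod>w\<leftarrow>ws. [:w, 1:])"
  have p: "lead_coeff p = 1 \<and> degree p = length ws"
    unfolding p_def
  proof (induction ws)
    case (Cons w ws)
    then have "(\<Prod>w\<leftarrow>ws. [:w, 1:]) \<noteq> 0" by auto
    then have "degree ([:w, 1:] * (\<Prod>w\<leftarrow>ws. [:w, 1:])) = Suc (length ws)"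
      using Cons by (subst degree_mult_eq) auto
    moreover have "lead_coeff ([:w, 1:] * (\<Prod>w\<leftarrow>ws. [:w, 1:])) = 1"
      using Cons by (subst lead_coeff_mult) auto
    ultimately show ?case by simp
  qed simp
  have roots: "-z \<in> set ws" if "poly p z = 0" for z
    using that unfolding p_def
  proof (induction ws)
    case (Cons w ws)
    then have "w = - z \<or> poly (\<Prod>w\<leftarrow>ws. [:w, 1:]) z = 0"
      by (simp add: eq_neg_iff_add_eq_0 del: mult_pCons_left)
    then show ?case using Cons.IH by auto
  qed simp
  \<comment> \<open>The 1 inserted into the minimum covers the empty list.\<close>
  obtain \<epsilon> where \<epsilon>: "\<epsilon> > 0" "\<And>w. w \<in> set ws \<Longrightarrow> Re w \<ge> \<epsilon>"
  proof
    show "0 < Min (insert 1 (Re ` set ws))" using assms(1) by simp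
  qed auto
  define h where "h j = fact (2 * j) * coeff p (2 * j)" for j
  \<comment> \<open>Coefficients of the preceding real-rooted polynomial at \<open>z / m\<close>.
    The rescaling makes them converge, to \<open>1 / (fact j * fact (Suc j))\<close>.\<close>
  define g where "g m j = real (m choose j) / real m ^ j / fact (Suc j)" for m j
  have bound: "\<epsilon> ^ length ws \<le> norm (\<Sum>j\<le>N. of_real (g m j) * h j)" if m: "m > 0" for m
  proof -
    define M where "M = (\<Sum>j\<le>m. monom (complex_of_real (g m j)) j)"
    have M: "coeff M j = of_real (g m j)" for j
      by (auto simp: M_def coeff_sum g_def binomial_eq_0)
    have pM: "poly M z = (\<Sum>j\<le>m. of_nat (m choose j) / fact (Suc j) * (z / of_nat m) ^ j)" for z
      by (simp add: M_def poly_sum poly_monom g_def power_divide algebra_simps)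
    have "\<exists>cs. (\<forall>c\<in>set cs. c \<ge> 0) \<and> M = (\<Prod>c\<leftarrow>cs. [:1, complex_of_real c:])"
    proof (rule complex_poly_negative_roots)
      show "coeff M 0 = 1" by (simp add: M g_def)
      fix z assume z: "poly M z = 0"
      then have "Im (z / of_nat m) = 0" unfolding pM by (rule binomial_Suc_fact_poly_real_rooted)
      then have "Im z = 0" using m by (simp add: Im_divide_of_nat)
      then have zr: "z = of_real (Re z)" by (simp add: complex_eq_iff)
      \<comment> \<open>All coefficients are nonnegative and the constant one is 1, so the value at
        a nonnegative real is at least 1.\<close>
      moreover have "Re z < 0"
      proof (rule ccontr)
        assume "\<not> Re z < 0"
        then have nn: "Re z \<ge> 0" by simp
        have "poly M z = of_real (\<Sum>j\<le>m. g m j * Re z ^ j)"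
          by (subst zr) (simp add: M_def poly_sum poly_monom)
        moreover have "g m 0 * Re z ^ 0 \<le> (\<Sum>j\<le>m. g m j * Re z ^ j)"
          by (rule member_le_sum) (use nn in \<open>auto simp: g_def\<close>)
        moreover have "g m 0 * Re z ^ 0 = 1" by (simp add: g_def)
        ultimately show False using z by (metis of_real_eq_0_iff not_one_le_zero)
      qed
      ultimately show "\<exists>t<0. z = of_real t" by blast
    qed
    then obtain cs where cs: "\<forall>c\<in>set cs. c \<ge> 0" "M = (\<Prod>c\<leftarrow>cs. [:1, complex_of_real c:])" by blast
    have "\<epsilon> ^ degree p \<le> norm (\<Sum>j\<le>N. coeff (\<Prod>c\<leftarrow>cs. [:1, of_real c:]) j * (fact (2 * j) * coeff p (2 * j)))"
    proof (rule even_differential_operator_bound)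
      show "Re z \<le> - \<epsilon>" if "poly p z = 0" for z using \<epsilon>(2)[OF roots[OF that]] by simp
    qed (use cs p \<epsilon> assms(2) in auto)
    then show ?thesis using p by (simp add: cs(2)[symmetric] M h_def)
  qed
  have "(\<lambda>m. g m j) \<longlonglongrightarrow> 1 / fact j / fact (Suc j)" for j
    unfolding g_def by (intro tendsto_divide binomial_over_power_limit tendsto_const) simp
  then have "(\<lambda>m. norm (\<Sum>j\<le>N. complex_of_real (g m j) * h j)) \<longlonglongrightarrow>
     norm (\<Sum>j\<le>N. complex_of_real (1 / fact j / fact (Suc j)) * h j)"
    by (intro tendsto_norm tendsto_sum tendsto_mult_right tendsto_of_real)
  then have "\<epsilon> ^ length ws \<le> norm (\<Sum>j\<le>N. complex_of_real (1 / fact j / fact (Suc j)) * h j)"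
    by (rule LIMSEQ_le_const) (use bound in \<open>auto intro!: exI[of _ 1]\<close>)
  moreover have "\<epsilon> ^ length ws > 0" using \<epsilon>(1) by simp
  ultimately have "(\<Sum>j\<le>N. complex_of_real (1 / fact j / fact (Suc j)) * h j) \<noteq> 0" by auto
  then show ?thesis by (simp add: h_def p_def[symmetric] algebra_simps)
qed

text \<open>Substituting \<open>t = A / B\<close> into the product of the \<open>v + u t\<close> and
  clearing denominators. It serves for \<open>A / B = t + 1/t\<close>, and for the passage from the
  zeros of the Newton coefficients to those of the numerator.\<close>

lemma prod_list_homogenization:
  fixes A B :: "'a :: comm_ring_1 poly"
  shows "(\<Prod>(v, u)\<leftarrow>xs. smult v B + smult u A) =
    (\<Sum>k\<le>length xs. smult (coeff (\<Prod>(v, u)\<leftarrow>xs. [:v, u:]) k) (A ^ k * B ^ (length xs - k)))"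
proof (induction xs)
  case (Cons x xs)
  obtain v u where x: "x = (v, u)" by force
  define n where "n = length xs"
  define R where "R = (\<Prod>(v, u)\<leftarrow>xs. [:v, u:])"
  have "degree R \<le> n"
    unfolding R_def n_def
  proof (induction xs)
    case (Cons y ys)
    have "degree (case y of (v, u) \<Rightarrow> [:v, u:]) \<le> 1" by (cases y) auto
    with Cons degree_mult_le[of "case y of (v, u) \<Rightarrow> [:v, u:]" "\<Prod>(v, u)\<leftarrow>ys. [:v, u:]"]
    show ?case by simp
  qed simp
  then have top: "coeff R (Suc n) = 0" by (simp add: coeff_eq_0)
  define t where "t k = A ^ k * B ^ (Suc n - k)" for k
  have tB: "B * (A ^ k * B ^ (n - k)) = t k" if "k \<le> n" for k
    using that by (simp add: t_def Suc_diff_le algebra_simps)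
  have tA: "A * (A ^ k * B ^ (n - k)) = t (Suc k)" for k
    by (simp add: t_def algebra_simps)
  have "(smult v B + smult u A) * (\<Sum>k\<le>n. smult (coeff R k) (A ^ k * B ^ (n - k))) =
     (\<Sum>k\<le>n. smult (v * coeff R k) (B * (A ^ k * B ^ (n - k)))) +
     (\<Sum>k\<le>n. smult (u * coeff R k) (A * (A ^ k * B ^ (n - k))))"
    by (simp add: sum_distrib_left ring_distribs sum.distrib[symmetric] smult_add_right mult.commute)
  also have "(\<Sum>k\<le>n. smult (v * coeff R k) (B * (A ^ k * B ^ (n - k)))) =
     (\<Sum>k\<le>Suc n. smult (v * coeff R k) (t k))"
    using tB by (simp add: top)
  also have "(\<Sum>k\<le>n. smult (u * coeff R k) (A * (A ^ k * B ^ (n - k)))) =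
     (\<Sum>k\<le>Suc n. smult (u * coeff (pCons 0 R) k) (t k))"
    by (simp add: sum.atMost_Suc_shift tA del: sum.atMost_Suc)
  also have "(\<Sum>k\<le>Suc n. smult (v * coeff R k) (t k)) + (\<Sum>k\<le>Suc n. smult (u * coeff (pCons 0 R) k) (t k)) =
     (\<Sum>k\<le>Suc n. smult (coeff ([:v, u:] * R) k) (t k))"
  proof -
    have "coeff ([:v, u:] * R) k = v * coeff R k + u * coeff (pCons 0 R) k" for k
      by (cases k) auto
    then show ?thesis by (simp only: sum.distrib[symmetric] smult_add_left)
  qed
  finally show ?case using Cons.IH by (simp add: x n_def R_def t_def del: mult_pCons_left)
qed simp

lemma coeff_one_plus_square_power:
  "coeff ([:1, 0, 1:] ^ k) i = (if even i then of_nat (k choose (i div 2)) else (0 :: 'a :: comm_ring_1))"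
proof -
  have "[:1, 0, 1 :: 'a:] = monom 1 2 + 1" by (simp add: numeral_2_eq_2 monom_Suc one_pCons)
  then have "[:1, 0, 1 :: 'a:] ^ k = (\<Sum>l\<le>k. of_nat (k choose l) * monom 1 (2 * l))"
    by (simp add: binomial_ring monom_power)
  also have "\<dots> = (\<Sum>l\<le>k. monom (of_nat (k choose l)) (2 * l))"
    by (simp add: of_nat_monom mult_monom)
  finally have "coeff ([:1, 0, 1 :: 'a:] ^ k) i = (\<Sum>l\<le>k. if 2 * l = i then of_nat (k choose l) else 0)"
    by (simp add: coeff_sum)
  also have "\<dots> = (if even i then of_nat (k choose (i div 2)) else 0)"
  proof (cases "even i")
    case True
    then obtain l0 where "i = 2 * l0" by auto
    then show ?thesis by (simp add: binomial_eq_0)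
  next
    case False
    then have "2 * l \<noteq> i" for l by auto
    then show ?thesis using False by simp
  qed
  finally show ?thesis .
qed

text \<open>The \<open>j\<close>-th Catalan number, which is the moment of order
  \<open>2 * j\<close> of the semicircle law on \<open>[-2, 2]\<close>; this is where the weights of
  the functional come from.\<close>

lemma catalan_binomial_difference:
  "of_nat (2 * j choose j) - of_nat (2 * j choose Suc j) =
    (fact (2 * j) / (fact j * fact (Suc j)) :: 'a :: field_char_0)"
proof (cases j)
  case (Suc i)
  define J x :: 'a where "J = of_nat j" and "x = fact j"
  have nz: "J \<noteq> 0" "1 + J \<noteq> 0" "x \<noteq> 0"
    unfolding J_def x_def using of_nat_neq_0[of j, where ?'a = 'a] by (simp_all add: Suc add.commute del: of_nat_Suc flip: of_nat_Suc)
  have fi: "fact i = x / J" using nz by (simp add: x_def J_def Suc field_simps)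
  have fs: "fact (Suc j) = (1 + J) * x" by (simp add: x_def J_def)
  have "of_nat (2 * j choose j) = fact (2 * j) / (x * x)"
    unfolding x_def by (subst binomial_fact) auto
  moreover have "of_nat (2 * j choose Suc j) = fact (2 * j) / ((1 + J) * x * (x / J))"
    unfolding fs[symmetric] fi[symmetric] by (subst binomial_fact) (auto simp: Suc)
  moreover have "F / (x * x) - F / ((1 + J) * x * (x / J)) = F / (x * ((1 + J) * x))" for F
    using nz by (simp add: divide_simps) (simp add: algebra_simps)
  ultimately show ?thesis by (simp only: fs x_def[symmetric])
qed simp

text \<open>The left-hand side is the constant term of \<open>(1 - t\<^sup>2) b(t) b(1/t)\<close>, and \<open>b(t) b(1/t)\<close> is a polynomial
  in \<open>t + 1/t\<close>.\<close>
lemma sum_squares_minus_shifted_products: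
  fixes \<alpha> :: "'a :: field_char_0 list" and y :: 'a
  assumes y: "y \<noteq> 0" and nz: "\<And>a. a \<in> set \<alpha> \<Longrightarrow> a \<noteq> 0"
  defines "n \<equiv> length \<alpha>" and "b \<equiv> (\<Prod>a\<leftarrow>\<alpha>. [:a, y:])"
  shows "(\<Sum>m\<le>n. (coeff b m)\<^sup>2) - (\<Sum>m\<le>n. coeff b m * coeff b (m + 2)) =
    (\<Sum>j\<le>n. fact (2 * j) / (fact j * fact (Suc j)) * coeff (\<Prod>a\<leftarrow>\<alpha>. [:a\<^sup>2 + y\<^sup>2, a * y:]) (2 * j))"
proof -
  have "degree b = n \<and> b \<noteq> 0 \<and> reflect_poly b = (\<Prod>a\<leftarrow>\<alpha>. [:y, a:])"
    unfolding b_def n_def using nz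
  proof (induction \<alpha>)
    case (Cons a as)
    then have IH: "degree (\<Prod>a\<leftarrow>as. [:a, y:]) = length as" "(\<Prod>a\<leftarrow>as. [:a, y:]) \<noteq> 0"
      "reflect_poly (\<Prod>a\<leftarrow>as. [:a, y:]) = (\<Prod>a\<leftarrow>as. [:y, a:])" by auto
    have "degree ([:a, y:] * (\<Prod>a\<leftarrow>as. [:a, y:])) = Suc (length as)"
      using y IH by (subst degree_mult_eq) auto
    moreover have "reflect_poly [:a, y:] = [:y, a:]"
      using y Cons.prems by (simp add: reflect_poly_def)
    moreover have "[:a, y:] * (\<Prod>a\<leftarrow>as. [:a, y:]) \<noteq> 0" using y IH by (simp del: mult_pCons_left)
    ultimately show ?case using IH by (simp add: reflect_poly_mult del: mult_pCons_left)
  qed simp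
  then have deg: "degree b = n" and refl: "reflect_poly b = (\<Prod>a\<leftarrow>\<alpha>. [:y, a:])" by auto
  have cr: "coeff (reflect_poly b) i = (if i > n then 0 else coeff b (n - i))" for i
    by (simp add: coeff_reflect_poly deg)
  define R where "R = (\<Prod>a\<leftarrow>\<alpha>. [:a\<^sup>2 + y\<^sup>2, a * y:])"
  have R: "R = (\<Prod>(v, u)\<leftarrow>map (\<lambda>a. (a\<^sup>2 + y\<^sup>2, a * y)) \<alpha>. [:v, u:])"
    by (simp add: R_def o_def)
  \<comment> \<open>\<open>reflect_poly b\<close> is \<open>t^n b(1/t)\<close>. Each pair of factors
    gives \<open>(a + y t) (y + a t) = (a^2 + y^2) t + a y (1 + t^2)\<close>, which divided by
    \<open>t\<close> is linear in \<open>t + 1/t\<close>.\<close>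
  have "b * reflect_poly b = (\<Prod>(v, u)\<leftarrow>map (\<lambda>a. (a\<^sup>2 + y\<^sup>2, a * y)) \<alpha>. smult v [:0, 1:] + smult u [:1, 0, 1:])"
    unfolding refl unfolding b_def
    by (induction \<alpha>) (simp_all add: algebra_simps power2_eq_square del: mult_pCons_left mult_pCons_right,
      simp add: algebra_simps)
  also have "\<dots> = (\<Sum>k\<le>n. smult (coeff R k) ([:1, 0, 1:] ^ k * [:0, 1:] ^ (n - k)))"
    unfolding prod_list_homogenization R by (simp add: n_def)
  finally have prod: "b * reflect_poly b = (\<Sum>k\<le>n. smult (coeff R k) (monom 1 (n - k) * [:1, 0, 1:] ^ k))"
    by (simp add: monom_altdef mult.commute)
  \<comment> \<open>The coefficient of index \<open>n + i\<close> is that of \<open>t^i\<close> in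
    the Laurent polynomial \<open>b(t) b(1/t)\<close>; the cases \<open>i = 0\<close> and
    \<open>i = 2\<close> are the two sums sought.\<close>
  have c: "coeff (b * reflect_poly b) (n + i) = (\<Sum>k\<le>n. coeff R k * coeff ([:1, 0, 1:] ^ k) (k + i))" for i
    unfolding prod coeff_sum
    by (rule sum.cong) (auto simp: coeff_monom_mult add.commute[of i])
  have "(\<Sum>m\<le>n. (coeff b m)\<^sup>2) = coeff (b * reflect_poly b) (n + 0)"
    unfolding add_0_right coeff_mult by (rule sum.cong) (auto simp: cr power2_eq_square)
  moreover have "(\<Sum>m\<le>n. coeff b m * coeff b (m + 2)) = coeff (b * reflect_poly b) (n + 2)"
  proof -
    have "coeff (b * reflect_poly b) (n + 2) = (\<Sum>i\<le>n + 2. coeff b i * (if i < 2 then 0 else coeff b (i - 2)))"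
      unfolding coeff_mult by (rule sum.cong) (auto simp: cr)
    also have "\<dots> = (\<Sum>m\<le>n. coeff b (m + 2) * coeff b m)"
      by (simp add: sum.atMost_Suc_shift del: sum.atMost_Suc)
    finally show ?thesis by (simp add: mult.commute)
  qed
  ultimately have "(\<Sum>m\<le>n. (coeff b m)\<^sup>2) - (\<Sum>m\<le>n. coeff b m * coeff b (m + 2)) =
     (\<Sum>k\<le>n. coeff R k * (coeff ([:1, 0, 1:] ^ k) k - coeff ([:1, 0, 1:] ^ k) (k + 2)))"
    unfolding c by (simp add: sum_subtractf right_diff_distrib)
  also have "\<dots> = (\<Sum>k\<le>n. if even k then coeff R k * (fact k / (fact (k div 2) * fact (Suc (k div 2)))) else 0)"
  proof (rule sum.cong)
    fix k assume "k \<in> {..n}"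
    show "coeff R k * (coeff ([:1, 0, 1:] ^ k) k - coeff ([:1, 0, 1:] ^ k) (k + 2)) =
       (if even k then coeff R k * (fact k / (fact (k div 2) * fact (Suc (k div 2)))) else 0)"
    proof (cases "even k")
      case True
      then obtain j where "k = 2 * j" by auto
      then show ?thesis
        by (simp add: coeff_one_plus_square_power catalan_binomial_difference del: fact_Suc)
    qed (simp add: coeff_one_plus_square_power)
  qed simp
  also have "\<dots> = (\<Sum>j\<le>n. coeff R (2 * j) * (fact (2 * j) / (fact j * fact (Suc j))))"
  proof -
    let ?g = "\<lambda>k. coeff R k * (fact k / (fact (k div 2) * fact (Suc (k div 2))))"
    have "degree R \<le> n" unfolding R_def n_def
    proof (induction \<alpha>)
      case (Cons a as)
      from Cons degree_mult_le[of "[:a\<^sup>2 + y\<^sup>2, a * y:]" "\<Prod>a\<leftarrow>as. [:a\<^sup>2 + y\<^sup>2, a * y:]"]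
      show ?case by (simp del: mult_pCons_left split: if_splits)
    qed simp
    then have 0: "coeff R (2 * j) = 0" if "n < 2 * j" for j using that by (simp add: coeff_eq_0)
    have "(\<Sum>k\<le>n. if even k then ?g k else 0) = (\<Sum>k\<in>{k. k \<le> n \<and> even k}. ?g k)"
      by (rule sum.mono_neutral_cong_right) auto
    also have "\<dots> = (\<Sum>j\<in>{j. 2 * j \<le> n}. ?g (2 * j))"
      by (rule sum.reindex_bij_witness[of _ "\<lambda>j. 2 * j" "\<lambda>k. k div 2"]) auto
    also have "\<dots> = (\<Sum>j\<le>n. ?g (2 * j))"
      by (rule sum.mono_neutral_left) (auto simp: 0)
    finally show ?thesis by simp
  qed
  finally show ?thesis by (simp add: R_def mult.commute)
qed

text \<open>Taking out \<open>a * y\<close> turns each linear factor into \<open>w + t\<close> with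
  \<open>w = a / y + y / a\<close>. A number and its inverse have real parts of the same sign, so
  \<open>Re w > 0\<close> and the functional does not vanish.\<close>

lemma sum_squares_minus_shifted_products_nonzero:
  fixes \<alpha> :: "complex list" and y :: complex
  assumes y: "y \<noteq> 0" and Re: "\<And>a. a \<in> set \<alpha> \<Longrightarrow> Re (a / y) > 0"
  defines "n \<equiv> length \<alpha>" and "b \<equiv> (\<Prod>a\<leftarrow>\<alpha>. [:a, y:])"
  shows "(\<Sum>m\<le>n. (coeff b m)\<^sup>2) - (\<Sum>m\<le>n. coeff b m * coeff b (m + 2)) \<noteq> 0"
proof -
  have nz: "a \<noteq> 0" if "a \<in> set \<alpha>" for a using Re[OF that] by auto
  define w where "w a = a / y + y / a" for a
  have Re_w: "Re (w a) > 0" if "a \<in> set \<alpha>" for a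
  proof -
    have "y / a = inverse (a / y)" by simp
    moreover have "Re (inverse (a / y)) > 0"
      using Re[OF that] by (simp only: inverse_complex.sel) (simp add: sum_power2_gt_zero_iff)
    ultimately show ?thesis using Re[OF that] by (simp add: w_def)
  qed
  have "(\<Prod>a\<leftarrow>\<alpha>. [:a\<^sup>2 + y\<^sup>2, a * y:]) = smult (\<Prod>a\<leftarrow>\<alpha>. a * y) (\<Prod>v\<leftarrow>map w \<alpha>. [:v, 1:])"
    using nz
  proof (induction \<alpha>)
    case (Cons a as)
    have "[:a\<^sup>2 + y\<^sup>2, a * y:] = smult (a * y) [:w a, 1:]"
      using y Cons.prems[of a] by (simp add: w_def field_simps power2_eq_square)
    moreover have "(\<Prod>a\<leftarrow>as. [:a\<^sup>2 + y\<^sup>2, a * y:]) = smult (\<Prod>a\<leftarrow>as. a * y) (\<Prod>v\<leftarrow>map w as. [:v, 1:])"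
      using Cons by simp
    ultimately show ?case
      by (simp only: list.map prod_list.Cons mult_smult_left mult_smult_right smult_smult mult.commute)
  qed simp
  then have "(\<Sum>m\<le>n. (coeff b m)\<^sup>2) - (\<Sum>m\<le>n. coeff b m * coeff b (m + 2)) =
     (\<Prod>a\<leftarrow>\<alpha>. a * y) * (\<Sum>j\<le>n. fact (2 * j) / (fact j * fact (Suc j)) * coeff (\<Prod>v\<leftarrow>map w \<alpha>. [:v, 1:]) (2 * j))"
    unfolding b_def n_def using sum_squares_minus_shifted_products[OF y nz, of \<alpha>]
    by (simp only: coeff_smult sum_distrib_left) (simp only: ac_simps)
  moreover have "(\<Sum>j\<le>n. fact (2 * j) / (fact j * fact (Suc j)) * coeff (\<Prod>v\<leftarrow>map w \<alpha>. [:v, 1:]) (2 * j)) \<noteq> 0"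
    by (rule catalan_functional_nonzero) (use Re_w in \<open>auto simp: n_def\<close>)
  moreover have "(\<Prod>a\<leftarrow>\<alpha>. a * y) \<noteq> 0" using nz y by (auto simp: prod_list_zero_iff)
  ultimately show ?thesis by simp
qed

section \<open>A binomial identity for the log-concavity defect\<close>

lemma gbinomial_Vandermonde_atMost:
  fixes a b :: "'a :: field_char_0"
  shows "(\<Sum>k\<le>n. (a gchoose k) * (b gchoose (n - k))) = (a + b) gchoose n"
  using gbinomial_Vandermonde[of a b n] by (simp add: atMost_atLeast0)

text \<open>Three applications of Vandermonde's convolution.\<close>
lemma gbinomial_product_Nanjundiah:
  fixes x y :: "'a :: field_char_0"
  shows "(x gchoose p) * (y gchoose q) = (\<Sum>m\<le>q. ((of_nat p - x + y) gchoose m) *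
    ((of_nat q + x - y) gchoose (q - m)) * ((x + of_nat m) gchoose (p + q)))"
proof -
  define P Q where "P = of_nat p - x + y" and "Q = of_nat q + x - y"
  \<comment> \<open>The upper parameters add up to a natural number. The inner Vandermonde sum is
    therefore an ordinary binomial coefficient, to which the symmetry rule applies.\<close>
  have PQ: "P + Q = of_nat (p + q)" by (simp add: P_def Q_def)
  have "(P gchoose m) * (Q gchoose (q - m)) * ((x + of_nat m) gchoose (p + q)) =
    (\<Sum>r\<le>q. if r \<le> m then (P gchoose r) * (((P - of_nat r) gchoose (m - r)) * (Q gchoose (q - m))) * (x gchoose (p + q - r)) else 0)"
    if m: "m \<le> q" for m
  proof -
    have "(x + of_nat m) gchoose (p + q) = (\<Sum>r\<le>p + q. (of_nat m gchoose r) * (x gchoose (p + q - r)))"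
      by (subst gbinomial_Vandermonde_atMost) (simp add: add.commute)
    also have "\<dots> = (\<Sum>r\<le>q. if r \<le> m then (of_nat m gchoose r) * (x gchoose (p + q - r)) else 0)"
      using m by (intro sum.mono_neutral_cong_right) (auto simp: binomial_gbinomial[symmetric] binomial_eq_0)
    finally show ?thesis
      by (auto simp: sum_distrib_left ac_simps gbinomial_trinomial_revision[of _ m P, symmetric] intro!: sum.cong)
  qed
  then have "(\<Sum>m\<le>q. (P gchoose m) * (Q gchoose (q - m)) * ((x + of_nat m) gchoose (p + q))) =
    (\<Sum>m\<le>q. \<Sum>r\<le>q. if r \<le> m then (P gchoose r) * (((P - of_nat r) gchoose (m - r)) * (Q gchoose (q - m))) * (x gchoose (p + q - r)) else 0)"
    by simp
  also have "\<dots> = (\<Sum>r\<le>q. \<Sum>m\<le>q. if r \<le> m then (P gchoose r) * (((P - of_nat r) gchoose (m - r)) * (Q gchoose (q - m))) * (x gchoose (p + q - r)) else 0)"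
    by (rule sum.swap)
  also have "\<dots> = (\<Sum>r\<le>q. (x gchoose p) * ((P gchoose r) * ((x - of_nat p) gchoose (q - r))))"
  proof (rule sum.cong)
    fix r assume r: "r \<in> {..q}"
    have "(\<Sum>m\<le>q. if r \<le> m then (P gchoose r) * (((P - of_nat r) gchoose (m - r)) * (Q gchoose (q - m))) * (x gchoose (p + q - r)) else 0) =
      (\<Sum>m\<le>q - r. (P gchoose r) * (((P - of_nat r) gchoose m) * (Q gchoose (q - r - m))) * (x gchoose (p + q - r)))"
      by (rule sym, rule sum.reindex_bij_witness_not_neutral[of "{}" "{m. m \<le> q \<and> m < r}" _ "\<lambda>m. m - r" "\<lambda>m. m + r"])
        (use r in \<open>auto simp: add.commute\<close>)
    also have "\<dots> = (P gchoose r) * (\<Sum>m\<le>q - r. ((P - of_nat r) gchoose m) * (Q gchoose (q - r - m))) * (x gchoose (p + q - r))"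
      by (simp add: sum_distrib_left sum_distrib_right)
    also have "(\<Sum>m\<le>q - r. ((P - of_nat r) gchoose m) * (Q gchoose (q - r - m))) = (of_nat (p + q - r) gchoose (q - r))"
    proof -
      have "(P - of_nat r) + Q = of_nat (p + q) - of_nat r" using PQ by (simp add: algebra_simps)
      also have "\<dots> = of_nat (p + q - r)" using r by (simp add: of_nat_diff)
      finally show ?thesis unfolding gbinomial_Vandermonde_atMost by simp
    qed
    also have "of_nat (p + q - r) gchoose (q - r) = of_nat (p + q - r) gchoose p"
      using r binomial_symmetric[of p "p + q - r"] by (simp add: binomial_gbinomial[symmetric] del: of_nat_diff)
    also have "(P gchoose r) * (of_nat (p + q - r) gchoose p) * (x gchoose (p + q - r)) =
       (P gchoose r) * ((x gchoose (p + q - r)) * (of_nat (p + q - r) gchoose p))" by simp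
    also have "(x gchoose (p + q - r)) * (of_nat (p + q - r) gchoose p) = (x gchoose p) * ((x - of_nat p) gchoose (q - r))"
      using r by (subst gbinomial_trinomial_revision) auto
    finally show "(\<Sum>m\<le>q. if r \<le> m then (P gchoose r) * (((P - of_nat r) gchoose (m - r)) * (Q gchoose (q - m))) * (x gchoose (p + q - r)) else 0) =
      (x gchoose p) * ((P gchoose r) * ((x - of_nat p) gchoose (q - r)))"
      by (simp only: ac_simps)
  qed simp
  also have "\<dots> = (x gchoose p) * (y gchoose q)"
    unfolding sum_distrib_left[symmetric] gbinomial_Vandermonde_atMost by (simp add: P_def)
  finally show ?thesis by (simp only: P_def Q_def)
qed

text \<open>Integer lower indices with value 0 below 0 let Pascal's rule and index shifts hold
  everywhere without boundary cases.\<close>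

definition binomial_int :: "nat \<Rightarrow> int \<Rightarrow> real" where
  "binomial_int n k = (if k < 0 then 0 else real (n choose nat k))"

lemma binomial_int_Suc: "binomial_int (Suc n) k = binomial_int n k + binomial_int n (k - 1)"
proof (cases "k \<le> 0")
  case False
  then obtain l where "k = int (Suc l)" by (metis not_le zero_less_imp_eq_int not0_implies_Suc of_nat_0_less_iff less_irrefl)
  then show ?thesis by (simp add: binomial_int_def nat_add_distrib)
qed (auto simp: binomial_int_def)

lemma binomial_int_of_nat [simp]: "binomial_int n (int k) = real (n choose k)"
  by (simp add: binomial_int_def)

lemma binomial_int_eq_0: "k < 0 \<or> k > int n \<Longrightarrow> binomial_int n k = 0"
  by (auto simp: binomial_int_def nat_less_iff)

lemma sum_int_shift:
  fixes f :: "int \<Rightarrow> real"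
  assumes "\<And>k. f k \<noteq> 0 \<Longrightarrow> - M \<le> k \<and> k \<le> M \<and> - M \<le> k - d \<and> k - d \<le> M"
  shows "(\<Sum>k\<in>{-M..M}. f (k + d)) = (\<Sum>k\<in>{-M..M}. f k)"
proof -
  have "(\<Sum>k\<in>{-M..M}. f (k + d)) = (\<Sum>k\<in>{-M + d..M + d}. f k)"
    by (rule sum.reindex_bij_witness[of _ "\<lambda>k. k - d" "\<lambda>k. k + d"]) auto
  also have "\<dots> = (\<Sum>k\<in>{-M..M} \<inter> {-M + d..M + d}. f k)"
    by (rule sum.mono_neutral_right) (use assms in force)+
  also have "\<dots> = (\<Sum>k\<in>{-M..M}. f k)"
    by (rule sum.mono_neutral_left) (use assms in force)+
  finally show ?thesis .
qed

lemma sum_nat_as_int: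
  fixes f :: "int \<Rightarrow> real"
  assumes "\<And>k. f k \<noteq> 0 \<Longrightarrow> 0 \<le> k \<and> k \<le> int N" "int N \<le> M"
  shows "(\<Sum>m\<le>N. f (int m)) = (\<Sum>k\<in>{-M..M}. f k)"
proof -
  have "(\<Sum>m\<le>N. f (int m)) = (\<Sum>k\<in>{0..int N}. f k)"
    by (rule sum.reindex_bij_witness[of _ nat int]) auto
  also have "\<dots> = (\<Sum>k\<in>{-M..M}. f k)"
    by (rule sum.mono_neutral_left) (use assms in force)+
  finally show ?thesis .
qed

text \<open>With equal arguments the parameters of Nanjundiah's formula no longer contain
  \<open>x\<close>, so they become the natural numbers \<open>i + 2\<close> and
  \<open>j + 2\<close>.\<close>

lemma gbinomial_product_equal_shift:
  fixes x :: "'a :: field_char_0"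
  shows "(x gchoose (i + 2)) * (x gchoose (j + 2)) =
    (\<Sum>m\<le>j + 2. of_nat (i + 2 choose m) * of_nat (j + 2 choose m) * ((x + of_nat m) gchoose (i + j + 4)))"
  unfolding gbinomial_product_Nanjundiah[of x "i + 2" x "j + 2"]
proof (rule sum.cong)
  fix m assume "m \<in> {..j + 2}"
  then have "j + 2 choose (j + 2 - m) = (j + 2 choose m)" by (simp add: binomial_symmetric[symmetric])
  moreover have "i + 2 + (j + 2) = i + j + 4" by simp
  moreover have "of_nat n - x + x = of_nat n" "of_nat n + x - x = of_nat n" for n by simp_all
  ultimately show "((of_nat (i + 2) - x + x) gchoose m) * ((of_nat (j + 2) + x - x) gchoose (j + 2 - m)) *
      ((x + of_nat m) gchoose (i + 2 + (j + 2))) =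
    of_nat (i + 2 choose m) * of_nat (j + 2 choose m) * ((x + of_nat m) gchoose (i + j + 4))"
    by (simp only: binomial_gbinomial[symmetric])
qed simp

text \<open>The arguments differ by 2, which moves the parameters of Nanjundiah's formula to
  \<open>i\<close> and \<open>j + 4\<close>.\<close>

lemma gbinomial_product_opposite_shift:
  fixes x :: "'a :: field_char_0"
  shows "((x + 1) gchoose (i + 2)) * ((x - 1) gchoose (j + 2)) =
    (\<Sum>m\<le>j + 2. of_nat (i choose m) * of_nat (j + 4 choose (m + 2)) * ((x + 1 + of_nat m) gchoose (i + j + 4)))"
  unfolding gbinomial_product_Nanjundiah[of "x + 1" "i + 2" "x - 1" "j + 2"]
proof (rule sum.cong)
  fix m assume "m \<in> {..j + 2}"
  then have "j + 4 choose (j + 2 - m) = (j + 4 choose (m + 2))"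
    by (subst binomial_symmetric) (auto simp: Suc_diff_le)
  moreover have "i + 2 + (j + 2) = i + j + 4" by simp
  moreover have "of_nat (i + 2) - (x + 1) + (x - 1) = of_nat i"
    "of_nat (j + 2) + (x + 1) - (x - 1) = of_nat (j + 4)" by simp_all
  ultimately show "((of_nat (i + 2) - (x + 1) + (x - 1)) gchoose m) *
      ((of_nat (j + 2) + (x + 1) - (x - 1)) gchoose (j + 2 - m)) * ((x + 1 + of_nat m) gchoose (i + 2 + (j + 2))) =
    of_nat (i choose m) * of_nat (j + 4 choose (m + 2)) * ((x + 1 + of_nat m) gchoose (i + j + 4))"
    by (simp only: binomial_gbinomial[symmetric])
qed simp

text \<open>Both sides are expanded in \<open>(x + k) gchoose (i + j + 4)\<close>; on the right, \<open>(x + k) gchoose (i + j + 2)\<close>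
  is a second difference of these. By Pascal's rule the coefficients agree as polynomials in the
  \<open>i choose k\<close> and \<open>j choose k\<close>.\<close>
lemma gbinomial_log_concavity_defect:
  fixes x :: real
  assumes "i \<le> M" "j \<le> M"
  shows "(x gchoose (i + 2)) * (x gchoose (j + 2)) -
     (((x + 1) gchoose (i + 2)) * ((x - 1) gchoose (j + 2)) + ((x - 1) gchoose (i + 2)) * ((x + 1) gchoose (j + 2))) / 2 =
   (\<Sum>m\<le>M. real (i choose m) * real (j choose m) * ((x + real m) gchoose (i + j + 2))) -
   (\<Sum>m\<le>M. (real (i choose m) * real (j choose (m + 2)) + real (i choose (m + 2)) * real (j choose m)) *
      ((x + real (m + 1)) gchoose (i + j + 2))) / 2"
proof -
  define V where "V k = ((x + of_int k) gchoose (i + j + 4))" for k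
  define U where "U k = ((x + of_int k) gchoose (i + j + 2))" for k
  \<comment> \<open>One window for all sums. Supports lie between \<open>-5\<close> and
    \<open>M + 5\<close> and shifts are at most 5; the remaining slack is arbitrary.\<close>
  define L :: int where "L = int (M + i + j + 20)"
  define S where "S g = (\<Sum>k\<in>{-L..L}. g k)" for g :: "int \<Rightarrow> real"
  have shift: "S (\<lambda>k. g (k + d)) = S g"
    if "\<bar>d\<bar> \<le> 5" "\<And>k. k < -5 \<or> k > int M + 5 \<Longrightarrow> g k = 0" for g d
    unfolding S_def
  proof (rule sum_int_shift)
    fix k assume "g k \<noteq> 0"
    then have "-5 \<le> k \<and> k \<le> int M + 5" using that(2)[of k] by linarith
    then show "- L \<le> k \<and> k \<le> L \<and> - L \<le> k - d \<and> k - d \<le> L" using that(1) by (auto simp: L_def)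
  qed
  note bz = binomial_int_eq_0
  have nat: "(\<Sum>m\<le>N. g (int m)) = S g" if "N \<le> M + 2" "\<And>k. k < 0 \<or> k > int N \<Longrightarrow> g k = 0" for g N
    unfolding S_def by (rule sum_nat_as_int) (use that in \<open>force simp: L_def\<close>)+
  have lin: "S g + S h = S (\<lambda>k. g k + h k)" "S g - S h = S (\<lambda>k. g k - h k)" "a * S g = S (\<lambda>k. a * g k)" for g h a
    by (simp_all add: S_def sum.distrib sum_subtractf sum_distrib_left)
  have UV: "U k = V (k + 2) - 2 * V (k + 1) + V k" for k
  proof -
    have *: "((x + of_int (k + 1)) gchoose Suc n) = ((x + of_int k) gchoose n) + ((x + of_int k) gchoose Suc n)" for k n
      using gbinomial_Suc_Suc[of "x + of_int k" n] by (simp add: algebra_simps)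
    have idx: "i + j + 4 = Suc (Suc (i + j + 2))" by simp
    have k2: "k + 2 = k + 1 + 1" by simp
    show ?thesis unfolding V_def U_def idx k2 * by simp
  qed
  have opposite: "((x + 1) gchoose (i' + 2)) * ((x - 1) gchoose (j' + 2)) =
      S (\<lambda>k. binomial_int i' (k - 1) * binomial_int (j' + 4) (k + 1) * V k)"
    if ij: "i' + j' = i + j" "i' \<le> M" "j' \<le> M" for i' j'
  proof -
    have "((x + 1) gchoose (i' + 2)) * ((x - 1) gchoose (j' + 2)) =
       (\<Sum>m\<le>j' + 2. binomial_int i' (int m) * binomial_int (j' + 4) (int m + 2) * V (int m + 1))"
    proof -
      have b: "binomial_int (j' + 4) (int m + 2) = real (j' + 4 choose (m + 2))" for m
        using binomial_int_of_nat[of "j' + 4" "m + 2"] by (simp add: add.commute)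
      have v: "V (int m + 1) = ((x + 1 + real m) gchoose (i' + j' + 4))" for m
        by (simp add: V_def ij add_ac)
      show ?thesis unfolding gbinomial_product_opposite_shift b v binomial_int_of_nat ..
    qed
    also have "\<dots> = S (\<lambda>k. binomial_int i' k * binomial_int (j' + 4) (k + 2) * V (k + 1))"
      by (rule nat) (use ij in \<open>auto simp: bz\<close>)
    also have "\<dots> = S (\<lambda>k. (\<lambda>k. binomial_int i' (k - 1) * binomial_int (j' + 4) (k + 1) * V k) (k + 1))"
      by (simp add: add.assoc)
    also have "\<dots> = S (\<lambda>k. binomial_int i' (k - 1) * binomial_int (j' + 4) (k + 1) * V k)"
      by (rule shift) (use ij in \<open>auto simp: bz\<close>)
    finally show ?thesis .
  qed
  have equal: "(x gchoose (i + 2)) * (x gchoose (j + 2)) = S (\<lambda>k. binomial_int (i + 2) k * binomial_int (j + 2) k * V k)"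
  proof -
    have "(x gchoose (i + 2)) * (x gchoose (j + 2)) =
        (\<Sum>m\<le>j + 2. binomial_int (i + 2) (int m) * binomial_int (j + 2) (int m) * V (int m))"
      unfolding gbinomial_product_equal_shift binomial_int_of_nat by (simp only: V_def of_int_of_nat_eq)
    also have "\<dots> = S (\<lambda>k. binomial_int (i + 2) k * binomial_int (j + 2) k * V k)"
      by (rule nat) (use assms in \<open>auto simp: bz\<close>)
    finally show ?thesis .
  qed
  define e f where "e = binomial_int i" and "f = binomial_int j"
  have right1: "(\<Sum>m\<le>M. real (i choose m) * real (j choose m) * ((x + real m) gchoose (i + j + 2))) =
      S (\<lambda>k. e (k - 2) * f (k - 2) * V k) - 2 * S (\<lambda>k. e (k - 1) * f (k - 1) * V k) + S (\<lambda>k. e k * f k * V k)"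
  proof -
    have "(\<Sum>m\<le>M. real (i choose m) * real (j choose m) * ((x + real m) gchoose (i + j + 2))) =
        (\<Sum>m\<le>M. e (int m) * f (int m) * U (int m))" by (simp add: e_def f_def U_def)
    also have "\<dots> = S (\<lambda>k. e k * f k * U k)"
      by (rule nat) (use assms in \<open>auto simp: bz e_def\<close>)
    also have "\<dots> = S (\<lambda>k. e k * f k * V (k + 2)) - 2 * S (\<lambda>k. e k * f k * V (k + 1)) + S (\<lambda>k. e k * f k * V k)"
      unfolding lin UV by (simp add: algebra_simps)
    also have "S (\<lambda>k. e k * f k * V (k + 2)) = S (\<lambda>k. (\<lambda>k. e (k - 2) * f (k - 2) * V k) (k + 2))" by simp
    also have "\<dots> = S (\<lambda>k. e (k - 2) * f (k - 2) * V k)"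
      by (rule shift) (use assms in \<open>auto simp: bz e_def\<close>)
    also have "S (\<lambda>k. e k * f k * V (k + 1)) = S (\<lambda>k. (\<lambda>k. e (k - 1) * f (k - 1) * V k) (k + 1))" by simp
    also have "\<dots> = S (\<lambda>k. e (k - 1) * f (k - 1) * V k)"
      by (rule shift) (use assms in \<open>auto simp: bz e_def\<close>)
    finally show ?thesis .
  qed
  have right2: "(\<Sum>m\<le>M. real (a choose m) * real (b choose (m + 2)) * ((x + real (m + 1)) gchoose (i + j + 2))) =
      S (\<lambda>k. binomial_int a (k - 3) * binomial_int b (k - 1) * V k) -
      2 * S (\<lambda>k. binomial_int a (k - 2) * binomial_int b k * V k) +
      S (\<lambda>k. binomial_int a (k - 1) * binomial_int b (k + 1) * V k)"
    if ab: "a \<le> M" for a b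
  proof -
    let ?g = "\<lambda>d k. binomial_int a (k - d) * binomial_int b (k + 2 - d) * V k"
    have b: "binomial_int b (int m + 2) = real (b choose (m + 2))" for m
      using binomial_int_of_nat[of b "m + 2"] by (simp add: add.commute)
    have "(\<Sum>m\<le>M. real (a choose m) * real (b choose (m + 2)) * ((x + real (m + 1)) gchoose (i + j + 2))) =
        (\<Sum>m\<le>M. binomial_int a (int m) * binomial_int b (int m + 2) * U (int m + 1))"
      by (simp add: b U_def add.commute)
    also have "\<dots> = S (\<lambda>k. binomial_int a k * binomial_int b (k + 2) * U (k + 1))"
      by (rule nat) (use ab in \<open>auto simp: bz\<close>)
    also have "\<dots> = S (\<lambda>k. ?g 3 (k + 3)) - 2 * S (\<lambda>k. ?g 2 (k + 2)) + S (\<lambda>k. ?g 1 (k + 1))"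
      unfolding lin UV by (simp add: algebra_simps)
    also have "S (\<lambda>k. ?g 3 (k + 3)) = S (?g 3)" by (rule shift) (use ab in \<open>auto simp: bz\<close>)
    also have "S (\<lambda>k. ?g 2 (k + 2)) = S (?g 2)" by (rule shift) (use ab in \<open>auto simp: bz\<close>)
    also have "S (\<lambda>k. ?g 1 (k + 1)) = S (?g 1)" by (rule shift) (use ab in \<open>auto simp: bz\<close>)
    finally show ?thesis by (simp add: add.commute)
  qed
  have half: "a / 2 = inverse 2 * a" for a :: real by simp
  have right2': "(\<Sum>m\<le>M. (real (i choose m) * real (j choose (m + 2)) + real (i choose (m + 2)) * real (j choose m)) *
      ((x + real (m + 1)) gchoose (i + j + 2))) =
      (\<Sum>m\<le>M. real (i choose m) * real (j choose (m + 2)) * ((x + real (m + 1)) gchoose (i + j + 2))) +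
      (\<Sum>m\<le>M. real (j choose m) * real (i choose (m + 2)) * ((x + real (m + 1)) gchoose (i + j + 2)))"
    by (simp add: sum.distrib[symmetric] algebra_simps)
  have swap: "((x - 1) gchoose (i + 2)) * ((x + 1) gchoose (j + 2)) = ((x + 1) gchoose (j + 2)) * ((x - 1) gchoose (i + 2))"
    by simp
  have pascal: "binomial_int (n + 2) k = binomial_int n k + 2 * binomial_int n (k - 1) + binomial_int n (k - 2)"
    "binomial_int (n + 4) (k + 1) = binomial_int n (k + 1) + 4 * binomial_int n k + 6 * binomial_int n (k - 1) +
      4 * binomial_int n (k - 2) + binomial_int n (k - 3)" for n k
  proof -
    have "n + 2 = Suc (Suc n)" "n + 4 = Suc (Suc (Suc (Suc n)))" by simp_all
    then show "binomial_int (n + 2) k = binomial_int n k + 2 * binomial_int n (k - 1) + binomial_int n (k - 2)"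
      "binomial_int (n + 4) (k + 1) = binomial_int n (k + 1) + 4 * binomial_int n k + 6 * binomial_int n (k - 1) +
      4 * binomial_int n (k - 2) + binomial_int n (k - 3)"
      by (simp_all only: binomial_int_Suc) simp_all
  qed
  \<comment> \<open>The average over the exchange of \<open>i\<close> and \<open>j\<close> is what
    makes the coefficients match, since each mixed product alone is asymmetric in \<open>e\<close>
    and \<open>f\<close>.\<close>
  show ?thesis
    unfolding equal swap right1 right2' right2[OF assms(1), of j] right2[OF assms(2), of i]
      opposite[of i j, OF refl assms] opposite[of j i, OF add.commute assms(2,1)] half lin
    unfolding pascal e_def f_def
    by (rule arg_cong[where f = S], rule ext) (simp add: algebra_simps)
qed

section \<open>Generating functions of a polynomial and of its log-concavity defect\<close>

lemma fps_linear_nth: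
  fixes F :: "real fps"
  shows "fps_nth (F * fps_of_poly [:1, -1:]) n = fps_nth F n - (if n = 0 then 0 else fps_nth F (n - 1))"
  by (cases n) (simp_all add: fps_of_poly_pCons ring_distribs fps_X_mult_right_nth mult.assoc[symmetric])

text \<open>For \<open>m = N\<close> this is the negative binomial series, obtained by repeated
  differences; lowering \<open>m\<close> delays the sequence by \<open>N - m\<close> places.\<close>

lemma fps_binomial_column:
  assumes "m \<le> N"
  shows "Abs_fps (\<lambda>k. real ((k + m) choose N)) * fps_of_poly ([:1, -1:] ^ Suc N) = fps_of_poly (monom 1 (N - m))"
proof -
  have base: "Abs_fps (\<lambda>k. real ((k + N) choose N)) * fps_of_poly ([:1, -1:] ^ Suc N) = 1" for N
  proof (induction N)
    case 0
    show ?case by (rule fps_ext) (simp only: power_Suc power_0 mult_1_right fps_linear_nth, auto)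
  next
    case (Suc N)
    have "Abs_fps (\<lambda>k. real ((k + Suc N) choose Suc N)) * fps_of_poly [:1, -1:] = Abs_fps (\<lambda>k. real ((k + N) choose N))"
    proof (rule fps_ext)
      fix n
      show "fps_nth (Abs_fps (\<lambda>k. real ((k + Suc N) choose Suc N)) * fps_of_poly [:1, -1:]) n =
         fps_nth (Abs_fps (\<lambda>k. real ((k + N) choose N))) n"
        unfolding fps_linear_nth by (cases n) auto
    qed
    then have "Abs_fps (\<lambda>k. real ((k + Suc N) choose Suc N)) * fps_of_poly ([:1, -1:] ^ Suc (Suc N)) =
       Abs_fps (\<lambda>k. real ((k + N) choose N)) * fps_of_poly ([:1, -1:] ^ Suc N)"
      by (simp only: power_Suc[of _ "Suc N"] fps_of_poly_mult mult.assoc[symmetric])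
    then show ?case using Suc by simp
  qed
  have "Abs_fps (\<lambda>k. real ((k + m) choose N)) = fps_of_poly (monom 1 (N - m)) * Abs_fps (\<lambda>k. real ((k + N) choose N))"
    by (rule fps_ext) (use assms in \<open>auto simp: fps_of_poly_monom fps_X_power_mult_nth binomial_eq_0\<close>)
  then show ?thesis using base[of N] by (simp only: mult.assoc mult_1_right)
qed

text \<open>The coefficient of \<open>u\<^sup>m\<close> in \<open>\<Sum>i\<le>e. c i * (x + u)\<^sup>i * (1 - x)\<^sup>e\<^sup>-\<^sup>i\<close>, as a polynomial in \<open>x\<close>.\<close>
definition shifted_coeff_poly :: "(nat \<Rightarrow> real) \<Rightarrow> nat \<Rightarrow> nat \<Rightarrow> real poly" where
  "shifted_coeff_poly c e m = (\<Sum>i\<le>e. smult (c i * real (i choose m)) (monom 1 (i - m) * [:1, -1:] ^ (e - i)))"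

text \<open>The polynomial \<open>G\<close> of the overview. If \<open>B m\<close> is the value of
  \<open>shifted_coeff_poly c e m\<close> at \<open>x = y^2\<close> and
  \<open>b m = y^m * B m\<close>, then \<open>b m * b m\<close> and \<open>b m * b (m + 2)\<close>
  involve only even powers of \<open>y\<close>.\<close>

definition defect_poly :: "(nat \<Rightarrow> real) \<Rightarrow> nat \<Rightarrow> real poly" where
  "defect_poly c e = (\<Sum>m\<le>e. monom 1 m * (shifted_coeff_poly c e m)\<^sup>2) -
     (\<Sum>m\<le>e. monom 1 (m + 1) * (shifted_coeff_poly c e m * shifted_coeff_poly c e (m + 2)))"

text \<open>The \<open>i\<close>-th summand has generating function
  \<open>x^(i + 2) / (1 - x)^(i + 3)\<close>; the common denominator supplies the factors
  \<open>(1 - x)^(e - i)\<close>.\<close>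

lemma fps_newton_numerator:
  "Abs_fps (\<lambda>k. \<Sum>i\<le>e. c i * (real k gchoose (i + 2))) * fps_of_poly ([:1, -1:] ^ (e + 3)) =
     fps_of_poly (monom 1 2 * shifted_coeff_poly c e 0)"
proof -
  have "Abs_fps (\<lambda>k. \<Sum>i\<le>e. c i * (real k gchoose (i + 2))) =
     (\<Sum>i\<le>e. fps_const (c i) * Abs_fps (\<lambda>k. real ((k + 0) choose (i + 2))))"
    by (rule fps_ext) (simp add: fps_sum_nth binomial_gbinomial del: add_2_eq_Suc')
  then have "Abs_fps (\<lambda>k. \<Sum>i\<le>e. c i * (real k gchoose (i + 2))) * fps_of_poly ([:1, -1:] ^ (e + 3)) =
     (\<Sum>i\<le>e. fps_const (c i) * (Abs_fps (\<lambda>k. real ((k + 0) choose (i + 2))) * fps_of_poly ([:1, -1:] ^ (e + 3))))"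
    by (simp only: sum_distrib_right mult.assoc)
  also have "\<dots> = (\<Sum>i\<le>e. fps_const (c i) * fps_of_poly (monom 1 2 * (monom 1 i * [:1, -1:] ^ (e - i))))"
  proof (rule sum.cong)
    fix i assume i: "i \<in> {..e}"
    have "e + 3 = Suc (i + 2) + (e - i)" using i by simp
    then have "Abs_fps (\<lambda>k. real ((k + 0) choose (i + 2))) * fps_of_poly ([:1, -1:] ^ (e + 3)) =
      (Abs_fps (\<lambda>k. real ((k + 0) choose (i + 2))) * fps_of_poly ([:1, -1:] ^ Suc (i + 2))) * fps_of_poly ([:1, -1:] ^ (e - i))"
      by (simp only: power_add fps_of_poly_mult mult.assoc)
    also have "\<dots> = fps_of_poly (monom 1 (i + 2) * [:1, -1:] ^ (e - i))"
      unfolding fps_binomial_column[OF zero_le] by (simp only: fps_of_poly_mult diff_zero)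
    also have "monom 1 (i + 2) = (monom 1 2 * monom 1 i :: real poly)" by (simp add: mult_monom)
    finally show "fps_const (c i) * (Abs_fps (\<lambda>k. real ((k + 0) choose (i + 2))) * fps_of_poly ([:1, -1:] ^ (e + 3))) =
       fps_const (c i) * fps_of_poly (monom 1 2 * (monom 1 i * [:1, -1:] ^ (e - i)))"
      by (simp only: mult.assoc)
  qed simp
  also have "\<dots> = fps_of_poly (monom 1 2 * shifted_coeff_poly c e 0)"
    by (simp add: shifted_coeff_poly_def sum_distrib_left fps_of_poly_sum fps_of_poly_smult[symmetric] del: fps_of_poly_smult)
  finally show ?thesis .
qed

lemma smult_sum_right: "smult a (sum f A) = (\<Sum>x\<in>A. smult a (f x))"
  by (induction A rule: infinite_finite_induct) (simp_all add: smult_add_right)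

text \<open>A quadratic form in \<open>c\<close>, written symmetrically so that its entries have the
  shape of the binomial identity. Up to \<open>x^2\<close>, \<open>t e i j m\<close> is the
  numerator of the series of \<open>(k + m) choose (i + j + 2)\<close> over
  \<open>(1 - x)^(2 e + 3)\<close>.\<close>

lemma defect_poly_bilinear:
  defines "t \<equiv> \<lambda>e i j m. monom 1 (i + j - m) * [:1, -1 :: real:] ^ (2 * e - i - j)"
  shows "defect_poly c e = (\<Sum>i\<le>e. \<Sum>j\<le>e. smult (c i * c j)
     ((\<Sum>m\<le>e. smult (real (i choose m) * real (j choose m)) (t e i j m)) -
      (\<Sum>m\<le>e. smult ((real (i choose m) * real (j choose (m + 2)) + real (i choose (m + 2)) * real (j choose m)) / 2) (t e i j (m + 1)))))"
proof -
  let ?b = "\<lambda>i m. real (i choose m)"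
  have prod: "monom 1 d * (shifted_coeff_poly c e m * shifted_coeff_poly c e l) =
     (\<Sum>i\<le>e. \<Sum>j\<le>e. smult (c i * c j) (smult (?b i m * ?b j l) (t e i j (m + l - d))))" if d: "d \<le> m + l" for m l d
  proof -
    have "monom 1 d * (shifted_coeff_poly c e m * shifted_coeff_poly c e l) = (\<Sum>i\<le>e. \<Sum>j\<le>e.
        monom 1 d * (smult (c i * ?b i m) (monom 1 (i - m) * [:1, -1:] ^ (e - i)) *
        smult (c j * ?b j l) (monom 1 (j - l) * [:1, -1:] ^ (e - j))))"
      unfolding shifted_coeff_poly_def sum_product by (simp only: sum_distrib_left)
    also have "\<dots> = (\<Sum>i\<le>e. \<Sum>j\<le>e. smult (c i * c j) (smult (?b i m * ?b j l) (t e i j (m + l - d))))"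
    proof (intro sum.cong refl)
      fix i j assume ij: "i \<in> {..e}" "j \<in> {..e}"
      show "monom 1 d * (smult (c i * ?b i m) (monom 1 (i - m) * [:1, -1:] ^ (e - i)) *
        smult (c j * ?b j l) (monom 1 (j - l) * [:1, -1:] ^ (e - j))) =
        smult (c i * c j) (smult (?b i m * ?b j l) (t e i j (m + l - d)))"
      proof (cases "m \<le> i \<and> l \<le> j")
        case True
        have *: "i + j - (m + l - d) = d + ((i - m) + (j - l))" "2 * e - i - j = (e - i) + (e - j)"
          using True d ij by auto
        have "t e i j (m + l - d) = monom 1 d * ((monom 1 (i - m) * [:1, -1:] ^ (e - i)) * (monom 1 (j - l) * [:1, -1:] ^ (e - j)))"
        proof -
          have "monom 1 (d + ((i - m) + (j - l))) = (monom 1 d * (monom 1 (i - m) * monom 1 (j - l)) :: real poly)"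
            by (simp add: mult_monom)
          then show ?thesis using * unfolding t_def by (simp only: power_add ac_simps)
        qed
        then show ?thesis by (simp only: mult_smult_left mult_smult_right smult_smult ac_simps)
      next
        \<comment> \<open>The exponents are truncated differences here, but a binomial factor
          vanishes in exactly these cases.\<close>
        case False
        then have "?b i m = 0 \<or> ?b j l = 0" by (auto simp: binomial_eq_0)
        then show ?thesis
          by (elim disjE) (simp_all only: mult_zero_left mult_zero_right smult_0_left smult_0_right)
      qed
    qed
    finally show ?thesis .
  qed
  have sym: "t e i j m = t e j i m" for i j m by (simp add: t_def add.commute diff_commute)
  \<comment> \<open>The exponent is symmetric in \<open>i\<close> and \<open>j\<close>, so the
    double sum equals the mean of itself and its transpose.\<close>
  have half: "(\<Sum>i\<le>e. \<Sum>j\<le>e. smult (c i * c j) (smult (?b i m * ?b j (m + 2)) (t e i j (m + 1)))) =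
    (\<Sum>i\<le>e. \<Sum>j\<le>e. smult (c i * c j) (smult ((?b i m * ?b j (m + 2) + ?b i (m + 2) * ?b j m) / 2) (t e i j (m + 1))))"
    (is "?X = _") for m
  proof -
    have "?X = (\<Sum>i\<le>e. \<Sum>j\<le>e. smult (c i * c j) (smult (?b i (m + 2) * ?b j m) (t e i j (m + 1))))"
      by (subst sum.swap) (simp only: sym[of _ _ "m + 1"] mult.commute)
    moreover have "?X = smult (1 / 2) ?X + smult (1 / 2) ?X" by (simp add: smult_add_left[symmetric])
    ultimately have "?X = smult (1 / 2) ?X +
        smult (1 / 2) (\<Sum>i\<le>e. \<Sum>j\<le>e. smult (c i * c j) (smult (?b i (m + 2) * ?b j m) (t e i j (m + 1))))"
      by simp
    then show ?thesis
      by (simp only: smult_sum_right smult_smult sum.distrib[symmetric] smult_add_left[symmetric])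
        (simp only: add_divide_distrib ring_distribs times_divide_eq_right mult_1_left mult_1_right times_divide_eq_left ac_simps)
  qed
  have "(\<Sum>m\<le>e. monom 1 m * (shifted_coeff_poly c e m)\<^sup>2) =
     (\<Sum>m\<le>e. \<Sum>i\<le>e. \<Sum>j\<le>e. smult (c i * c j) (smult (?b i m * ?b j m) (t e i j m)))"
    using prod[of m m m for m] by (simp add: power2_eq_square)
  also have "\<dots> = (\<Sum>i\<le>e. \<Sum>j\<le>e. \<Sum>m\<le>e. smult (c i * c j) (smult (?b i m * ?b j m) (t e i j m)))"
    by (subst sum.swap) (rule sum.cong[OF refl], rule sum.swap)
  finally have 1: "(\<Sum>m\<le>e. monom 1 m * (shifted_coeff_poly c e m)\<^sup>2) =
    (\<Sum>i\<le>e. \<Sum>j\<le>e. \<Sum>m\<le>e. smult (c i * c j) (smult (?b i m * ?b j m) (t e i j m)))" .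
  have "(\<Sum>m\<le>e. monom 1 (m + 1) * (shifted_coeff_poly c e m * shifted_coeff_poly c e (m + 2))) =
     (\<Sum>m\<le>e. \<Sum>i\<le>e. \<Sum>j\<le>e. smult (c i * c j) (smult (?b i m * ?b j (m + 2)) (t e i j (m + 1))))"
  proof (rule sum.cong)
    fix m :: nat
    have "m + (m + 2) - (m + 1) = m + 1" "m + 1 \<le> m + (m + 2)" by auto
    then show "monom 1 (m + 1) * (shifted_coeff_poly c e m * shifted_coeff_poly c e (m + 2)) =
      (\<Sum>i\<le>e. \<Sum>j\<le>e. smult (c i * c j) (smult (?b i m * ?b j (m + 2)) (t e i j (m + 1))))"
      using prod[of "m + 1" m "m + 2"] by simp
  qed simp
  also have "\<dots> = (\<Sum>i\<le>e. \<Sum>j\<le>e. \<Sum>m\<le>e. smult (c i * c j) (smult ((?b i m * ?b j (m + 2) + ?b i (m + 2) * ?b j m) / 2) (t e i j (m + 1))))"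
    unfolding half by (subst sum.swap) (rule sum.cong[OF refl], rule sum.swap)
  finally have 2: "(\<Sum>m\<le>e. monom 1 (m + 1) * (shifted_coeff_poly c e m * shifted_coeff_poly c e (m + 2))) =
    (\<Sum>i\<le>e. \<Sum>j\<le>e. \<Sum>m\<le>e. smult (c i * c j) (smult ((?b i m * ?b j (m + 2) + ?b i (m + 2) * ?b j m) / 2) (t e i j (m + 1))))" .
  show ?thesis unfolding defect_poly_def 1 2
    by (simp only: sum_subtractf[symmetric] smult_sum_right smult_diff_right)
qed

text \<open>Both sides are quadratic forms in \<open>c\<close>. The binomial identity matches them
  entry by entry, each binomial sequence being replaced by its rational generating function.\<close>

lemma fps_defect_numerator:
  assumes P: "\<And>x. P x = (\<Sum>i\<le>e. c i * (x gchoose (i + 2)))"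
  shows "Abs_fps (\<lambda>k. (P (real k))\<^sup>2 - P (real k - 1) * P (real k + 1)) * fps_of_poly ([:1, -1:] ^ (2 * e + 3)) =
     fps_of_poly (monom 1 2 * defect_poly c e)"
proof -
  let ?b = "\<lambda>i m. real (i choose m)"
  let ?b2 = "\<lambda>i j m. (?b i m * ?b j (m + 2) + ?b i (m + 2) * ?b j m) / 2"
  define t where "t = (\<lambda>e i j m. monom 1 (i + j - m) * [:1, -1 :: real:] ^ (2 * e - i - j))"
  define D where "D = fps_of_poly ([:1, -1 :: real:] ^ (2 * e + 3))"
  define F where "F i j m = Abs_fps (\<lambda>k. real ((k + m) choose (i + j + 2)))" for i j m
  have F: "F i j m * D = fps_of_poly (monom 1 2 * t e i j m)" if "i \<le> e" "j \<le> e" "m \<le> i + j" for i j m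
  proof -
    have "2 * e + 3 = Suc (i + j + 2) + (2 * e - i - j)" using that by simp
    then have "F i j m * D = (F i j m * fps_of_poly ([:1, -1:] ^ Suc (i + j + 2))) * fps_of_poly ([:1, -1:] ^ (2 * e - i - j))"
      unfolding D_def by (simp only: power_add fps_of_poly_mult mult.assoc)
    also have "F i j m * fps_of_poly ([:1, -1:] ^ Suc (i + j + 2)) = fps_of_poly (monom 1 (i + j + 2 - m))"
      unfolding F_def by (rule fps_binomial_column) (use that in simp)
    also have "monom 1 (i + j + 2 - m) = (monom 1 2 * monom 1 (i + j - m) :: real poly)"
      using that by (simp add: mult_monom Suc_diff_le)
    finally show ?thesis by (simp only: t_def fps_of_poly_mult mult.assoc)
  qed
  have "(P (real k))\<^sup>2 - P (real k - 1) * P (real k + 1) =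
    (\<Sum>i\<le>e. \<Sum>j\<le>e. c i * c j * ((\<Sum>m\<le>e. ?b i m * ?b j m * fps_nth (F i j m) k) - (\<Sum>m\<le>e. ?b2 i j m * fps_nth (F i j (m + 1)) k)))" for k
  proof -
    let ?x = "real k"
    let ?B = "\<lambda>x i. x gchoose (i + 2) :: real"
    have "P (?x - 1) * P (?x + 1) = (\<Sum>i\<le>e. \<Sum>j\<le>e. c i * c j * (?B (?x - 1) i * ?B (?x + 1) j))"
      unfolding P sum_product by (simp only: ac_simps)
    moreover have "P (?x - 1) * P (?x + 1) = (\<Sum>i\<le>e. \<Sum>j\<le>e. c i * c j * (?B (?x + 1) i * ?B (?x - 1) j))"
      unfolding P sum_product by (subst sum.swap) (simp only: ac_simps)
    moreover have "z = a \<Longrightarrow> z = b \<Longrightarrow> z = (a + b) / 2" for z a b :: real by simp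
    ultimately have "P (?x - 1) * P (?x + 1) =
       ((\<Sum>i\<le>e. \<Sum>j\<le>e. c i * c j * (?B (?x - 1) i * ?B (?x + 1) j)) + (\<Sum>i\<le>e. \<Sum>j\<le>e. c i * c j * (?B (?x + 1) i * ?B (?x - 1) j))) / 2"
      by blast
    also have "\<dots> = (\<Sum>i\<le>e. \<Sum>j\<le>e. c i * c j * ((?B (?x + 1) i * ?B (?x - 1) j + ?B (?x - 1) i * ?B (?x + 1) j) / 2))"
      by (simp only: sum.distrib[symmetric] sum_divide_distrib ring_distribs add_divide_distrib times_divide_eq_right add.commute)
    finally have "(P ?x)\<^sup>2 - P (?x - 1) * P (?x + 1) = (\<Sum>i\<le>e. \<Sum>j\<le>e. c i * c j *
        (?B ?x i * ?B ?x j - (?B (?x + 1) i * ?B (?x - 1) j + ?B (?x - 1) i * ?B (?x + 1) j) / 2))"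
      unfolding power2_eq_square P[of ?x] sum_product
      by (simp only: sum_subtractf[symmetric] right_diff_distrib ac_simps)
    also have "\<dots> = (\<Sum>i\<le>e. \<Sum>j\<le>e. c i * c j *
        ((\<Sum>m\<le>e. ?b i m * ?b j m * fps_nth (F i j m) k) - (\<Sum>m\<le>e. ?b2 i j m * fps_nth (F i j (m + 1)) k)))"
    proof (intro sum.cong refl arg_cong2[where f = "(*)"])
      fix i j assume ij: "i \<in> {..e}" "j \<in> {..e}"
      have nth: "fps_nth (F i j m) k = ((?x + real m) gchoose (i + j + 2))" for m
        by (simp only: F_def fps_nth_Abs_fps binomial_gbinomial of_nat_add)
      show "?B ?x i * ?B ?x j - (?B (?x + 1) i * ?B (?x - 1) j + ?B (?x - 1) i * ?B (?x + 1) j) / 2 =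
        (\<Sum>m\<le>e. ?b i m * ?b j m * fps_nth (F i j m) k) - (\<Sum>m\<le>e. ?b2 i j m * fps_nth (F i j (m + 1)) k)"
        using gbinomial_log_concavity_defect[of i e j ?x] ij unfolding nth
        by (simp only: atMost_iff sum_divide_distrib times_divide_eq_left)
    qed
    finally show ?thesis .
  qed
  then have "Abs_fps (\<lambda>k. (P (real k))\<^sup>2 - P (real k - 1) * P (real k + 1)) =
    (\<Sum>i\<le>e. \<Sum>j\<le>e. fps_const (c i * c j) * ((\<Sum>m\<le>e. fps_const (?b i m * ?b j m) * F i j m) - (\<Sum>m\<le>e. fps_const (?b2 i j m) * F i j (m + 1))))"
    by (intro fps_ext) (simp only: fps_nth_Abs_fps fps_sum_nth fps_mult_left_const_nth fps_sub_nth)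
  then have "Abs_fps (\<lambda>k. (P (real k))\<^sup>2 - P (real k - 1) * P (real k + 1)) * D =
    (\<Sum>i\<le>e. \<Sum>j\<le>e. fps_const (c i * c j) * ((\<Sum>m\<le>e. fps_const (?b i m * ?b j m) * (F i j m * D)) - (\<Sum>m\<le>e. fps_const (?b2 i j m) * (F i j (m + 1) * D))))"
    by (simp only: sum_distrib_right mult.assoc left_diff_distrib)
  also have "\<dots> = (\<Sum>i\<le>e. \<Sum>j\<le>e. fps_const (c i * c j) * ((\<Sum>m\<le>e. fps_const (?b i m * ?b j m) * fps_of_poly (monom 1 2 * t e i j m)) -
      (\<Sum>m\<le>e. fps_const (?b2 i j m) * fps_of_poly (monom 1 2 * t e i j (m + 1)))))"
  proof (rule sum.cong[OF refl], rule sum.cong[OF refl])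
    fix i j assume ij: "i \<in> {..e}" "j \<in> {..e}"
    \<comment> \<open>The numerator formula is available only for \<open>m <= i + j\<close>; beyond
      that range the binomial weights vanish, here and in the next fact.\<close>
    have 1: "fps_const (?b i m * ?b j m) * (F i j m * D) = fps_const (?b i m * ?b j m) * fps_of_poly (monom 1 2 * t e i j m)" for m
      using F[of i j m] ij by (cases "m \<le> i") (auto simp: binomial_eq_0)
    have 2: "fps_const (?b2 i j m) * (F i j (m + 1) * D) = fps_const (?b2 i j m) * fps_of_poly (monom 1 2 * t e i j (m + 1))" for m
    proof (cases "m + 1 \<le> i + j")
      case True
      then show ?thesis using F[of i j "m + 1"] ij by simp
    next
      case False
      then have "?b2 i j m = 0" by (auto simp: binomial_eq_0)
      then show ?thesis by simp
    qed
    show "fps_const (c i * c j) * ((\<Sum>m\<le>e. fps_const (?b i m * ?b j m) * (F i j m * D)) - (\<Sum>m\<le>e. fps_const (?b2 i j m) * (F i j (m + 1) * D))) =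
      fps_const (c i * c j) * ((\<Sum>m\<le>e. fps_const (?b i m * ?b j m) * fps_of_poly (monom 1 2 * t e i j m)) -
      (\<Sum>m\<le>e. fps_const (?b2 i j m) * fps_of_poly (monom 1 2 * t e i j (m + 1))))"
      by (simp only: 1 2)
  qed
  also have "\<dots> = fps_of_poly (monom 1 2 * defect_poly c e)"
    unfolding defect_poly_bilinear t_def
    by (simp only: sum_distrib_left right_diff_distrib mult_smult_right fps_of_poly_sum fps_of_poly_smult fps_of_poly_diff)
  finally show ?thesis unfolding D_def .
qed

section \<open>Zeros of the numerators\<close>

abbreviation complex_poly :: "real poly \<Rightarrow> complex poly" where
  "complex_poly \<equiv> map_poly complex_of_real"

lemma complex_poly_add: "complex_poly (p + q) = complex_poly p + complex_poly q"
  by (rule poly_eqI) (simp add: coeff_map_poly)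

lemma complex_poly_smult: "complex_poly (smult a p) = smult (complex_of_real a) (complex_poly p)"
  by (rule poly_eqI) (simp add: coeff_map_poly)

lemma complex_poly_mult: "complex_poly (p * q) = complex_poly p * complex_poly q"
  by (induction p) (simp_all add: complex_poly_add complex_poly_smult map_poly_pCons)

lemma complex_poly_diff: "complex_poly (p - q) = complex_poly p - complex_poly q"
  by (rule poly_eqI) (simp add: coeff_map_poly)

lemma complex_poly_sum: "complex_poly (sum f A) = (\<Sum>x\<in>A. complex_poly (f x))"
  by (induction A rule: infinite_finite_induct) (simp_all add: complex_poly_add)

lemma complex_poly_power: "complex_poly (p ^ n) = complex_poly p ^ n"
  by (induction n) (simp_all add: complex_poly_mult)

lemma poly_complex_poly_of_real: "poly (complex_poly p) (of_real x) = of_real (poly p x)"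
  by (induction p) (simp_all add: map_poly_pCons)

lemma complex_poly_prod_list: "complex_poly (prod_list ps) = (\<Prod>p\<leftarrow>ps. complex_poly p)"
  by (induction ps) (simp_all add: complex_poly_mult)

lemma real_poly_nonpos_roots_factor:
  fixes p :: "real poly"
  assumes "p \<noteq> 0" "\<And>z. poly (complex_poly p) z = 0 \<Longrightarrow> \<exists>t\<le>0. z = of_real t"
  shows "\<exists>ss. (\<forall>s\<in>set ss. s \<ge> 0 \<and> poly p (-s) = 0) \<and> length ss = degree p \<and>
    p = smult (lead_coeff p) (\<Prod>s\<leftarrow>ss. [:s, 1:])"
  using assms
proof (induction "degree p" arbitrary: p)
  case 0
  then obtain x where "p = [:x:]" by (metis degree_eq_zeroE)
  then show ?case by (intro exI[of _ "[]"]) simp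
next
  case (Suc n)
  have "degree (complex_poly p) = Suc n" using Suc.hyps(2) by (simp add: degree_map_poly)
  then have "\<not> constant (poly (complex_poly p))" by (simp add: constant_degree)
  then obtain z where "poly (complex_poly p) z = 0" using fundamental_theorem_of_algebra by blast
  moreover from this obtain t where t: "t \<le> 0" "z = of_real t"
    using Suc.prems(2) by blast
  ultimately have pt: "poly p t = 0" by (simp add: poly_complex_poly_of_real)
  then have "[:-t, 1:] dvd p" by (simp add: poly_eq_0_iff_dvd)
  then obtain q where q: "p = [:-t, 1:] * q" by blast
  have q0: "q \<noteq> 0" using q Suc.prems(1) by auto
  have "degree p = degree [:-t, 1:] + degree q" unfolding q by (rule degree_mult_eq) (use q0 in auto)
  then have "n = degree q" using Suc.hyps(2) by simp
  have roots: "\<exists>t\<le>0. z = of_real t" if "poly (complex_poly q) z = 0" for z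
    by (rule Suc.prems(2)) (simp only: q complex_poly_mult poly_mult mult_zero_right that)
  obtain ss where ss: "\<forall>s\<in>set ss. s \<ge> 0 \<and> poly q (-s) = 0" "length ss = degree q"
    "q = smult (lead_coeff q) (\<Prod>s\<leftarrow>ss. [:s, 1:])"
    using Suc.hyps(1)[OF \<open>n = degree q\<close> q0 roots] by blast
  have lead: "lead_coeff p = lead_coeff q"
    unfolding q lead_coeff_mult by simp
  have fact: "p = smult (lead_coeff p) (\<Prod>s\<leftarrow>(- t) # ss. [:s, 1:])"
    unfolding lead list.map prod_list.Cons mult_smult_right[symmetric]
    by (rule trans[OF q arg_cong[OF ss(3), of "(*) [:-t, 1:]"]])
  have "poly p (-s) = 0" if "s \<in> set ss" for s
    using ss(1) that unfolding q by simp
  then have nonneg: "\<forall>s\<in>set ((- t) # ss). s \<ge> 0 \<and> poly p (-s) = 0" using ss(1) t(1) pt by simp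
  have len: "length ((- t) # ss) = degree p" using ss(2) \<open>n = degree q\<close> Suc.hyps(2) by simp
  show ?case by (intro exI[of _ "(- t) # ss"] conjI nonneg len fact)
qed

lemma poly_shifted_coeff_poly:
  "poly (complex_poly (shifted_coeff_poly c e m)) x =
    coeff (\<Sum>i\<le>e. smult (of_real (c i)) ([:x, 1:] ^ i * [:1 - x:] ^ (e - i))) m"
proof -
  have *: "coeff (smult (of_real (c i)) ([:x, 1:] ^ i * [:1 - x:] ^ (e - i))) m =
    of_real (c i * real (i choose m)) * (x ^ (i - m) * (1 - x) ^ (e - i))" for i
  proof -
    have "[:1 - x:] ^ (e - i) = [:(1 - x) ^ (e - i):]" by (simp add: poly_const_pow)
    then show ?thesis
      by (cases "m \<le> i") (simp_all add: coeff_linear_poly_power coeff_eq_0 degree_linear_power)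
  qed
  show ?thesis
    unfolding coeff_sum *
    by (simp add: shifted_coeff_poly_def complex_poly_sum complex_poly_smult complex_poly_mult complex_poly_power
        map_poly_monom map_poly_pCons poly_sum poly_monom)
qed

lemma coeff_prod_list_scale:
  "coeff (\<Prod>a\<leftarrow>as. [:a, y:]) m = y ^ m * coeff (\<Prod>a\<leftarrow>as. [:a, 1:]) (m :: nat)"
  for y :: "'a :: comm_ring_1"
proof (induction as arbitrary: m)
  case Nil
  then show ?case by (cases m) simp_all
next
  case (Cons a as)
  then show ?case by (cases m) (simp_all add: algebra_simps)
qed

text \<open>Homogenizing the product of the \<open>z + \<rho>\<close> with
  \<open>z = (x + u) / (1 - x)\<close> gives the product of the
  \<open>x + \<rho> (1 - x) + u\<close>. Then \<open>u = y t\<close> with \<open>y^2 = x\<close>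
  absorbs the powers of \<open>x\<close> into the coefficients of \<open>b\<close>.\<close>

lemma defect_poly_eval:
  fixes x y :: complex
  assumes xy: "x = y\<^sup>2" and E: "(\<Sum>i\<le>e. monom (c i) i) = smult k (\<Prod>\<rho>\<leftarrow>\<rho>s. [:\<rho>, 1:])" "length \<rho>s = e"
  defines "\<alpha> \<equiv> map (\<lambda>\<rho>. x + of_real \<rho> * (1 - x)) \<rho>s"
  defines "b \<equiv> (\<Prod>a\<leftarrow>\<alpha>. [:a, y:])"
  shows "poly (complex_poly (defect_poly c e)) x = (of_real k)\<^sup>2 *
    ((\<Sum>m\<le>e. (coeff b m)\<^sup>2) - (\<Sum>m\<le>e. coeff b m * coeff b (m + 2)))"
proof -
  define B where "B m = poly (complex_poly (shifted_coeff_poly c e m)) x" for m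
  have c: "of_real (c i) = complex_of_real k * coeff (\<Prod>\<rho>\<leftarrow>\<rho>s. [:of_real \<rho>, 1:]) i" if "i \<le> e" for i
  proof -
    have "c i = coeff (\<Sum>i\<le>e. monom (c i) i) i" using that by (simp add: coeff_sum)
    also have "\<dots> = k * coeff (\<Prod>\<rho>\<leftarrow>\<rho>s. [:\<rho>, 1:]) i" unfolding E(1) by simp
    finally have "complex_of_real (c i) = of_real k * coeff (complex_poly (\<Prod>\<rho>\<leftarrow>\<rho>s. [:\<rho>, 1:])) i"
      by (simp add: coeff_map_poly)
    then show ?thesis by (simp add: complex_poly_prod_list o_def map_poly_pCons)
  qed
  have "(\<Sum>i\<le>e. smult (of_real (c i)) ([:x, 1:] ^ i * [:1 - x:] ^ (e - i))) =
    smult (of_real k) (\<Sum>i\<le>length (map (\<lambda>\<rho>. (complex_of_real \<rho>, 1 :: complex)) \<rho>s).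
      smult (coeff (\<Prod>(v, u)\<leftarrow>map (\<lambda>\<rho>. (complex_of_real \<rho>, 1 :: complex)) \<rho>s. [:v, u:]) i)
        ([:x, 1:] ^ i * [:1 - x:] ^ (length (map (\<lambda>\<rho>. (complex_of_real \<rho>, 1 :: complex)) \<rho>s) - i)))"
    unfolding smult_sum_right
    by (rule sum.cong) (use E(2) c in \<open>auto simp: o_def\<close>)
  also have "\<dots> = smult (of_real k) (\<Prod>\<rho>\<leftarrow>\<rho>s. smult (of_real \<rho>) [:1 - x:] + smult 1 [:x, 1:])"
    unfolding prod_list_homogenization[symmetric] by (simp add: o_def)
  also have "\<dots> = smult (of_real k) (\<Prod>a\<leftarrow>\<alpha>. [:a, 1:])"
    by (simp add: \<alpha>_def o_def add.commute)
  finally have B: "B m = of_real k * coeff (\<Prod>a\<leftarrow>\<alpha>. [:a, 1:]) m" for m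
    unfolding B_def poly_shifted_coeff_poly by simp
  have yB: "y ^ m * B m = of_real k * coeff b m" for m
    unfolding b_def coeff_prod_list_scale[of y] B by (rule mult.left_commute)
  have x: "x ^ m = y ^ m * y ^ m" for m
    unfolding xy power2_eq_square power_mult_distrib ..
  have "poly (complex_poly (defect_poly c e)) x = (\<Sum>m\<le>e. x ^ m * (B m)\<^sup>2) - (\<Sum>m\<le>e. x ^ (m + 1) * (B m * B (m + 2)))"
    by (simp add: defect_poly_def complex_poly_diff complex_poly_sum complex_poly_mult complex_poly_power
        map_poly_monom poly_sum poly_monom B_def)
  also have "(\<Sum>m\<le>e. x ^ m * (B m)\<^sup>2) = (\<Sum>m\<le>e. (of_real k)\<^sup>2 * (coeff b m)\<^sup>2)"
  proof (rule sum.cong)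
    fix m
    have "x ^ m * (B m)\<^sup>2 = (y ^ m * B m)\<^sup>2"
      unfolding x by (simp add: power2_eq_square ac_simps)
    then show "x ^ m * (B m)\<^sup>2 = (of_real k)\<^sup>2 * (coeff b m)\<^sup>2"
      unfolding yB by (simp add: power_mult_distrib)
  qed simp
  also have "(\<Sum>m\<le>e. x ^ (m + 1) * (B m * B (m + 2))) = (\<Sum>m\<le>e. (of_real k)\<^sup>2 * (coeff b m * coeff b (m + 2)))"
  proof (rule sum.cong)
    fix m
    have "x ^ (m + 1) * (B m * B (m + 2)) = (y ^ m * B m) * (y ^ (m + 2) * B (m + 2))"
      unfolding x by (simp add: ac_simps)
    also have "\<dots> = (of_real k)\<^sup>2 * (coeff b m * coeff b (m + 2))"
      unfolding yB by (simp add: power2_eq_square)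
    finally show "x ^ (m + 1) * (B m * B (m + 2)) = (of_real k)\<^sup>2 * (coeff b m * coeff b (m + 2))" .
  qed simp
  finally show ?thesis by (simp add: sum_distrib_left right_diff_distrib)
qed

text \<open>Off the nonpositive real axis the principal square root of \<open>x\<close> has positive
  real part, and \<open>\<rho>\<close> in \<open>[0, 1]\<close> then keeps all quotients in the
  right half-plane, where the functional cannot vanish.\<close>

lemma defect_poly_roots:
  assumes E: "(\<Sum>i\<le>e. monom (c i) i) = smult k (\<Prod>\<rho>\<leftarrow>\<rho>s. [:\<rho>, 1:])" "length \<rho>s = e"
    and k: "k \<noteq> 0" and \<rho>: "\<And>\<rho>. \<rho> \<in> set \<rho>s \<Longrightarrow> 0 \<le> \<rho> \<and> \<rho> \<le> 1"
    and x: "poly (complex_poly (defect_poly c e)) x = 0"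
  shows "\<exists>t\<le>0. x = of_real t"
proof (rule ccontr)
  assume neg: "\<not> ?thesis"
  define y where "y = csqrt x"
  have xy: "x = y\<^sup>2" by (simp add: y_def)
  have Re: "Re y > 0"
  proof (rule ccontr)
    assume "\<not> 0 < Re y"
    then have "y = \<i> * of_real (Im y)" using csqrt_principal[of x] by (simp add: y_def complex_eq_iff)
    then have "x = of_real (- (Im y)\<^sup>2)" unfolding xy by (metis of_real_minus of_real_power power2_i power_mult_distrib mult_minus1)
    moreover have "- (Im y)\<^sup>2 \<le> 0" by simp
    ultimately show False using neg by blast
  qed
  then have y0: "y \<noteq> 0" by auto
  let ?a = "\<lambda>\<rho>. x + complex_of_real \<rho> * (1 - x)"
  have "Re (?a \<rho> / y) > 0" if "\<rho> \<in> set \<rho>s" for \<rho>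
  proof -
    have r: "0 \<le> \<rho>" "\<rho> \<le> 1" using \<rho>[OF that] by auto
    have "(of_real (1 - \<rho>) * y + of_real \<rho> * inverse y) * y = of_real (1 - \<rho>) * (y * y) + of_real \<rho>"
      by (simp only: distrib_right mult.assoc left_inverse[OF y0] mult_1_right)
    also have "\<dots> = ?a \<rho>"
      unfolding xy power2_eq_square by (simp add: left_diff_distrib right_diff_distrib)
    finally have "?a \<rho> / y = of_real (1 - \<rho>) * y + of_real \<rho> * inverse y"
      using y0 by (simp only: divide_eq_eq) simp
    moreover have "Re (complex_of_real r * z) = r * Re z" for r z by simp
    ultimately have eq: "Re (?a \<rho> / y) = (1 - \<rho>) * Re y + \<rho> * Re (inverse y)"
      by (simp only: plus_complex.sel)
    have inv: "Re (inverse y) > 0"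
      using Re by (simp only: inverse_complex.sel) (simp add: sum_power2_gt_zero_iff)
    show ?thesis
    proof (cases "\<rho> = 0")
      case False
      then have "\<rho> * Re (inverse y) > 0" using r(1) inv by (intro mult_pos_pos) auto
      moreover have "(1 - \<rho>) * Re y \<ge> 0" using r Re by simp
      ultimately show ?thesis unfolding eq by linarith
    qed (use eq Re in simp)
  qed
  then have "\<And>a. a \<in> set (map ?a \<rho>s) \<Longrightarrow> Re (a / y) > 0" by auto
  from sum_squares_minus_shifted_products_nonzero[of y "map ?a \<rho>s", OF y0 this] have
    "poly (complex_poly (defect_poly c e)) x \<noteq> 0"
    unfolding defect_poly_eval[OF xy E] length_map E(2) using k by simp
  with x show False by simp
qed

text \<open>At \<open>x = 1\<close> the numbers \<open>\<rho>\<close> drop out of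
  \<open>x + \<rho> (1 - x)\<close>, which leaves a sum of nonnegative terms, the first of them
  positive. The value serves to fix the sign of the leading coefficient.\<close>

lemma defect_poly_pos_at_1:
  assumes E: "(\<Sum>i\<le>e. monom (c i) i) = smult k (\<Prod>\<rho>\<leftarrow>\<rho>s. [:\<rho>, 1:])" "length \<rho>s = e" and k: "k \<noteq> 0"
  shows "poly (defect_poly c e) 1 > 0"
proof -
  define S :: real where "S = (\<Sum>j\<le>e. fact (2 * j) / (fact j * fact (Suc j)) * coeff ([:2, 1:] ^ e) (2 * j))"
  have nonneg: "coeff ([:2, 1:] ^ n) i \<ge> (0 :: real)" for n i
  proof (induction n arbitrary: i)
    case 0
    then show ?case by (cases i) auto
  next
    case (Suc n)
    then show ?case by (cases i) auto
  qed
  have "coeff ([:2, 1:] ^ n) 0 > (0 :: real)" for n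
    by (induction n) (auto simp: coeff_mult)
  then have "S > 0"
    unfolding S_def
  proof (intro sum_pos2[of _ 0])
    show "0 \<le> fact (2 * j) / (fact j * fact (Suc j)) * coeff ([:2, 1 :: real:] ^ e) (2 * j)" for j
      by (rule mult_nonneg_nonneg[OF _ nonneg]) (simp del: fact_Suc)
  qed (simp_all del: power_Suc)
  have 1: "(1 :: complex) = 1\<^sup>2" by simp
  have "of_real (poly (defect_poly c e) 1) = poly (complex_poly (defect_poly c e)) 1"
    using poly_complex_poly_of_real[of "defect_poly c e" 1] by simp
  also have "\<dots> = (of_real k)\<^sup>2 * (\<Sum>j\<le>e. fact (2 * j) / (fact j * fact (Suc j)) * coeff ([:2, 1:] ^ e) (2 * j))"
    unfolding defect_poly_eval[OF 1 E]
    using sum_squares_minus_shifted_products[of "1 :: complex" "replicate e 1"] E(2)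
    by (simp add: map_replicate_const del: fact_Suc)
  also have "[:2, 1:] ^ e = complex_poly ([:2, 1:] ^ e)"
    by (simp add: complex_poly_power map_poly_pCons)
  also have "(of_real k)\<^sup>2 * (\<Sum>j\<le>e. fact (2 * j) / (fact j * fact (Suc j)) * coeff (complex_poly ([:2, 1:] ^ e)) (2 * j)) =
      complex_of_real (k\<^sup>2 * S)"
    by (simp add: S_def coeff_map_poly del: fact_Suc)
  finally have "poly (defect_poly c e) 1 = k\<^sup>2 * S" by (simp only: of_real_eq_iff)
  then show ?thesis using k \<open>S > 0\<close> by simp
qed

section \<open>A sufficient criterion: rational functions with nonpositive zeros\<close>

lemma polya_frequency_coeff_prod:
  assumes "\<And>s. s \<in> set ss \<Longrightarrow> s \<ge> 0"
  shows "polya_frequency (coeff (\<Prod>s\<leftarrow>ss. [:s, 1:]))"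
  using assms
proof (induction ss)
  case Nil
  have "coeff (\<Prod>s\<leftarrow>[]. [:s, 1:]) = (\<lambda>k. if k = 0 then 1 else (0 :: real))"
    by (rule ext) (simp add: coeff_1)
  then show ?case using polya_frequency_delta by simp
next
  case (Cons s ss)
  let ?q = "\<Prod>s\<leftarrow>ss. [:s, 1:]"
  have "coeff (\<Prod>s\<leftarrow>s # ss. [:s, 1:]) = (\<lambda>k. s * coeff ?q k + (if k = 0 then 0 else coeff ?q (k - 1)))"
  proof
    fix k
    show "coeff (\<Prod>s\<leftarrow>s # ss. [:s, 1:]) k = s * coeff ?q k + (if k = 0 then 0 else coeff ?q (k - 1))"
      by (cases k) simp_all
  qed
  then show ?case using polya_frequency_linear_factor[of "coeff ?q" s] Cons by simp
qed

text \<open>Each factor \<open>1 - x\<close> in the denominator is undone by one passage to partial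
  sums, starting from the coefficients of a product of factors \<open>s + x\<close>.\<close>

lemma polya_frequency_rational:
  assumes "Abs_fps a * fps_of_poly ([:1, -1:] ^ n) = fps_of_poly (smult L (\<Prod>s\<leftarrow>ss. [:s, 1:]))"
    "L \<ge> 0" "\<And>s. s \<in> set ss \<Longrightarrow> s \<ge> 0"
  shows "polya_frequency a"
  using assms(1)
proof (induction n arbitrary: a)
  case 0
  then have "Abs_fps a = fps_of_poly (smult L (\<Prod>s\<leftarrow>ss. [:s, 1:]))" by simp
  then have "a = (\<lambda>k. L * coeff (\<Prod>s\<leftarrow>ss. [:s, 1:]) k)"
    by (metis (no_types, lifting) ext coeff_smult fps_nth_Abs_fps fps_of_poly_nth)
  then show ?case
    using polya_frequency_scale[OF polya_frequency_coeff_prod[OF assms(3)] assms(2)] by simp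
next
  case (Suc n)
  define b where "b k = a k - (if k = 0 then 0 else a (k - 1))" for k
  have "Abs_fps b = Abs_fps a * fps_of_poly [:1, -1:]"
    by (rule fps_ext) (simp only: fps_linear_nth b_def fps_nth_Abs_fps)
  then have "Abs_fps b * fps_of_poly ([:1, -1:] ^ n) = Abs_fps a * fps_of_poly ([:1, -1:] ^ Suc n)"
    by (simp only: power_Suc fps_of_poly_mult mult.assoc)
  then have "polya_frequency b" using Suc.IH[of b] Suc.prems by simp
  then have "polya_frequency (\<lambda>k. \<Sum>l\<le>k. b l)" by (rule polya_frequency_partial_sums)
  moreover have "(\<Sum>l\<le>k. b l) = a k" for k by (induction k) (simp_all add: b_def)
  ultimately show ?case by simp
qed

text \<open>A shift of the columns of the Toeplitz matrix; the dropped zeros supply the entries that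
  must vanish below the diagonal.\<close>

lemma polya_frequency_drop_zeros:
  assumes "polya_frequency a" "\<And>k. k < s \<Longrightarrow> a k = 0"
  shows "polya_frequency (\<lambda>k. a (k + s))"
  unfolding polya_frequency_def totally_nonnegative_def
proof (intro allI impI)
  fix n and r c :: "nat \<Rightarrow> nat"
  assume r: "strict_mono_on {..<n} r" and c: "strict_mono_on {..<n} c"
  have "toeplitz (\<lambda>k. a (k + s)) i j = toeplitz a i (j + s)" for i j
    using assms(2)[of "j + s - i"] by (auto simp: toeplitz_def)
  moreover have "strict_mono_on {..<n} (\<lambda>j. c j + s)" using c by (simp add: strict_mono_on_def)
  ultimately show "0 \<le> det (mat n n (\<lambda>(i, j). toeplitz (\<lambda>k. a (k + s)) (r i) (c j)))"
    using assms(1) r by (simp add: polya_frequency_def totally_nonnegative_def)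
qed

section \<open>Zeros of the numerator of a Polya frequency generating function\<close>

lemma alternating_fps_mult:
  fixes F G :: "real fps"
  shows "Abs_fps (\<lambda>n. (-1) ^ n * fps_nth (F * G) n) =
    Abs_fps (\<lambda>n. (-1) ^ n * fps_nth F n) * Abs_fps (\<lambda>n. (-1) ^ n * fps_nth G n)"
proof (rule fps_ext)
  fix n
  have "(-1) ^ n * (fps_nth F i * fps_nth G (n - i)) =
      ((-1) ^ i * fps_nth F i) * ((-1) ^ (n - i) * fps_nth G (n - i))" if "i \<le> n" for i
  proof -
    have "(-1 :: real) ^ n = (-1) ^ i * (-1) ^ (n - i)" using that by (simp add: power_add[symmetric])
    then show ?thesis by simp
  qed
  then show "fps_nth (Abs_fps (\<lambda>n. (-1) ^ n * fps_nth (F * G) n)) n =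
    fps_nth (Abs_fps (\<lambda>n. (-1) ^ n * fps_nth F n) * Abs_fps (\<lambda>n. (-1) ^ n * fps_nth G n)) n"
    unfolding fps_nth_Abs_fps fps_mult_nth sum_distrib_left by (intro sum.cong) auto
qed

lemma alternating_fps_of_poly:
  fixes p :: "real poly"
  shows "Abs_fps (\<lambda>n. (-1) ^ n * fps_nth (fps_of_poly p) n) = fps_of_poly (pcompose p [:0, -1:])"
  by (rule fps_ext) (simp add: coeff_pcompose_linear)

lemma poly_nonzero_imp_coprime_power:
  fixes q :: "real poly"
  assumes "poly q (-1) \<noteq> 0"
  shows "coprime q ([:1, 1:] ^ n)"
proof -
  define k where "k = poly q (-1)"
  have "q = [:k:] + [:- (- 1), 1:] * synthetic_div q (- 1)"
    using synthetic_div_correct'[of "-1" q] by (simp add: k_def add.commute)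
  then have "[:k:] = q - [:1, 1:] * synthetic_div q (- 1)" by (simp add: algebra_simps)
  moreover have "smult k p = [:k:] * p" for p by simp
  ultimately have k: "smult k p = q * p - [:1, 1:] * p * synthetic_div q (- 1)" for p
    by (simp only: left_diff_distrib right_diff_distrib ac_simps)
  show ?thesis
  proof (rule coprimeI)
    fix d assume d: "d dvd q" and "d dvd [:1, 1:] ^ n"
    from this(2) show "is_unit d"
    proof (induction n)
      case (Suc n)
      have "d dvd q * [:1, 1:] ^ n - [:1, 1:] ^ Suc n * synthetic_div q (- 1)"
        using d Suc.prems by (intro dvd_diff dvd_mult2) auto
      then have "d dvd smult k ([:1, 1:] ^ n)" unfolding k by (simp only: power_Suc)
      then have "d dvd [:1, 1:] ^ n" by (rule dvd_smult_cancel) (use assms in \<open>simp add: k_def\<close>)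
      then show ?case by (rule Suc.IH)
    qed simp
  qed
qed

text \<open>If \<open>f\<close> generates a Polya frequency sequence then so does \<open>1 / f(-x)\<close>, and the zeros of \<open>f\<close> are
  read off from the poles of the latter.\<close>
lemma polya_frequency_numerator_roots:
  fixes g :: "real poly"
  assumes A: "polya_frequency A" and g: "Abs_fps A * fps_of_poly ([:1, -1:] ^ N) = fps_of_poly g"
    and g1: "poly g 1 \<noteq> 0" and z: "poly (complex_poly g) z = 0"
  shows "\<exists>t\<le>0. z = of_real t"
proof -
  have "\<exists>k. A k \<noteq> 0"
  proof (rule ccontr)
    assume "\<nexists>k. A k \<noteq> 0"
    then have "Abs_fps A = 0" by (intro fps_ext) simp
    then have "fps_of_poly g = fps_of_poly 0" using g by simp
    then show False using g1 by (simp only: fps_of_poly_eq_iff poly_0)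
  qed
  \<comment> \<open>Leading zeros are stripped to make the series invertible; they account for the
    zero of \<open>g\<close> at 0.\<close>
  define s where "s = (LEAST k. A k \<noteq> 0)"
  have As: "A s \<noteq> 0" unfolding s_def using \<open>\<exists>k. A k \<noteq> 0\<close> by (rule LeastI_ex)
  have low: "A k = 0" if "k < s" for k using not_less_Least[of k "\<lambda>k. A k \<noteq> 0"] that by (auto simp: s_def)
  define a where "a k = A (k + s)" for k
  have a: "polya_frequency a" unfolding a_def by (rule polya_frequency_drop_zeros[OF A low])
  have a0: "a 0 > 0"
    using col_pf_nonneg[OF polya_frequency_imp_col_pf[OF a], of 0] As by (simp add: a_def)
  have "Abs_fps A = fps_X ^ s * Abs_fps a"
    by (rule fps_ext) (simp add: fps_X_power_mult_nth a_def low)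
  then have gs: "fps_of_poly g = fps_X ^ s * (Abs_fps a * fps_of_poly ([:1, -1:] ^ N))"
    using g by (simp add: mult.assoc)
  define h where "h = poly_shift s g"
  have h: "Abs_fps a * fps_of_poly ([:1, -1:] ^ N) = fps_of_poly h"
  proof (rule fps_ext)
    fix n
    have "fps_nth (fps_of_poly h) n = fps_nth (fps_of_poly g) (n + s)" by (simp add: h_def coeff_poly_shift)
    then show "fps_nth (Abs_fps a * fps_of_poly ([:1, -1:] ^ N)) n = fps_nth (fps_of_poly h) n"
      unfolding gs fps_X_power_mult_nth by simp
  qed
  have gh: "g = monom 1 s * h"
  proof -
    have "fps_of_poly g = fps_of_poly (monom 1 s * h)"
      unfolding gs h by (simp add: fps_of_poly_mult fps_of_poly_monom)
    then show ?thesis by (simp only: fps_of_poly_eq_iff)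
  qed
  define F where "F = Abs_fps (\<lambda>n. (-1) ^ n * a n)"
  define b where "b = fps_nth (inverse F)"
  have "fps_nth F 0 \<noteq> 0" using a0 by (simp add: F_def)
  then have Fb: "F * Abs_fps b = 1" by (simp add: b_def fps_nth_inverse inverse_mult_eq_1')
  have "col_pf b"
  proof (rule col_pf_inverse[OF a a0])
    fix k
    have "(\<Sum>l\<le>k. (-1) ^ l * a l * b (k - l)) = fps_nth (F * Abs_fps b) k"
      by (simp add: fps_mult_nth F_def atLeast0AtMost)
    then show "(\<Sum>l\<le>k. (-1) ^ l * a l * b (k - l)) = (if k = 0 then 1 else 0)" unfolding Fb by simp
  qed
  moreover have "b 0 > 0" using a0 by (simp add: b_def F_def)
  \<comment> \<open>\<open>q(x) = h(-x)\<close>, so \<open>b\<close> has generating function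
    \<open>(1 + x)^N / q(x)\<close>. The assumption on \<open>g\<close> at 1 makes this fraction
    reduced, and all its poles are then found by ratios.\<close>
  define q where "q = pcompose h [:0, -1:]"
  have Fq: "F * fps_of_poly ([:1, 1:] ^ N) = fps_of_poly q"
  proof -
    have "pcompose ([:1, -1 :: real:] ^ N) [:0, -1:] = [:1, 1:] ^ N"
      by (induction N) (simp_all add: pcompose_mult pcompose_pCons pcompose_1 del: mult_pCons_left)
    then show ?thesis
      using alternating_fps_mult[of "Abs_fps a" "fps_of_poly ([:1, -1:] ^ N)"]
      unfolding h alternating_fps_of_poly by (simp add: q_def F_def)
  qed
  have "fps_of_poly q * Abs_fps b = fps_of_poly ([:1, 1:] ^ N)"
    unfolding Fq[symmetric] using Fb by (simp add: mult.assoc mult.left_commute mult.commute)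
  moreover have "coprime q ([:1, 1:] ^ N)"
    by (rule poly_nonzero_imp_coprime_power) (use g1 in \<open>simp add: q_def gh poly_pcompose poly_monom\<close>)
  moreover have "coeff q 0 \<noteq> 0"
  proof -
    have "coeff q 0 = fps_nth (F * fps_of_poly ([:1, 1:] ^ N)) 0" unfolding Fq by simp
    also have "\<dots> = a 0" by (simp add: F_def coeff_0_power)
    finally show ?thesis using a0 by simp
  qed
  ultimately obtain ls where ls: "\<forall>l\<in>set ls. l > 0" "q = smult (coeff q 0) (\<Prod>l\<leftarrow>ls. [:1, -l:])"
    using col_pf_rational_denominator \<open>b 0 > 0\<close> by blast
  have "h = pcompose q [:0, -1:]"
    by (rule poly_eqI) (simp add: q_def coeff_pcompose_linear power_mult_distrib[symmetric] mult.assoc[symmetric])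
  also have "\<dots> = smult (coeff q 0) (pcompose (\<Prod>l\<leftarrow>ls. [:1, -l:]) [:0, -1:])"
    by (rule trans[OF arg_cong[OF ls(2), of "\<lambda>q. pcompose q [:0, -1:]"] pcompose_smult])
  also have "pcompose (\<Prod>l\<leftarrow>ls. [:1, -l:]) [:0, -1:] = (\<Prod>l\<leftarrow>ls. [:1, l:])"
    by (induction ls) (simp_all add: pcompose_mult pcompose_pCons pcompose_1 del: mult_pCons_left)
  finally have "poly (complex_poly g) z = z ^ s * (of_real (coeff q 0) * poly (\<Prod>l\<leftarrow>ls. [:1, of_real l:]) z)"
    unfolding gh by (simp add: complex_poly_mult complex_poly_smult complex_poly_prod_list map_poly_monom poly_monom map_poly_pCons o_def)
  then have "z = 0 \<or> poly (\<Prod>l\<leftarrow>ls. [:1, complex_of_real l:]) z = 0"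
    using z \<open>coeff q 0 \<noteq> 0\<close> by auto
  then show ?thesis
  proof
    assume "poly (\<Prod>l\<leftarrow>ls. [:1, complex_of_real l:]) z = 0"
    then have "\<exists>l\<in>set ls. 1 + z * complex_of_real l = 0"
      by (induction ls) (auto simp del: mult_pCons_left)
    then obtain l where l: "l \<in> set ls" "1 + z * of_real l = 0" by blast
    then have "l > 0" using ls(1) by blast
    then have "z = of_real (- 1 / l)" using l(2) by (simp add: field_simps add_eq_0_iff)
    moreover have "- 1 / l \<le> 0" using \<open>l > 0\<close> by simp
    ultimately show ?thesis by blast
  qed (auto intro!: exI[of _ 0])
qed

lemma newton_expansion:
  fixes p :: "real poly"
  assumes "degree p \<le> n"
  shows "\<exists>c. (\<forall>x. poly p x = (\<Sum>j\<le>n. c j * (x gchoose j))) \<and> c n = coeff p n * fact n"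
  using assms
proof (induction n arbitrary: p)
  case 0
  then have "degree p = 0" by simp
  then obtain a where "p = [:a:]" by (rule degree_eq_zeroE)
  then show ?case by (intro exI[of _ "\<lambda>_. a"]) simp
next
  case (Suc n)
  define k where "k = coeff p (Suc n) * fact (Suc n)"
  define q where "q = smult (1 / fact (Suc n)) (\<Prod>i<Suc n. [:- of_nat i, 1 :: real:])"
  have q: "poly q x = (x gchoose Suc n)" for x
    by (simp add: q_def gbinomial_prod_rev poly_prod atLeast0LessThan del: fact_Suc prod.lessThan_Suc)
  have deg: "degree (\<Prod>i<m. [:- of_nat i, 1 :: real:]) = m \<and> coeff (\<Prod>i<m. [:- of_nat i, 1 :: real:]) m = 1" for m
  proof (induction m)
    case (Suc m)
    let ?p = "\<Prod>i<m. [:- of_nat i, 1 :: real:]"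
    have "coeff (?p * [:- of_nat m, 1:]) (Suc m) = 1"
      using Suc by (simp add: mult_pCons_right coeff_eq_0)
    moreover have "degree (?p * [:- of_nat m, 1:]) = Suc m"
    proof (rule antisym)
      show "degree (?p * [:- of_nat m, 1:]) \<le> Suc m"
        using degree_mult_le[of ?p "[:- of_nat m, 1:]"] Suc by simp
      show "Suc m \<le> degree (?p * [:- of_nat m, 1:])"
        by (rule le_degree) (simp only: calculation)
    qed
    ultimately show ?case by (simp only: prod.lessThan_Suc)
  qed simp
  then have "degree q \<le> Suc n" "coeff q (Suc n) = 1 / fact (Suc n)"
    using deg[of "Suc n"] by (simp_all add: q_def del: fact_Suc prod.lessThan_Suc)
  have "degree (p - smult k q) \<le> n"
  proof (rule degree_le, intro allI impI)
    fix i assume "n < i"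
    then consider "i = Suc n" | "i > Suc n" by linarith
    then show "coeff (p - smult k q) i = 0"
      using \<open>degree q \<le> Suc n\<close> \<open>coeff q (Suc n) = 1 / fact (Suc n)\<close> Suc.prems
      by cases (simp_all add: k_def coeff_eq_0 del: fact_Suc)
  qed
  then obtain c where c: "\<forall>x. poly (p - smult k q) x = (\<Sum>j\<le>n. c j * (x gchoose j))"
    using Suc.IH by blast
  define c' where "c' = c(Suc n := k)"
  have "poly p x = (\<Sum>j\<le>Suc n. c' j * (x gchoose j))" for x
  proof -
    have "poly p x = poly (p - smult k q) x + k * (x gchoose Suc n)" by (simp add: q)
    also have "\<dots> = (\<Sum>j\<le>n. c j * (x gchoose j)) + k * (x gchoose Suc n)" using c by simp
    also have "\<dots> = (\<Sum>j\<le>Suc n. c' j * (x gchoose j))" by (simp add: c'_def)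
    finally show ?thesis .
  qed
  then show ?case by (intro exI[of _ c']) (simp add: c'_def k_def)
qed

section \<open>The classes are preserved\<close>

lemma polya_frequency_L_op:
  fixes p :: "real poly" and u :: nat
  assumes A: "polya_frequency A" and p: "interpolates p A" and u: "u \<le> 2"
    and roots: "poly p (- real u) = 0" "poly p (1 - real u) = 0"
  shows "polya_frequency (L_op A)"
    and "interpolates (p\<^sup>2 - pcompose p [:-1, 1:] * pcompose p [:1, 1:]) (L_op A)"
proof -
  have pA: "A k = poly p (real k)" for k using p by (simp add: interpolates_def)
  \<comment> \<open>At \<open>k = 0\<close> the convention drops \<open>p(-1) p(1)\<close>, which is
    0 anyway: one of \<open>-1\<close> and \<open>1\<close> is a prescribed zero for each
    \<open>u\<close>.\<close>
  have L: "L_op A k = (poly p (real k))\<^sup>2 - poly p (real k - 1) * poly p (real k + 1)" for k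
  proof (cases "k = 0")
    case True
    have "poly p (-1) * poly p 1 = 0"
    proof -
      have "u = 0 \<or> u = 1 \<or> u = 2" using u by linarith
      then show ?thesis using roots by auto
    qed
    then show ?thesis using True by (simp add: L_op_def pA)
  next
    case False
    then have "real (k - 1) = real k - 1" by (simp add: of_nat_diff)
    then show ?thesis using False by (simp add: L_op_def pA add.commute)
  qed
  then show "interpolates (p\<^sup>2 - pcompose p [:-1, 1:] * pcompose p [:1, 1:]) (L_op A)"
    by (simp add: interpolates_def poly_pcompose add.commute)
  show "polya_frequency (L_op A)"
  proof (cases "p = 0")
    case True
    then have "L_op A = (\<lambda>k. 0 * (if k = 0 then 1 else 0))" by (intro ext) (simp add: L)
    then show ?thesis using polya_frequency_scale[OF polya_frequency_delta, of 0] by simp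
  next
    case False
    define r where "r = pcompose p [:- real u, 1:]"
    have r: "poly r x = poly p (x - real u)" for x by (simp add: r_def poly_pcompose)
    have r0: "r \<noteq> 0" unfolding r_def using False pcompose_eq_0[of p "[:- real u, 1:]"] by auto
    have "degree r \<ge> 2"
    proof -
      have "{0, 1} \<subseteq> {x. poly r x = 0}" using roots by (simp add: r)
      then have "card {0, 1 :: real} \<le> card {x. poly r x = 0}"
        by (intro card_mono poly_roots_finite r0)
      also have "\<dots> \<le> degree r" by (rule card_poly_roots_bound[OF r0])
      finally show ?thesis by simp
    qed
    then obtain e where e: "degree r = Suc (Suc e)" by (metis add_2_eq_Suc le_Suc_ex)
    obtain c where c: "\<And>x. poly r x = (\<Sum>j\<le>Suc (Suc e). c j * (x gchoose j))" "c (Suc (Suc e)) = lead_coeff r * fact (Suc (Suc e))"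
      using newton_expansion[of r "Suc (Suc e)"] e by auto
    have expand: "poly r x = c 0 + c 1 * x + (\<Sum>i\<le>e. c (i + 2) * (x gchoose (i + 2)))" for x
      unfolding c(1) by (simp add: sum.atMost_Suc_shift del: sum.atMost_Suc gbinomial_Suc)
    have c0: "c 0 = 0" using c(1)[of 0] roots(1) by (simp add: r sum.atMost_Suc_shift del: sum.atMost_Suc)
    have c1: "c 1 = 0"
    proof -
      have "(1 :: real) gchoose (i + 2) = 0" for i
        using binomial_gbinomial[of 1 "i + 2", where ?'a = real] by simp
      then show ?thesis using expand[of 1] roots(2) c0 by (simp add: r)
    qed
    define d where "d i = c (i + 2)" for i
    have P: "poly r x = (\<Sum>i\<le>e. d i * (x gchoose (i + 2)))" for x
      unfolding expand c0 c1 by (simp add: d_def)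
    have d0: "d e \<noteq> 0" using c(2) r0 by (simp add: d_def del: fact_Suc)
    have cancel: "X = Y" if "fps_X ^ u * X = fps_X ^ u * Y" for X Y :: "real fps" using that by simp
    \<comment> \<open>The indices below \<open>u\<close> are among 0 and 1, which are zeros of the
      translate \<open>r\<close>. Hence its series is \<open>x^u\<close> times that of
      \<open>A\<close>, and \<open>x^(2 - u)\<close> is what remains of the factor
      \<open>x^2\<close>.\<close>
    have low: "k = 0 \<or> k = 1 \<and> u = 2" if "k < u" for k using that u by linarith
    have two: "monom 1 2 = monom 1 u * (monom 1 (2 - u) :: real poly)" using u by (simp add: mult_monom)

    define g where "g = monom 1 (2 - u) * shifted_coeff_poly d e 0"
    have "Abs_fps (\<lambda>k. poly r (real k)) = fps_X ^ u * Abs_fps A"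
    proof (rule fps_ext)
      fix k
      show "fps_nth (Abs_fps (\<lambda>k. poly r (real k))) k = fps_nth (fps_X ^ u * Abs_fps A) k"
        using low[of k] roots by (auto simp: fps_X_power_mult_nth r pA of_nat_diff)
    qed
    with fps_newton_numerator[of d e]
    have "fps_X ^ u * (Abs_fps A * fps_of_poly ([:1, -1:] ^ (e + 3))) = fps_X ^ u * fps_of_poly g"
      unfolding P g_def two by (simp only: mult.assoc fps_of_poly_mult fps_of_poly_monom fps_const_1_eq_1 mult_1_left)
    then have g: "Abs_fps A * fps_of_poly ([:1, -1:] ^ (e + 3)) = fps_of_poly g" by (rule cancel)
    \<comment> \<open>At 1 only the summand \<open>i = e\<close> survives, so the numerator has no
      factor \<open>1 - x\<close>.\<close>
    have g1: "poly g 1 = d e"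
    proof -
      have "poly (shifted_coeff_poly d e 0) 1 = (\<Sum>i\<le>e. if i = e then d e else 0)"
        unfolding shifted_coeff_poly_def poly_sum by (rule sum.cong) (auto simp: poly_monom)
      then show ?thesis by (simp add: g_def poly_monom)
    qed
    define E where "E = (\<Sum>i\<le>e. monom (d i) i)"
    have cE: "coeff E i = (if i \<le> e then d i else 0)" for i by (simp add: E_def coeff_sum)
    have degE: "degree E = e"
      by (rule antisym) (use d0 in \<open>auto intro: degree_le le_degree simp: cE\<close>)
    have leadE: "lead_coeff E = d e" by (simp add: degE cE)
    text \<open>The substitution \<open>x = z / (1 + z)\<close> carries the zeros of \<open>E\<close> to those of \<open>g\<close>.\<close>
    have E_roots: "\<exists>t. -1 \<le> t \<and> t \<le> 0 \<and> z = of_real t" if z: "poly (complex_poly E) z = 0" for z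
    proof (cases "z = -1")
      \<comment> \<open>The substitution sends \<open>-1\<close> to infinity, so \<open>g\<close>
        says nothing about it; it is an endpoint of the allowed interval.\<close>
      case True
      then show ?thesis by (intro exI[of _ "-1"]) simp
    next
      case False
      then have z1: "1 + z \<noteq> 0" by (simp add: add_eq_0_iff)
      define x where "x = z / (1 + z)"
      have "1 - x = 1 / (1 + z)" using z1 by (simp add: x_def field_simps)
      then have pw: "x ^ i * (1 - x) ^ (e - i) = z ^ i / (1 + z) ^ e" if "i \<le> e" for i
        using that by (simp add: x_def power_divide power_add[symmetric])
      have "poly (complex_poly (shifted_coeff_poly d e 0)) x = (\<Sum>i\<le>e. of_real (d i) * (x ^ i * (1 - x) ^ (e - i)))"
        by (simp add: shifted_coeff_poly_def complex_poly_sum complex_poly_smult complex_poly_mult complex_poly_power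
            map_poly_monom map_poly_pCons poly_sum poly_monom)
      also have "\<dots> = poly (complex_poly E) z / (1 + z) ^ e"
        by (simp add: pw E_def complex_poly_sum map_poly_monom poly_sum poly_monom sum_divide_distrib)
      finally have "poly (complex_poly g) x = 0" using z by (simp add: g_def complex_poly_mult)
      then obtain t where t: "t \<le> 0" "x = of_real t"
        using polya_frequency_numerator_roots[OF A g] g1 d0 by metis
      have "z = x * (1 + z)" using z1 by (simp add: x_def)
      then have "z * (1 - of_real t) = of_real t" unfolding t(2) by (simp add: algebra_simps)
      then have "z = of_real t / of_real (1 - t)"
        using t(1) by (simp add: eq_divide_eq del: of_real_diff) (simp add: complex_eq_iff)
      then have zt: "z = of_real (t / (1 - t))" by simp
      have "-1 \<le> t / (1 - t)" "t / (1 - t) \<le> 0"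
        using t(1) by (simp_all add: pos_le_divide_eq divide_nonpos_pos)
      then show ?thesis by (intro exI[of _ "t / (1 - t)"] conjI zt)
    qed
    have "E \<noteq> 0"
    proof
      assume "E = 0"
      then have "lead_coeff E = 0" by simp
      then show False using leadE d0 by simp
    qed
    moreover have "\<exists>t\<le>0. z = of_real t" if "poly (complex_poly E) z = 0" for z
      using E_roots[OF that] by blast
    ultimately obtain \<rho>s where \<rho>s: "\<forall>\<rho>\<in>set \<rho>s. \<rho> \<ge> 0 \<and> poly E (-\<rho>) = 0" "length \<rho>s = degree E"
      "E = smult (lead_coeff E) (\<Prod>\<rho>\<leftarrow>\<rho>s. [:\<rho>, 1:])"
      using real_poly_nonpos_roots_factor[of E] by blast
    have \<rho>: "0 \<le> \<rho> \<and> \<rho> \<le> 1" if "\<rho> \<in> set \<rho>s" for \<rho>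
    proof -
      have "poly (complex_poly E) (of_real (-\<rho>)) = 0"
        using \<rho>s(1) that by (simp only: poly_complex_poly_of_real) simp
      from E_roots[OF this] have "-1 \<le> -\<rho>" by (metis of_real_eq_iff)
      then show ?thesis using \<rho>s(1) that by auto
    qed
    have E: "(\<Sum>i\<le>e. monom (d i) i) = smult (d e) (\<Prod>\<rho>\<leftarrow>\<rho>s. [:\<rho>, 1:])" "length \<rho>s = e"
      using \<rho>s(2,3) leadE degE by (simp_all only: E_def)

    define G where "G = defect_poly d e"
    have G1: "poly G 1 > 0" unfolding G_def by (rule defect_poly_pos_at_1[OF E d0])
    then have "G \<noteq> 0" by auto
    then obtain ss where ss: "\<forall>s\<in>set ss. s \<ge> 0 \<and> poly G (-s) = 0" "G = smult (lead_coeff G) (\<Prod>s\<leftarrow>ss. [:s, 1:])"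
      using real_poly_nonpos_roots_factor[of G] defect_poly_roots[OF E d0 \<rho>] unfolding G_def by blast
    \<comment> \<open>With all \<open>s >= 0\<close> this product is positive at 1, so the leading
      coefficient inherits the sign of \<open>G\<close> at 1.\<close>
    have "poly (\<Prod>s\<leftarrow>ss. [:s, 1:]) 1 > 0" using ss(1) by (induction ss) (auto intro!: mult_pos_pos simp del: mult_pCons_left)
    moreover have "poly G 1 = lead_coeff G * poly (\<Prod>s\<leftarrow>ss. [:s, 1:]) 1" by (subst ss(2)) simp
    ultimately have leadG: "lead_coeff G > 0" using G1 by (simp add: zero_less_mult_iff)
    have shift: "monom 1 n = (\<Prod>s\<leftarrow>replicate n 0. [:s, 1 :: real:])" for n
      by (induction n) (simp_all add: monom_Suc monom_0 one_pCons)
    have factor: "monom 1 (2 - u) * G = smult (lead_coeff G) (\<Prod>s\<leftarrow>replicate (2 - u) 0 @ ss. [:s, 1:])"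
      by (subst ss(2)) (simp only: shift map_append prod_list.append mult_smult_right)
    have "Abs_fps (\<lambda>k. (poly r (real k))\<^sup>2 - poly r (real k - 1) * poly r (real k + 1)) = fps_X ^ u * Abs_fps (L_op A)"
    proof (rule fps_ext)
      fix k
      show "fps_nth (Abs_fps (\<lambda>k. (poly r (real k))\<^sup>2 - poly r (real k - 1) * poly r (real k + 1))) k =
        fps_nth (fps_X ^ u * Abs_fps (L_op A)) k"
      proof (cases "k < u")
        case True
        then show ?thesis using low[OF True] roots by (auto simp: fps_X_power_mult_nth r)
      next
        case False
        then have "real k - real u = real (k - u)" "real k - 1 - real u = real (k - u) - 1"
          "real k + 1 - real u = real (k - u) + 1" by (simp_all add: of_nat_diff)
        then show ?thesis using False by (simp only: fps_X_power_mult_nth r L fps_nth_Abs_fps if_False)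
      qed
    qed
    with fps_defect_numerator[of "poly r" d e, OF P]
    have "fps_X ^ u * (Abs_fps (L_op A) * fps_of_poly ([:1, -1:] ^ (2 * e + 3))) = fps_X ^ u * fps_of_poly (monom 1 (2 - u) * G)"
      unfolding two G_def by (simp only: mult.assoc fps_of_poly_mult fps_of_poly_monom fps_const_1_eq_1 mult_1_left)
    then have "Abs_fps (L_op A) * fps_of_poly ([:1, -1:] ^ (2 * e + 3)) = fps_of_poly (monom 1 (2 - u) * G)"
      by (rule cancel)
    then show ?thesis unfolding factor
      by (rule polya_frequency_rational) (use leadG ss(1) in \<open>auto split: if_splits\<close>)
  qed
qed

text \<open>Consecutive zeros are inherited: \<open>p(x)\<close> vanishes at both points, while
  \<open>p(x + 1)\<close> vanishes at \<open>i\<close> and \<open>p(x - 1)\<close> at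
  \<open>i + 1\<close>.\<close>

lemma PF_class_L_op:
  assumes i: "i \<in> {-2, -1, 0}" and A: "A \<in> PF_class i"
  shows "L_op A \<in> PF_class i"
proof -
  obtain p where p: "polya_frequency A" "interpolates p A" "poly p (of_int i) = 0" "poly p (of_int (i + 1)) = 0"
    using A by (auto simp: PF_class_def)
  define u where "u = nat (- i)"
  have u: "u \<le> 2" "of_int i = - real u" "of_int (i + 1) = 1 - real u" using i by (auto simp: u_def)
  note L = polya_frequency_L_op[OF p(1,2) u(1) p(3,4)[unfolded u(2,3)]]
  have eval: "poly (p\<^sup>2 - pcompose p [:-1, 1:] * pcompose p [:1, 1:]) x = (poly p x)\<^sup>2 - poly p (x - 1) * poly p (1 + x)" for x
    by (simp add: poly_pcompose)
  have "poly (p\<^sup>2 - pcompose p [:-1, 1:] * pcompose p [:1, 1:]) (of_int i) = 0"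
    "poly (p\<^sup>2 - pcompose p [:-1, 1:] * pcompose p [:1, 1:]) (of_int (i + 1)) = 0"
    using p(3,4) unfolding eval by (simp_all add: add.commute)
  then show ?thesis using L unfolding PF_class_def by blast
qed

section \<open>Necessity: polynomial interpolation forces one of the classes\<close>

lemma poly_eqI_nat:
  fixes p q :: "real poly"
  assumes "\<And>k. poly p (of_nat (Suc k)) = poly q (of_nat (Suc k))"
  shows "p = q"
proof (rule ccontr)
  assume "p \<noteq> q"
  then have "finite {x. poly (p - q) x = 0}" by (intro poly_roots_finite) simp
  moreover have "range (\<lambda>k. of_nat (Suc k)) \<subseteq> {x. poly (p - q) x = 0}" using assms by auto
  moreover have "infinite (range (\<lambda>k. of_nat (Suc k) :: real))"
    by (rule range_inj_infinite) (auto simp: inj_def)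
  ultimately show False using finite_subset by blast
qed

text \<open>The positive integers already identify \<open>q\<close>, so its value at 0 can be
  compared with the convention in \<open>L_op\<close>; the difference is
  \<open>p(-1) p(1)\<close>.\<close>

lemma L_op_interpolation:
  assumes p: "interpolates p A" and q: "interpolates q (L_op A)"
  shows "poly q x = (poly p x)\<^sup>2 - poly p (x - 1) * poly p (x + 1)"
    and "poly p (-1) * poly p 1 = 0"
proof -
  have "q = p\<^sup>2 - pcompose p [:-1, 1:] * pcompose p [:1, 1:]"
  proof (rule poly_eqI_nat)
    fix k
    have "poly q (of_nat (Suc k)) = L_op A (Suc k)" using q by (simp add: interpolates_def)
    also have "\<dots> = poly (p\<^sup>2 - pcompose p [:-1, 1:] * pcompose p [:1, 1:]) (of_nat (Suc k))"
      using p by (simp add: interpolates_def L_op_def poly_pcompose add.commute)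
    finally show "poly q (of_nat (Suc k)) = poly (p\<^sup>2 - pcompose p [:-1, 1:] * pcompose p [:1, 1:]) (of_nat (Suc k))" .
  qed
  then show eq: "poly q x = (poly p x)\<^sup>2 - poly p (x - 1) * poly p (x + 1)" for x
    by (simp add: poly_pcompose add.commute)
  have "poly q 0 = (poly p 0)\<^sup>2"
    using p[unfolded interpolates_def, rule_format, of 0] q[unfolded interpolates_def, rule_format, of 0]
    by (simp add: L_op_def)
  then show "poly p (-1) * poly p 1 = 0" using eq[of 0] by simp
qed

text \<open>If the sequence starts with a positive term, a zero at index 1 annihilates all later
  terms, and a polynomial with that many zeros is 0.\<close>

lemma polya_frequency_root_at_1:
  assumes "polya_frequency A" "interpolates p A" "poly p 1 = 0"
  shows "p = 0 \<or> poly p 0 = 0"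
proof (cases "A 0 = 0")
  case True
  then show ?thesis using assms(2)[unfolded interpolates_def, rule_format, of 0] by simp
next
  case False
  have col: "col_pf A" by (rule polya_frequency_imp_col_pf[OF assms(1)])
  then have "A 0 > 0" using col_pf_nonneg[OF col, of 0] False by simp
  moreover have "A 1 = 0" using assms(2,3) by (simp add: interpolates_def)
  ultimately have "A (Suc k) = 0" for k using col_pf_zero_tail[OF col, of 1 "Suc k"] by simp
  moreover have "A (Suc k) = poly p (of_nat (Suc k))" for k using assms(2) by (simp only: interpolates_def)
  ultimately have "p = 0" by (intro poly_eqI_nat) simp
  then show ?thesis by simp
qed

lemma PF_class_of_two_steps:
  assumes "polya_frequency A" "polya_frequency (L_op A)"
    and "poly_interpolated A" "poly_interpolated (L_op A)" "poly_interpolated (L_op (L_op A))"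
  shows "A \<in> PF_class 0 \<union> PF_class (-1) \<union> PF_class (-2)"
proof -
  obtain p q s where p: "interpolates p A" and q: "interpolates q (L_op A)" and s: "interpolates s (L_op (L_op A))"
    using assms by (auto simp: poly_interpolated_def)
  note pq = L_op_interpolation[OF p q] and qs = L_op_interpolation(2)[OF q s]
  have classI: "A \<in> PF_class i" if "poly p (of_int i) = 0" "poly p (of_int (i + 1)) = 0" for i
    using that assms(1) p by (auto simp: PF_class_def)
  show ?thesis
  proof (cases "poly p 1 = 0")
    case True
    then have "poly p 0 = 0" using polya_frequency_root_at_1[OF assms(1) p] by auto
    then show ?thesis using classI[of 0] True by simp
  next
    case False
    then have m1: "poly p (-1) = 0" using pq(2) by simp
    \<comment> \<open>The second step, \<open>q(-1) q(1) = 0\<close>, decides between the two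
      remaining classes. Since \<open>p(-1) = 0\<close>, \<open>q(-1) = 0\<close> means
      \<open>p(-2) p(0) = 0\<close>, while \<open>q(1) = 0\<close> forces
      \<open>q(0) = p(0)^2 = 0\<close>.\<close>
    have "poly p 0 = 0 \<or> poly p (-2) = 0"
    proof (cases "poly q (-1) = 0")
      case True
      then show ?thesis using pq(1)[of "-1"] m1 by auto
    next
      case q1: False
      then have "poly q 1 = 0" using qs by simp
      then have "q = 0 \<or> poly q 0 = 0" using polya_frequency_root_at_1[OF assms(2) q] by simp
      then show ?thesis using pq(1)[of 0] m1 by auto
    qed
    then show ?thesis using classI[of "-1"] classI[of "-2"] m1 by auto
  qed
qed

theorem theorem2p1:
  fixes A :: "nat \<Rightarrow> real"
  shows "((\<forall>k. polya_frequency ((L_op ^^ k) A) \<and> poly_interpolated ((L_op ^^ k) A)) \<longleftrightarrow>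
          (poly_interpolated A \<and> poly_interpolated (L_op A) \<and> poly_interpolated (L_op (L_op A)) \<and>
           polya_frequency A \<and> polya_frequency (L_op A)))
       \<and> ((poly_interpolated A \<and> poly_interpolated (L_op A) \<and> poly_interpolated (L_op (L_op A)) \<and>
           polya_frequency A \<and> polya_frequency (L_op A)) \<longleftrightarrow>
          A \<in> PF_class 0 \<union> PF_class (-1) \<union> PF_class (-2))
       \<and> (\<forall>i \<in> {-2, -1, 0}. A \<in> PF_class i \<longrightarrow> L_op A \<in> PF_class i)"
    (is "(?i \<longleftrightarrow> ?ii) \<and> (?ii \<longleftrightarrow> ?iii) \<and> _")
proof -
  have "?ii" if "?i" using that[rule_format, of 0] that[rule_format, of 1] that[rule_format, of 2]
    by (simp add: numeral_2_eq_2)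
  moreover have "?iii" if "?ii" using that by (intro PF_class_of_two_steps) auto
  moreover have "?i" if iii: "?iii"
  proof -
    obtain i where i: "i \<in> {-2, -1, 0}" "A \<in> PF_class i" using iii by blast
    have "(L_op ^^ k) A \<in> PF_class i" for k
      by (induction k) (simp_all only: id_apply i(2) funpow.simps o_apply PF_class_L_op[OF i(1)])
    then show ?thesis unfolding PF_class_def poly_interpolated_def by blast
  qed
  ultimately show ?thesis using PF_class_L_op by blast
qed

end
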